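(* Let $u^1,\dots,u^n:\mathbb{R}^m\to\mathbb{R}$ be smooth functions such that their graph $M=\{(x,u^1(x),\dots,u^n(x)) : x\in\mathbb{R}^m\}$ is a spacelike translating soliton in $\mathbb{R}^{m+n}_n$. If the Gauss image of $M$ is bounded, then $M$ is an affine $m$-plane.
   Context: $\mathbb{R}^{m+n}_n$ is the linear space $\mathbb{R}^{m+n}$ with the indefinite metric $\langle\cdot,\cdot\rangle = \sum_{i=1}^m (dx^i)^2-\sum_{\alpha=m+1}^{m+n}(dx^\alpha)^2$. A graph over $\mathbb{R}^m$ is spacelike if the induced metric $g_{ij}=\delta_{ij}-\sum_{\alpha=1}^n \frac{\partial u^\alpha}{\partial x_i}\frac{\partial u^\alpha}{\partial x_j}$ is positive definite everywhere. With $\overline\nabla$ the flat connection and $(\cdot)^\perp$ the orthogonal projection (with respect to $\langle\cdot,\cdot\rangle$) onto the normal bundle, the second fundamental form is $B_{YW}=(\overline\nabla_Y W)^\perp$ and the mean curvature vector $H$ is its trace with respect to the induced metric. $M$ is a spacelike translating soliton (translator) if it is spacelike and there is a non-zero constant vector $T\in\mathbb{R}^{m+n}$ such that $H=T^\perp$ on $M$. The Gauss map of $M$ sends a point to its tangent space, translated to the origin, viewed as a point in the pseudo-Grassmannian of all spacelike $m$-dimensional linear subspaces of $\mathbb{R}^{m+n}_n$, which is a non-compact Riemannian symmetric space with its canonical invariant metric. The Gauss image is bounded if the image of the Gauss map is a bounded subset of this space. For a spacelike graph $M=\{(x,u^1(x),\dots,u^n(x)) : x\in\mathbb{R}^m\}$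 of smooth functions $u^1,\dots,u^n$ on $\mathbb{R}^m$, with induced metric $g_{ij}=\delta_{ij}-\sum_{\alpha=1}^n \frac{\partial u^\alpha}{\partial x_i}\frac{\partial u^\alpha}{\partial x_j}$, this is equivalent to a bound on $\det(g_{ij})$, namely the existence of a constant $c>0$ with $\det(g_{ij}(x))\ge c$ for all $x\in\mathbb{R}^m$ (the upper bound $\det(g_{ij})\le 1$ is automatic). *)

theory Defs
  imports "HOL-Analysis.Analysis"
begin

text \<open>
  The ambient space with its indefinite metric is modelled on the product of the positive
  factor \<open>real ^ 'm\<close> and the negative factor \<open>real ^ 'n\<close>.
\<close>

definition pseudo_inner :: "(real ^ 'm) \<times> (real ^ 'n) \<Rightarrow> (real ^ 'm) \<times> (real ^ 'n) \<Rightarrow> real" where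
  "pseudo_inner v w = fst v \<bullet> fst w - snd v \<bullet> snd w"

definition pseudo_orthogonal :: "((real ^ 'm) \<times> (real ^ 'n)) set \<Rightarrow> ((real ^ 'm) \<times> (real ^ 'n)) set" where
  "pseudo_orthogonal P = {\<nu>. \<forall>w\<in>P. pseudo_inner \<nu> w = 0}"

text \<open>
  If \<open>P\<close> is a spacelike subspace then \<open>P\<close> and \<open>pseudo_orthogonal P\<close> are complementary,
  so the description below determines a unique vector.
\<close>

definition normal_part ::
    "((real ^ 'm) \<times> (real ^ 'n)) set \<Rightarrow> (real ^ 'm) \<times> (real ^ 'n) \<Rightarrow> (real ^ 'm) \<times> (real ^ 'n)" where
  "normal_part P w = (THE \<nu>. \<nu> \<in> pseudo_orthogonal P \<and> w - \<nu> \<in> P)"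

definition spacelike_subspace :: "((real ^ 'm) \<times> (real ^ 'n)) set \<Rightarrow> bool" where
  "spacelike_subspace P \<longleftrightarrow> subspace P \<and> (\<forall>v\<in>P. v \<noteq> 0 \<longrightarrow> pseudo_inner v v > 0)"

lemma normal_part_eqI:
  assumes P: "spacelike_subspace P" and \<nu>: "\<nu> \<in> pseudo_orthogonal P" "w - \<nu> \<in> P"
  shows "normal_part P w = \<nu>"
  unfolding normal_part_def
proof (rule the_equality)
  fix \<mu> assume \<mu>: "\<mu> \<in> pseudo_orthogonal P \<and> w - \<mu> \<in> P"
  have "(w - \<nu>) - (w - \<mu>) \<in> P"
    using P \<nu> \<mu> subspace_diff unfolding spacelike_subspace_def by blast
  then have d: "\<mu> - \<nu> \<in> P" by simp
  have "pseudo_inner (\<mu> - \<nu>) (\<mu> - \<nu>) = pseudo_inner \<mu> (\<mu> - \<nu>) - pseudo_inner \<nu> (\<mu> - \<nu>)"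
    by (simp add: pseudo_inner_def inner_diff_left)
  also have "\<dots> = 0"
    using d \<nu> \<mu> by (simp add: pseudo_orthogonal_def)
  finally show "\<mu> = \<nu>"
    using P d unfolding spacelike_subspace_def by force
qed (use \<nu> in auto)

primrec Ck :: "nat \<Rightarrow> ('a::euclidean_space \<Rightarrow> 'b::real_normed_vector) \<Rightarrow> bool" where
  "Ck 0 f \<longleftrightarrow> continuous_on UNIV f"
| "Ck (Suc k) f \<longleftrightarrow> f differentiable_on UNIV \<and> (\<forall>v. Ck k (\<lambda>x. frechet_derivative f (at x) v))"

definition smooth :: "('a::euclidean_space \<Rightarrow> 'b::real_normed_vector) \<Rightarrow> bool" where
  "smooth f \<longleftrightarrow> (\<forall>k. Ck k f)"


subsection \<open>Geometry of entire graphs\<close>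

definition graph_map :: "(real ^ 'm \<Rightarrow> real ^ 'n) \<Rightarrow> real ^ 'm \<Rightarrow> (real ^ 'm) \<times> (real ^ 'n)" where
  "graph_map u x = (x, u x)"

definition entire_graph :: "(real ^ 'm \<Rightarrow> real ^ 'n) \<Rightarrow> ((real ^ 'm) \<times> (real ^ 'n)) set" where
  "entire_graph u = range (graph_map u)"

definition tangent_lift ::
    "(real ^ 'm \<Rightarrow> real ^ 'n) \<Rightarrow> real ^ 'm \<Rightarrow> real ^ 'm \<Rightarrow> (real ^ 'm) \<times> (real ^ 'n)" where
  "tangent_lift u x v = frechet_derivative (graph_map u) (at x) v"

definition tangent_space ::
    "(real ^ 'm \<Rightarrow> real ^ 'n) \<Rightarrow> real ^ 'm \<Rightarrow> ((real ^ 'm) \<times> (real ^ 'n)) set" where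
  "tangent_space u x = range (tangent_lift u x)"

definition induced_metric :: "(real ^ 'm \<Rightarrow> real ^ 'n) \<Rightarrow> real ^ 'm \<Rightarrow> real ^ 'm ^ 'm" where
  "induced_metric u x =
     (\<chi> i j. pseudo_inner (tangent_lift u x (axis i 1)) (tangent_lift u x (axis j 1)))"

lemma tangent_lift_eq:
  assumes "u differentiable (at x)"
  shows "tangent_lift u x v = (v, frechet_derivative u (at x) v)"
proof -
  have "((\<lambda>y. (y, u y)) has_derivative (\<lambda>v. (v, frechet_derivative u (at x) v))) (at x)"
    using assms by (intro has_derivative_Pair has_derivative_ident)
      (simp add: frechet_derivative_works)
  moreover have "graph_map u = (\<lambda>y. (y, u y))"
    by (simp add: fun_eq_iff graph_map_def)
  ultimately show ?thesis
    by (simp add: tangent_lift_def frechet_derivative_at[symmetric])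
qed

lemma induced_metric_eq:
  assumes "u differentiable (at x)"
  shows "induced_metric u x $ i $ j =
    (if i = j then 1 else 0) -
    (\<Sum>\<alpha>\<in>UNIV. frechet_derivative u (at x) (axis i 1) $ \<alpha> * frechet_derivative u (at x) (axis j 1) $ \<alpha>)"
  using assms
  by (simp add: induced_metric_def pseudo_inner_def tangent_lift_eq inner_axis_axis)
     (simp add: inner_vec_def)

definition spacelike_graph :: "(real ^ 'm \<Rightarrow> real ^ 'n) \<Rightarrow> bool" where
  "spacelike_graph u \<longleftrightarrow> (\<forall>x v. v \<noteq> 0 \<longrightarrow> v \<bullet> (induced_metric u x *v v) > 0)"

text \<open>
  The value at \<open>x\<close> of the normal part of the flat derivative of the field \<open>tangent_lift u _ w\<close>
  in the direction \<open>tangent_lift u x v\<close>; the choice of the extending tangent field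
  does not matter, because the second fundamental form is tensorial.
\<close>

definition second_fundamental_form ::
    "(real ^ 'm \<Rightarrow> real ^ 'n) \<Rightarrow> real ^ 'm \<Rightarrow> real ^ 'm \<Rightarrow> real ^ 'm \<Rightarrow> (real ^ 'm) \<times> (real ^ 'n)" where
  "second_fundamental_form u x v w =
     normal_part (tangent_space u x) (frechet_derivative (\<lambda>y. tangent_lift u y w) (at x) v)"

definition mean_curvature ::
    "(real ^ 'm \<Rightarrow> real ^ 'n) \<Rightarrow> real ^ 'm \<Rightarrow> (real ^ 'm) \<times> (real ^ 'n)" where
  "mean_curvature u x =
     (\<Sum>i\<in>UNIV. \<Sum>j\<in>UNIV. matrix_inv (induced_metric u x) $ i $ j *\<^sub>R
        second_fundamental_form u x (axis i 1) (axis j 1))"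

definition spacelike_translator :: "(real ^ 'm \<Rightarrow> real ^ 'n) \<Rightarrow> bool" where
  "spacelike_translator u \<longleftrightarrow>
     spacelike_graph u \<and>
     (\<exists>T. T \<noteq> 0 \<and> (\<forall>x. mean_curvature u x = normal_part (tangent_space u x) T))"


subsection \<open>The pseudo-Grassmannian and the Gauss image\<close>

definition pseudo_grassmannian :: "((real ^ 'm) \<times> (real ^ 'n)) set set" where
  "pseudo_grassmannian = {P. spacelike_subspace P \<and> dim P = CARD('m)}"

definition pseudo_orthonormal :: "((real ^ 'm) \<times> (real ^ 'n)) ^ 'm \<Rightarrow> bool" where
  "pseudo_orthonormal e \<longleftrightarrow> (\<forall>i j. pseudo_inner (e $ i) (e $ j) = (if i = j then 1 else 0))"

definition frame_span :: "((real ^ 'm) \<times> (real ^ 'n)) ^ 'm \<Rightarrow> ((real ^ 'm) \<times> (real ^ 'n)) set" where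
  "frame_span e = span (range (($) e))"

text \<open>
  A curve \<open>P(t)\<close> in the pseudo-Grassmannian is represented by a moving pseudo-orthonormal frame
  \<open>e\<^sub>i(t)\<close> of \<open>P(t)\<close>. Its velocity is the linear map from \<open>P(t)\<close> to its orthogonal
  complement that sends \<open>e\<^sub>i\<close> to the normal part of its derivative, and the
  canonical invariant metric is the squared Hilbert-Schmidt norm of this map, that is, the sum of
  the squares of the forms \<open>\<omega>\<^sub>i\<^sub>\<alpha>\<close>. The minus sign appears because the orthogonal complement is
  negative definite. The speed depends only on the curve \<open>P(t)\<close>, not on the frame.
\<close>

definition grassmann_speed :: "(real \<Rightarrow> ((real ^ 'm) \<times> (real ^ 'n)) ^ 'm) \<Rightarrow> real \<Rightarrow> real" where
  "grassmann_speed e t =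
     sqrt (\<Sum>i\<in>UNIV.
       let \<nu> = normal_part (frame_span (e t)) (vector_derivative e (at t) $ i)
       in - pseudo_inner \<nu> \<nu>)"

definition grassmann_length :: "(real \<Rightarrow> ((real ^ 'm) \<times> (real ^ 'n)) ^ 'm) \<Rightarrow> real" where
  "grassmann_length e = integral {0..1} (grassmann_speed e)"

definition grassmann_dist ::
    "((real ^ 'm) \<times> (real ^ 'n)) set \<Rightarrow> ((real ^ 'm) \<times> (real ^ 'n)) set \<Rightarrow> real" where
  "grassmann_dist P Q =
     Inf {grassmann_length e | e.
            e C1_differentiable_on {0..1} \<and> (\<forall>t\<in>{0..1}. pseudo_orthonormal (e t)) \<and>
            frame_span (e 0) = P \<and> frame_span (e 1) = Q}"

definition grassmann_bounded :: "((real ^ 'm) \<times> (real ^ 'n)) set set \<Rightarrow> bool" where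
  "grassmann_bounded S \<longleftrightarrow>
     S \<subseteq> pseudo_grassmannian \<and> (\<exists>r. \<forall>P\<in>S. \<forall>Q\<in>S. grassmann_dist P Q \<le> r)"

text \<open>
  Points of the graph correspond to their base points, so the Gauss image is the
  set of all tangent spaces.
\<close>

definition gauss_image :: "(real ^ 'm \<Rightarrow> real ^ 'n) \<Rightarrow> ((real ^ 'm) \<times> (real ^ 'n)) set set" where
  "gauss_image u = range (tangent_space u)"

end

theory Submission imports Defs begin

text \<open>
  Let \<open>g = I - Du\<^sup>T Du\<close> be the induced metric in the chart \<open>x\<close>, let \<open>G\<close> be its inverse, and let
  \<open>T = (a, b)\<close>. The mean curvature vector \<open>H\<close> is the normal part of \<open>(0, \<Sum> G\<^sub>i\<^sub>j \<partial>\<^sub>i \<partial>\<^sub>j u)\<close>. If it equals \<open>T\<^sup>\<bottom>\<close>,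
  this vector differs from \<open>T\<close> by a tangent vector, and comparison of components turns the soliton
  equation into \<open>L u = b\<close> for the second order operator \<open>L = \<Sum> G\<^sub>i\<^sub>j \<partial>\<^sub>i \<partial>\<^sub>j + \<partial>\<^sub>a\<close>
  (\<open>translator_equation_of_soliton\<close>). Two facts about \<open>L\<close> make the graph flat: its coefficients
  are bounded when the Gauss image is bounded, and the size of the second fundamental form is a
  subsolution with a strong growth term, \<open>L f \<ge> f\<^sup>3\<close> in a weak sense.

  Bounded coefficients. Along a curve of spacelike planes with a pseudo-orthonormal frame \<open>e\<close> the
  quantity \<open>Q = \<Sum> \<bar>fst e\<^sub>i\<bar>\<^sup>2\<close>, which for a tangent plane is the trace of \<open>G\<close>, satisfies \<open>Q' \<le> 2 \<sigma> Q\<close> with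
  the speed \<open>\<sigma>\<close> of the curve (\<open>horizontal_energy_growth\<close>). Hence it is bounded on a bounded subset of the
  pseudo-Grassmannian, and \<open>\<bar>v\<bar>\<^sup>2 \<le> K g(v, v)\<close> with a constant \<open>K\<close> independent of the base point
  (\<open>bounded_gauss_image_uniformly_spacelike\<close>). The distance is an infimum over frame paths; that any two
  tangent planes are joined by such a path (\<open>tangent_spaces_joined_by_frames\<close>) keeps this infimum
  from being taken over the empty set.

  The subsolution. The normal vectors at \<open>x\<close> are \<open>(Du\<^sup>T y, y)\<close>, so the largest value of the
  second fundamental form on unit vectors is the supremum \<open>f(x)\<close> over \<open>v\<close> and \<open>y\<close> of
  \<open>y \<bullet> D\<^sup>2u(v, v) / (g(v, v) \<bar>(Du\<^sup>T y, y)\<bar>)\<close>. Where \<open>\<eta> f\<close> has its maximum over a ball, for the cutoff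
  \<open>\<eta> = 1 - \<bar>x\<bar>\<^sup>2 / R\<^sup>2\<close>, the function of the three variables \<open>x, v, y\<close> is critical, and its second
  derivative along every straight line through the maximum point is nonpositive. The lines used
  move \<open>x\<close> in the directions of a \<open>g\<close>-orthonormal frame and carry the tangent vector and the
  normal vector along in a parallel way, to first order. After summation over the frame, the
  third and fourth derivatives of \<open>u\<close> are eliminated by the equation differentiated twice, and all
  terms left over have a sign: this is Simons' inequality, in which the definiteness
  of the normal bundle makes the cubic term favourable. With \<open>M = max (\<eta> f)\<close> the outcome is
  \<open>M\<^sup>2 \<le> 2 \<bar>D\<eta>\<bar>\<^sup>2 - \<eta> L \<eta>\<close> (\<open>max_point_estimate\<close>), and the right hand side is \<open>O(1/R)\<close>.
  Letting \<open>R\<close> tend to infinity gives \<open>D\<^sup>2u = 0\<close> (\<open>second_derivative_zero\<close>).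

  Working with the maximum of a function of \<open>(x, v, y)\<close>, instead of with the squared norm of the second
  fundamental form, replaces covariant differentiation by calculus in one variable along lines.
\<close>

section \<open>Directional derivatives of smooth maps\<close>

definition dirderiv :: "'a \<Rightarrow> ('a::euclidean_space \<Rightarrow> 'b::real_normed_vector) \<Rightarrow> 'a \<Rightarrow> 'b" where
  "dirderiv v f x = frechet_derivative f (at x) v"

lemma smooth_differentiable: "smooth f \<Longrightarrow> f differentiable (at x)"
  unfolding smooth_def by (metis Ck.simps(2) UNIV_I differentiable_on_def)

lemma smooth_dirderiv: "smooth f \<Longrightarrow> smooth (dirderiv v f)"
  unfolding smooth_def dirderiv_def[abs_def] by (metis Ck.simps(2))

lemma smooth_continuous: "smooth f \<Longrightarrow> continuous_on UNIV f"
  unfolding smooth_def by (metis Ck.simps(1))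

lemma smooth_has_derivative: "smooth f \<Longrightarrow> (f has_derivative (\<lambda>v. dirderiv v f x)) (at x)"
  unfolding dirderiv_def using smooth_differentiable frechet_derivative_works by blast

lemma linear_dirderiv: "smooth f \<Longrightarrow> linear (\<lambda>v. dirderiv v f x)"
  by (rule has_derivative_linear[OF smooth_has_derivative])

lemma dirderiv_add: "smooth f \<Longrightarrow> dirderiv (v + w) f x = dirderiv v f x + dirderiv w f x"
  by (rule linear_add[OF linear_dirderiv])

lemma dirderiv_scaleR: "smooth f \<Longrightarrow> dirderiv (c *\<^sub>R v) f x = c *\<^sub>R dirderiv v f x"
  by (rule linear_cmul[OF linear_dirderiv])

lemma dirderiv_sum: "smooth f \<Longrightarrow> dirderiv (\<Sum>i\<in>I. v i) f x = (\<Sum>i\<in>I. dirderiv (v i) f x)"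
  by (rule linear_sum[OF linear_dirderiv])

lemma frechet_derivative_bounded_linear:
  assumes h: "bounded_linear h" and f: "f differentiable (at x)"
  shows "frechet_derivative (\<lambda>x. h (f x)) (at x) v = h (frechet_derivative f (at x) v)"
proof -
  have "((\<lambda>x. h (f x)) has_derivative (\<lambda>v. h (frechet_derivative f (at x) v))) (at x)"
    using f bounded_linear.has_derivative[OF h] frechet_derivative_works by blast
  then show ?thesis using frechet_derivative_at by metis
qed

lemma Ck_bounded_linear:
  assumes h: "bounded_linear h"
  shows "Ck k f \<Longrightarrow> Ck k (\<lambda>x. h (f x))"
proof (induction k arbitrary: f)
  case 0
  then show ?case using bounded_linear.continuous_on[OF h] by auto
next
  case (Suc k)
  have d: "\<And>x. f differentiable (at x)" using Suc.prems by (auto simp: differentiable_on_def)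
  have "(\<lambda>x. h (f x)) differentiable (at x)" for x
    using d[of x] bounded_linear.has_derivative[OF h] unfolding differentiable_def by blast
  moreover have "Ck k (\<lambda>x. frechet_derivative (\<lambda>x. h (f x)) (at x) v)" for v
    using Suc by (simp add: frechet_derivative_bounded_linear[OF h d])
  ultimately show ?case by (simp add: differentiable_on_def)
qed

lemma smooth_bounded_linear: "bounded_linear h \<Longrightarrow> smooth f \<Longrightarrow> smooth (\<lambda>x. h (f x))"
  unfolding smooth_def using Ck_bounded_linear by blast

lemma dirderiv_bounded_linear:
  "bounded_linear h \<Longrightarrow> smooth f \<Longrightarrow> dirderiv v (\<lambda>x. h (f x)) x = h (dirderiv v f x)"
  unfolding dirderiv_def by (intro frechet_derivative_bounded_linear smooth_differentiable)

lemma differentiable_vec_componentwise: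
  fixes f :: "'a::euclidean_space \<Rightarrow> real ^ 'n"
  assumes "\<And>\<alpha>. (\<lambda>x. f x $ \<alpha>) differentiable (at x)"
  shows "f differentiable (at x)"
proof -
  have "(\<lambda>x. f x \<bullet> i) differentiable (at x)" if "i \<in> Basis" for i
    using that assms by (auto simp: Basis_vec_def inner_axis)
  then show ?thesis by (simp add: differentiable_componentwise_within[of f])
qed

lemma Ck_componentwise:
  fixes f :: "'a::euclidean_space \<Rightarrow> real ^ 'n"
  shows "(\<And>\<alpha>. Ck k (\<lambda>x. f x $ \<alpha>)) \<Longrightarrow> Ck k f"
proof (induction k arbitrary: f)
  case 0
  then show ?case by (simp add: continuous_on_componentwise[of UNIV f] Basis_vec_def) (auto simp: inner_axis)
next
  case (Suc k)
  have d: "\<And>x. f differentiable (at x)"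
    by (rule differentiable_vec_componentwise) (use Suc.prems in \<open>auto simp: differentiable_on_def\<close>)
  have "Ck k (\<lambda>x. frechet_derivative f (at x) v)" for v
  proof (rule Suc.IH)
    fix \<alpha>
    show "Ck k (\<lambda>x. frechet_derivative f (at x) v $ \<alpha>)"
      using Suc.prems[of \<alpha>]
      by (simp add: frechet_derivative_bounded_linear[OF bounded_linear_vec_nth d])
  qed
  with d show ?case by (auto simp: differentiable_on_def)
qed

lemma smooth_componentwise:
  fixes f :: "'a::euclidean_space \<Rightarrow> real ^ 'n"
  assumes "\<And>\<alpha>. smooth (\<lambda>x. f x $ \<alpha>)"
  shows "smooth f"
  using assms Ck_componentwise unfolding smooth_def by blast

lemma smooth_line_derivative:
  assumes "smooth f"
  shows "((\<lambda>t. f (x + t *\<^sub>R v)) has_vector_derivative dirderiv v f (x + t *\<^sub>R v)) (at t)"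
proof -
  have "((\<lambda>t. x + t *\<^sub>R v) has_derivative (\<lambda>h. h *\<^sub>R v)) (at t)"
    by (auto intro!: derivative_eq_intros)
  from has_derivative_compose[OF this smooth_has_derivative[OF assms]]
  show ?thesis by (simp add: has_vector_derivative_def dirderiv_scaleR[OF assms])
qed

lemma smooth_line_real_derivative:
  assumes "smooth f"
  shows "((\<lambda>t. f (x + t *\<^sub>R v)) has_real_derivative dirderiv v f (x + t *\<^sub>R v)) (at t)"
  using smooth_line_derivative[OF assms] by (simp add: has_real_derivative_iff_has_vector_derivative)

text \<open>
  Applying the mean value theorem first in one direction and then in the other. The left hand side is symmetric in \<open>v\<close> and \<open>w\<close>, and this is the source of the symmetry of second derivatives.
\<close>

lemma second_difference:
  fixes f :: "'a::euclidean_space \<Rightarrow> real"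
  assumes f: "smooth f" and h: "h > 0"
  shows "\<exists>s t. 0 < s \<and> s < h \<and> 0 < t \<and> t < h \<and>
     f (x + h *\<^sub>R v + h *\<^sub>R w) - f (x + h *\<^sub>R v) - f (x + h *\<^sub>R w) + f x
       = h * h * dirderiv w (dirderiv v f) (x + s *\<^sub>R v + t *\<^sub>R w)"
proof -
  define \<phi> where "\<phi> s = f (x + h *\<^sub>R w + s *\<^sub>R v) - f (x + s *\<^sub>R v)" for s
  have "DERIV \<phi> s :> dirderiv v f (x + h *\<^sub>R w + s *\<^sub>R v) - dirderiv v f (x + s *\<^sub>R v)" for s
    unfolding \<phi>_def by (intro DERIV_diff smooth_line_real_derivative f)
  from MVT2[OF h this] obtain s where s: "0 < s" "s < h" and
    s_eq: "\<phi> h - \<phi> 0 = h * (dirderiv v f (x + h *\<^sub>R w + s *\<^sub>R v) - dirderiv v f (x + s *\<^sub>R v))"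
    by auto
  have "DERIV (\<lambda>t. dirderiv v f (x + s *\<^sub>R v + t *\<^sub>R w)) t :>
      dirderiv w (dirderiv v f) (x + s *\<^sub>R v + t *\<^sub>R w)" for t
    by (intro smooth_line_real_derivative smooth_dirderiv f)
  from MVT2[OF h this] obtain t where t: "0 < t" "t < h" and
    t_eq: "dirderiv v f (x + s *\<^sub>R v + h *\<^sub>R w) - dirderiv v f (x + s *\<^sub>R v + 0 *\<^sub>R w)
      = h * dirderiv w (dirderiv v f) (x + s *\<^sub>R v + t *\<^sub>R w)" by auto
  have "f (x + h *\<^sub>R v + h *\<^sub>R w) - f (x + h *\<^sub>R v) - f (x + h *\<^sub>R w) + f x = \<phi> h - \<phi> 0"
    by (simp add: \<phi>_def algebra_simps)
  then show ?thesis using s t s_eq t_eq by (intro exI[of _ s] exI[of _ t]) (simp add: algebra_simps)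
qed

lemma dirderiv_commute_real:
  fixes f :: "'a::euclidean_space \<Rightarrow> real"
  assumes f: "smooth f"
  shows "dirderiv v (dirderiv w f) x = dirderiv w (dirderiv v f) x"
proof (rule ccontr)
  let ?A = "dirderiv w (dirderiv v f)" and ?B = "dirderiv v (dirderiv w f)"
  assume ne: "?B x \<noteq> ?A x"
  define e where "e = \<bar>?A x - ?B x\<bar> / 2"
  have e: "e > 0" using ne by (simp add: e_def)
  have cA: "isCont ?A x" and cB: "isCont ?B x"
    using smooth_continuous[OF smooth_dirderiv[OF smooth_dirderiv[OF f]]]
    by (simp_all add: continuous_on_eq_continuous_at)
  obtain dA where dA: "dA > 0" "\<And>y. dist y x < dA \<Longrightarrow> dist (?A y) (?A x) < e"
    using cA e unfolding continuous_at_eps_delta by blast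
  obtain dB where dB: "dB > 0" "\<And>y. dist y x < dB \<Longrightarrow> dist (?B y) (?B x) < e"
    using cB e unfolding continuous_at_eps_delta by blast
  define h where "h = min dA dB / (norm v + norm w + 1)"
  have pos: "norm v + norm w + 1 > 0" by (simp add: add_nonneg_pos)
  have h: "h > 0" using dA(1) dB(1) pos by (simp add: h_def)
  have near: "dist (x + s *\<^sub>R v' + t *\<^sub>R w') x < min dA dB"
    if "0 < s" "s < h" "0 < t" "t < h" "norm v' + norm w' = norm v + norm w" for s t v' w'
  proof -
    have "dist (x + s *\<^sub>R v' + t *\<^sub>R w') x \<le> norm (s *\<^sub>R v') + norm (t *\<^sub>R w')"
      by (metis add.assoc add_diff_cancel_left' dist_norm norm_triangle_ineq)
    also have "\<dots> \<le> h * norm v' + h * norm w'"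
      using that by (intro add_mono) (auto intro: mult_right_mono)
    also have "\<dots> = h * (norm v + norm w)" using that(5) by (simp add: distrib_left[symmetric])
    also have "\<dots> < h * (norm v + norm w + 1)" using h by simp
    also have "\<dots> = min dA dB" using pos by (simp add: h_def)
    finally show ?thesis .
  qed
  obtain s t where st: "0 < s" "s < h" "0 < t" "t < h"
    "f (x + h *\<^sub>R v + h *\<^sub>R w) - f (x + h *\<^sub>R v) - f (x + h *\<^sub>R w) + f x = h * h * ?A (x + s *\<^sub>R v + t *\<^sub>R w)"
    using second_difference[OF f h, of x v w] by blast
  obtain s' t' where st': "0 < s'" "s' < h" "0 < t'" "t' < h"
    "f (x + h *\<^sub>R w + h *\<^sub>R v) - f (x + h *\<^sub>R w) - f (x + h *\<^sub>R v) + f x = h * h * ?B (x + s' *\<^sub>R w + t' *\<^sub>R v)"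
    using second_difference[OF f h, of x w v] by blast
  have "h * h * ?A (x + s *\<^sub>R v + t *\<^sub>R w) = h * h * ?B (x + s' *\<^sub>R w + t' *\<^sub>R v)"
    using st(5) st'(5) by (simp add: algebra_simps)
  then have eq: "?A (x + s *\<^sub>R v + t *\<^sub>R w) = ?B (x + s' *\<^sub>R w + t' *\<^sub>R v)" using h by simp
  have "dist (?A (x + s *\<^sub>R v + t *\<^sub>R w)) (?A x) < e"
    using near[OF st(1-4), of v w] by (intro dA) auto
  moreover have "dist (?B (x + s' *\<^sub>R w + t' *\<^sub>R v)) (?B x) < e"
    using near[OF st'(1-4), of w v] by (intro dB) auto
  ultimately show False using eq unfolding e_def dist_real_def by (smt (verit) field_sum_of_halves)
qed

lemma dirderiv_commute:
  fixes f :: "'a::euclidean_space \<Rightarrow> 'b::euclidean_space"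
  assumes f: "smooth f"
  shows "dirderiv v (dirderiv w f) = dirderiv w (dirderiv v f)"
proof (rule ext, rule euclidean_eqI)
  fix x and i :: 'b assume "i \<in> Basis"
  have bl: "bounded_linear (\<lambda>y::'b. y \<bullet> i)" by (rule bounded_linear_inner_left)
  have 1: "dirderiv w' (\<lambda>x. f x \<bullet> i) = (\<lambda>x. dirderiv w' f x \<bullet> i)" for w'
    using dirderiv_bounded_linear[OF bl f] by blast
  have 2: "dirderiv v' (dirderiv w' (\<lambda>x. f x \<bullet> i)) x = dirderiv v' (dirderiv w' f) x \<bullet> i" for v' w'
    unfolding 1 using dirderiv_bounded_linear[OF bl smooth_dirderiv[OF f]] by blast
  show "dirderiv v (dirderiv w f) x \<bullet> i = dirderiv w (dirderiv v f) x \<bullet> i"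
    using dirderiv_commute_real[OF smooth_bounded_linear[OF bl f], of v w x] by (simp add: 2)
qed

section \<open>Second-order jets of curves\<close>

text \<open>
  The value and the first two derivatives at \<open>0\<close> of a curve that is differentiable everywhere and twice differentiable at \<open>0\<close>. Passing around the three numbers together lets the second derivative of a product of several curves be computed by one rule per operation.
\<close>

definition jet2 :: "(real \<Rightarrow> 'a::real_normed_vector) \<Rightarrow> 'a \<Rightarrow> 'a \<Rightarrow> 'a \<Rightarrow> bool" where
  "jet2 f a b c \<longleftrightarrow> (\<exists>f'. (\<forall>t. (f has_vector_derivative f' t) (at t)) \<and> f 0 = a \<and> f' 0 = b \<and>
     (f' has_vector_derivative c) (at 0))"

lemma jet2_const: "jet2 (\<lambda>t. a) a 0 0"
  unfolding jet2_def by (rule exI[of _ "\<lambda>t. 0"]) auto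

lemma jet2_ident: "jet2 (\<lambda>t. t) 0 1 (0::real)"
  unfolding jet2_def
  by (rule exI[of _ "\<lambda>t. 1"]) (auto simp: has_vector_derivative_def intro!: derivative_eq_intros)

lemma jet2_add: "jet2 f a b c \<Longrightarrow> jet2 g a' b' c' \<Longrightarrow> jet2 (\<lambda>t. f t + g t) (a + a') (b + b') (c + c')"
  unfolding jet2_def
  apply (elim exE)
  subgoal for f' g' by (rule exI[of _ "\<lambda>t. f' t + g' t"]) (auto intro!: has_vector_derivative_add)
  done

lemma jet2_diff: "jet2 f a b c \<Longrightarrow> jet2 g a' b' c' \<Longrightarrow> jet2 (\<lambda>t. f t - g t) (a - a') (b - b') (c - c')"
  unfolding jet2_def
  apply (elim exE)
  subgoal for f' g' by (rule exI[of _ "\<lambda>t. f' t - g' t"]) (auto intro!: has_vector_derivative_diff)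
  done

lemma jet2_bilinear:
  assumes p: "bounded_bilinear p" and "jet2 f a b c" "jet2 g a' b' c'"
  shows "jet2 (\<lambda>t. p (f t) (g t)) (p a a') (p a b' + p b a') (p a c' + 2 *\<^sub>R p b b' + p c a')"
proof -
  obtain f' where f: "\<forall>t. (f has_vector_derivative f' t) (at t)" "f 0 = a" "f' 0 = b"
    "(f' has_vector_derivative c) (at 0)" using assms(2) unfolding jet2_def by blast
  obtain g' where g: "\<forall>t. (g has_vector_derivative g' t) (at t)" "g 0 = a'" "g' 0 = b'"
    "(g' has_vector_derivative c') (at 0)" using assms(3) unfolding jet2_def by blast
  note pd = bounded_bilinear.has_vector_derivative[OF p]
  have "((\<lambda>t. p (f t) (g' t) + p (f' t) (g t)) has_vector_derivative
      (p (f 0) c' + p (f' 0) (g' 0)) + (p (f' 0) (g' 0) + p c (g 0))) (at 0)"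
    using f g by (intro has_vector_derivative_add pd) auto
  then have "((\<lambda>t. p (f t) (g' t) + p (f' t) (g t)) has_vector_derivative
      (p a c' + 2 *\<^sub>R p b b' + p c a')) (at 0)"
    using f g by (simp add: scaleR_2 add.assoc)
  then show ?thesis unfolding jet2_def
    by (intro exI[of _ "\<lambda>t. p (f t) (g' t) + p (f' t) (g t)"]) (use f g pd in auto)
qed

lemmas jet2_mult = jet2_bilinear[OF bounded_bilinear_mult]
lemmas jet2_inner = jet2_bilinear[OF bounded_bilinear_inner]
lemmas jet2_scaleR = jet2_bilinear[OF bounded_bilinear_scaleR]

lemma has_vector_derivative_iff_quotient:
  fixes f :: "real \<Rightarrow> 'a::real_normed_vector"
  shows "(f has_vector_derivative D) (at s) \<longleftrightarrow>
    ((\<lambda>t. (1 / (t - s)) *\<^sub>R (f t - f s)) \<longlongrightarrow> D) (at s)"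
proof -
  have eq: "norm (f t - f s - (t - s) *\<^sub>R D) / norm (t - s) = norm ((1 / (t - s)) *\<^sub>R (f t - f s) - D)"
    if "t \<noteq> s" for t
  proof -
    have "(1 / (t - s)) *\<^sub>R (f t - f s) - D = (1 / (t - s)) *\<^sub>R (f t - f s - (t - s) *\<^sub>R D)"
      using that by (simp add: scaleR_diff_right)
    then show ?thesis by (simp add: divide_inverse mult.commute)
  qed
  have "(f has_vector_derivative D) (at s) \<longleftrightarrow>
      ((\<lambda>t. norm (f t - f s - (t - s) *\<^sub>R D) / norm (t - s)) \<longlongrightarrow> 0) (at s)"
    by (simp add: has_vector_derivative_def has_derivative_iff_norm bounded_linear_scaleR_left)
  also have "\<dots> \<longleftrightarrow> ((\<lambda>t. norm ((1 / (t - s)) *\<^sub>R (f t - f s) - D)) \<longlongrightarrow> 0) (at s)"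
    by (rule Lim_cong_within) (auto simp: eq[unfolded real_norm_def])
  finally show ?thesis
    using LIM_zero_iff[of "\<lambda>t. (1 / (t - s)) *\<^sub>R (f t - f s)" D "at s"] by (simp add: tendsto_norm_zero_iff)
qed

lemma has_vector_derivative_vec:
  fixes f :: "real \<Rightarrow> 'a::real_normed_vector ^ 'n"
  assumes "\<And>i. ((\<lambda>t. f t $ i) has_vector_derivative D $ i) (at t)"
  shows "(f has_vector_derivative D) (at t)"
  using assms unfolding has_vector_derivative_iff_quotient by (intro vec_tendstoI) simp

lemma jet2_vec:
  fixes f :: "real \<Rightarrow> 'a::real_normed_vector ^ 'n"
  assumes "\<And>i. jet2 (\<lambda>t. f t $ i) (a $ i) (b $ i) (c $ i)"
  shows "jet2 f a b c"
proof -
  have "\<forall>i. \<exists>f'. (\<forall>t. ((\<lambda>t. f t $ i) has_vector_derivative f' t) (at t)) \<and> f 0 $ i = a $ i \<and> f' 0 = b $ i \<and>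
     (f' has_vector_derivative c $ i) (at 0)"
    using assms unfolding jet2_def by blast
  then obtain f' where f': "\<And>i t. ((\<lambda>t. f t $ i) has_vector_derivative f' i t) (at t)"
    "\<And>i. f 0 $ i = a $ i" "\<And>i. f' i 0 = b $ i" "\<And>i. (f' i has_vector_derivative c $ i) (at 0)"
    by metis
  show ?thesis unfolding jet2_def
    by (intro exI[of _ "\<lambda>t. \<chi> i. f' i t"] conjI allI has_vector_derivative_vec)
      (use f' in \<open>auto simp: vec_eq_iff\<close>)
qed

lemma jet2_line:
  assumes "smooth f"
  shows "jet2 (\<lambda>t. f (x + t *\<^sub>R v)) (f x) (dirderiv v f x) (dirderiv v (dirderiv v f) x)"
proof -
  have "((\<lambda>t. dirderiv v f (x + t *\<^sub>R v)) has_vector_derivative dirderiv v (dirderiv v f) x) (at 0)"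
    using smooth_line_derivative[OF smooth_dirderiv[OF assms], where x=x and v=v and t=0] by simp
  then show ?thesis unfolding jet2_def
    by (intro exI[of _ "\<lambda>t. dirderiv v f (x + t *\<^sub>R v)"])
      (auto intro: smooth_line_derivative[OF assms])
qed

lemma jet2_cong: "jet2 f a b c \<Longrightarrow> (\<And>t. g t = f t) \<Longrightarrow> a' = a \<Longrightarrow> b' = b \<Longrightarrow> c' = c \<Longrightarrow> jet2 g a' b' c'"
  by (metis ext)

text \<open>
  The second derivative test: a negative second derivative would make the first derivative negative just after the critical point.
\<close>

lemma jet2_local_min:
  fixes f :: "real \<Rightarrow> real"
  assumes j: "jet2 f a b c" and d: "d > 0" and min: "\<And>t. \<bar>t\<bar> < d \<Longrightarrow> f t \<ge> a"
  shows "b = 0 \<and> c \<ge> 0"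
proof -
  obtain f' where f: "\<And>t. DERIV f t :> f' t" "f 0 = a" "f' 0 = b" and f2: "DERIV f' 0 :> c"
    using j unfolding jet2_def has_real_derivative_iff_has_vector_derivative by blast
  have b: "b = 0"
    using DERIV_local_min[OF f(1)[of 0] d] min f(2,3) by auto
  have "c \<ge> 0"
  proof (rule ccontr)
    assume "\<not> c \<ge> 0"
    then have "c < 0" by simp
    from DERIV_neg_dec_right[OF f2 this] obtain e where e: "e > 0" "\<And>h. 0 < h \<Longrightarrow> h < e \<Longrightarrow> f' (0 + h) < f' 0"
      by blast
    define h where "h = min d e / 2"
    have h: "0 < h" "h < e" "h < d" using d e(1) by (auto simp: h_def min_def)
    obtain z where z: "0 < z" "z < h" "f h - f 0 = (h - 0) * f' z"
      using MVT2[OF h(1), of f f'] f(1) by blast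
    have "f' z < 0" using e(2)[of z] z h f(3) b by simp
    then have "f h < f 0" using z h by (metis diff_less_0_iff_less mult_pos_neg diff_zero h(1))
    with min[of h] f(2) h show False by simp
  qed
  with b show ?thesis by simp
qed

lemma jet2_sum:
  "(\<And>i. i \<in> I \<Longrightarrow> jet2 (f i) (a i) (b i) (c i)) \<Longrightarrow>
    jet2 (\<lambda>t. \<Sum>i\<in>I. f i t) (\<Sum>i\<in>I. a i) (\<Sum>i\<in>I. b i) (\<Sum>i\<in>I. c i)"
proof (induction I rule: infinite_finite_induct)
  case (insert i I)
  then show ?case by (simp add: jet2_add)
qed (simp_all add: jet2_const)

lemma jet2_unique:
  assumes "jet2 f a b c" "jet2 f a' b' c'"
  shows "a = a' \<and> b = b' \<and> c = c'"
proof -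
  obtain f' where f: "\<forall>t. (f has_vector_derivative f' t) (at t)" "f 0 = a" "f' 0 = b"
    "(f' has_vector_derivative c) (at 0)" using assms(1) unfolding jet2_def by blast
  obtain g' where g: "\<forall>t. (f has_vector_derivative g' t) (at t)" "f 0 = a'" "g' 0 = b'"
    "(g' has_vector_derivative c') (at 0)" using assms(2) unfolding jet2_def by blast
  have "f' = g'" using f(1) g(1) vector_derivative_unique_at by blast
  with f g show ?thesis using vector_derivative_unique_at by blast
qed

lemma jet2_bounded_linear:
  assumes "bounded_linear h" "jet2 f a b c" shows "jet2 (\<lambda>t. h (f t)) (h a) (h b) (h c)"
proof -
  obtain f' where "\<forall>t. (f has_vector_derivative f' t) (at t)" "f 0 = a" "f' 0 = b"
    "(f' has_vector_derivative c) (at 0)" using assms(2) unfolding jet2_def by blast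
  then show ?thesis unfolding jet2_def
    by (intro exI[of _ "\<lambda>t. h (f' t)"]) (auto intro: bounded_linear.has_vector_derivative[OF assms(1)])
qed

lemma bounded_bilinear_matrix_mult:
  "bounded_bilinear ((**) :: real^'n^'m \<Rightarrow> real^'p^'n \<Rightarrow> real^'p^'m)"
  unfolding bilinear_conv_bounded_bilinear[symmetric] bilinear_def linear_iff
  by (auto simp: matrix_matrix_mult_def vec_eq_iff sum.distrib distrib_left distrib_right sum_distrib_left ac_simps)

lemma continuous_det:
  fixes A :: "real \<Rightarrow> real^'n^'n"
  assumes "\<And>i j. continuous F (\<lambda>s. A s $ i $ j)"
  shows "continuous F (\<lambda>s. det (A s))"
  unfolding det_def by (intro continuous_intros assms)

text \<open>
  Cramer's rule expresses the entries of the inverse through determinants, which are polynomials in the entries of the matrix.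
\<close>

lemma isCont_matrix_inverse:
  fixes A B :: "real \<Rightarrow> real^'n^'n"
  assumes inv: "\<And>s. A s ** B s = mat 1" and A: "isCont A s"
  shows "isCont B s"
proof -
  have cA: "continuous (at s) (\<lambda>s. A s $ i $ j)" for i j
    using A by (simp add: isCont_def tendsto_vec_nth)
  have nz: "det (A s) \<noteq> 0" for s
    using inv[of s] by (metis det_I det_mul mult_eq_0_iff zero_neq_one)
  have entry: "B s $ k $ q = det (\<chi> i j. if j = k then axis q 1 $ i else A s $ i $ j) / det (A s)" for s k q
  proof -
    have "A s *v (B s *v axis q 1) = axis q 1"
      by (simp add: matrix_vector_mul_assoc inv)
    then have "B s *v axis q 1 = (\<chi> k. det (\<chi> i j. if j = k then axis q 1 $ i else A s $ i $ j) / det (A s))"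
      using cramer[OF nz] by blast
    then show ?thesis
      by (simp add: vec_eq_iff matrix_vector_mult_basis column_def)
  qed
  have "continuous (at s) (\<lambda>s. if j = k then axis q 1 $ i else A s $ i $ j)" for i j k q
    by (cases "j = k") (auto intro: cA)
  then have "continuous (at s) (\<lambda>s. B s $ k $ q)" for k q
    unfolding entry by (intro continuous_divide continuous_det nz) (auto intro: cA)
  then have "((\<lambda>s. B s $ k $ q) \<longlongrightarrow> B s $ k $ q) (at s)" for k q
    by (simp add: isCont_def)
  then show ?thesis unfolding isCont_def by (intro vec_tendstoI)
qed

text \<open>
  Since \<open>B t - B s = - B t (A t - A s) B s\<close>, continuity of the inverse already yields its differentiability.
\<close>

lemma has_vector_derivative_matrix_inverse:
  fixes A B :: "real \<Rightarrow> real^'n^'n"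
  assumes inv: "\<And>s. A s ** B s = mat 1" and A: "(A has_vector_derivative A') (at s)"
  shows "(B has_vector_derivative - (B s ** A' ** B s)) (at s)"
proof -
  have inv': "B s ** A s = mat 1" for s using inv matrix_left_right_inverse by blast
  note bb = bounded_bilinear_matrix_mult
  have B: "(B \<longlongrightarrow> B s) (at s)"
    using isCont_matrix_inverse[OF inv has_vector_derivative_continuous[OF A]] by (simp add: isCont_def)
  have lim: "((\<lambda>t. - (B t ** ((1 / (t - s)) *\<^sub>R (A t - A s)) ** B s)) \<longlongrightarrow> - (B s ** A' ** B s)) (at s)"
    using A by (intro tendsto_minus bounded_bilinear.tendsto[OF bb] B tendsto_const)
       (simp add: has_vector_derivative_iff_quotient)
  have "B t - B s = - (B t ** (A t - A s) ** B s)" for t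
  proof -
    have "B t ** (A t - A s) ** B s = B t ** A t ** B s - B t ** (A s ** B s)"
      by (simp add: bounded_bilinear.diff_left[OF bb] bounded_bilinear.diff_right[OF bb] matrix_mul_assoc)
    then show ?thesis by (simp add: inv inv')
  qed
  then have "(1 / (t - s)) *\<^sub>R (B t - B s) = - (B t ** ((1 / (t - s)) *\<^sub>R (A t - A s)) ** B s)" for t
    by (simp add: bounded_bilinear.scaleR_left[OF bb] bounded_bilinear.scaleR_right[OF bb])
  with lim show ?thesis by (simp add: has_vector_derivative_iff_quotient)
qed

lemma jet2_matrix_inverse:
  fixes A B :: "real \<Rightarrow> real^'n^'n"
  assumes inv: "\<And>s. A s ** B s = mat 1" and A: "jet2 A (mat 1) b c"
  shows "jet2 B (mat 1) (- b) (2 *\<^sub>R (b ** b) - c)"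
proof -
  obtain A' where A': "\<And>t. (A has_vector_derivative A' t) (at t)" "A 0 = mat 1" "A' 0 = b"
     "(A' has_vector_derivative c) (at 0)"
    using A unfolding jet2_def by blast
  define B' where "B' t = - (B t ** A' t ** B t)" for t
  have B': "(B has_vector_derivative B' t) (at t)" for t
    unfolding B'_def by (rule has_vector_derivative_matrix_inverse[OF inv A'(1)])
  have B0: "B 0 = mat 1" using inv[of 0] A'(2) by simp
  note d = bounded_bilinear.has_vector_derivative[OF bounded_bilinear_matrix_mult]
  have "((\<lambda>t. - (B t ** A' t ** B t)) has_vector_derivative
      - (B 0 ** A' 0 ** B' 0 + (B 0 ** c + B' 0 ** A' 0) ** B 0)) (at 0)"
    by (intro has_vector_derivative_minus d B' A')
  moreover have "- (B 0 ** A' 0 ** B' 0 + (B 0 ** c + B' 0 ** A' 0) ** B 0) = 2 *\<^sub>R (b ** b) - c"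
    unfolding B'_def by (simp add: B0 A' B'_def scaleR_2 bounded_bilinear.minus_left[OF bounded_bilinear_matrix_mult]
        bounded_bilinear.minus_right[OF bounded_bilinear_matrix_mult])
  ultimately have "((\<lambda>t. B' t) has_vector_derivative 2 *\<^sub>R (b ** b) - c) (at 0)"
    by (simp only: B'_def)
  moreover have "B' 0 = - b" by (simp add: B'_def B0 A')
  ultimately show ?thesis unfolding jet2_def using B' B0 by (intro exI[of _ B']) auto
qed

section \<open>Orthonormalising curves of vectors\<close>

lemma C1_differentiable_on_bilinear:
  assumes B: "bounded_bilinear B" and f: "f C1_differentiable_on S" and g: "g C1_differentiable_on S"
  shows "(\<lambda>t. B (f t) (g t)) C1_differentiable_on S"
proof -
  obtain f' where f': "\<And>t. t \<in> S \<Longrightarrow> (f has_vector_derivative f' t) (at t)" "continuous_on S f'"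
    using f unfolding C1_differentiable_on_def by blast
  obtain g' where g': "\<And>t. t \<in> S \<Longrightarrow> (g has_vector_derivative g' t) (at t)" "continuous_on S g'"
    using g unfolding C1_differentiable_on_def by blast
  have c: "continuous_on S f" "continuous_on S g"
    using f'(1) g'(1) by (auto intro!: continuous_at_imp_continuous_on has_vector_derivative_continuous)
  show ?thesis unfolding C1_differentiable_on_def
  proof (intro exI conjI ballI)
    show "((\<lambda>t. B (f t) (g t)) has_vector_derivative B (f t) (g' t) + B (f' t) (g t)) (at t)" if "t \<in> S" for t
      by (rule bounded_bilinear.has_vector_derivative[OF B f'(1)[OF that] g'(1)[OF that]])
    show "continuous_on S (\<lambda>t. B (f t) (g' t) + B (f' t) (g t))"
      by (intro continuous_on_add bounded_bilinear.continuous_on[OF B] c f'(2) g'(2))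
  qed
qed

lemma C1_differentiable_on_inverse_sqrt:
  assumes f: "f C1_differentiable_on S" and pos: "\<And>t. t \<in> S \<Longrightarrow> f t > (0::real)"
  shows "(\<lambda>t. inverse (sqrt (f t))) C1_differentiable_on S"
proof -
  obtain f' where f': "\<And>t. t \<in> S \<Longrightarrow> (f has_real_derivative f' t) (at t)" "continuous_on S f'"
    using f unfolding C1_differentiable_on_def has_real_derivative_iff_has_vector_derivative by blast
  have c: "continuous_on S f"
    using f'(1) by (auto intro!: continuous_at_imp_continuous_on DERIV_isCont)
  show ?thesis unfolding C1_differentiable_on_def has_real_derivative_iff_has_vector_derivative[symmetric]
  proof (intro exI conjI ballI)
    show "((\<lambda>t. inverse (sqrt (f t))) has_real_derivative - (f' t / (2 * sqrt (f t) * f t))) (at t)" if "t \<in> S" for t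
      using pos[OF that] by (auto intro!: derivative_eq_intros f'(1)[OF that] simp: field_simps power2_eq_square)
    show "continuous_on S (\<lambda>t. - (f' t / (2 * sqrt (f t) * f t)))"
      by (intro continuous_intros c f'(2)) (use pos in fastforce)
  qed
qed

lemma C1_differentiable_on_sum:
  "(\<And>i. i \<in> I \<Longrightarrow> f i C1_differentiable_on S) \<Longrightarrow> (\<lambda>t. \<Sum>i\<in>I. f i t) C1_differentiable_on S"
  by (induction I rule: infinite_finite_induct) auto

lemma span_image_sum:
  assumes "finite I" "s \<in> span (f ` I)"
  obtains c where "s = (\<Sum>i\<in>I. c i *\<^sub>R f i)"
proof -
  let ?W = "{s. \<exists>c. s = (\<Sum>i\<in>I. c i *\<^sub>R f i)}"
  have "subspace ?W"
  proof (rule subspaceI)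
    show "0 \<in> ?W" by (auto intro!: exI[of _ "\<lambda>_. 0"])
    fix x y assume "x \<in> ?W" "y \<in> ?W"
    then obtain c d where "x = (\<Sum>i\<in>I. c i *\<^sub>R f i)" "y = (\<Sum>i\<in>I. d i *\<^sub>R f i)" by blast
    then show "x + y \<in> ?W" by (auto simp: sum.distrib scaleR_add_left intro!: exI[of _ "\<lambda>i. c i + d i"])
  next
    fix r x assume "x \<in> ?W"
    then obtain c where "x = (\<Sum>i\<in>I. c i *\<^sub>R f i)" by blast
    then show "r *\<^sub>R x \<in> ?W" by (auto simp: scaleR_sum_right intro!: exI[of _ "\<lambda>i. r * c i"])
  qed
  moreover have "f ` I \<subseteq> ?W"
  proof clarify
    fix i assume "i \<in> I"
    then have "f i = (\<Sum>j\<in>I. (if j = i then 1 else 0) *\<^sub>R f j)"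
      using assms(1) by (simp add: if_distrib[of "\<lambda>c. c *\<^sub>R _"] sum.delta' cong: if_cong)
    then show "\<exists>c. f i = (\<Sum>j\<in>I. c j *\<^sub>R f j)"
      by (intro exI[of _ "\<lambda>j. if j = i then 1 else 0"])
  qed
  ultimately have "span (f ` I) \<subseteq> ?W" by (rule span_minimal[rotated])
  with assms(2) that show ?thesis by blast
qed

text \<open>
  Gram-Schmidt for curves. Positivity on all nontrivial combinations says at once that the vectors are independent and that the form is definite on their span, so no step divides by zero. One instance produces paths of frames between tangent planes, and the instance with constant curves produces a frame that is orthonormal for the induced metric at a point.
\<close>

lemma gram_schmidt_curves:
  fixes B :: "'a::real_normed_vector \<Rightarrow> 'a \<Rightarrow> real" and f :: "'i \<Rightarrow> real \<Rightarrow> 'a"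
  assumes B: "bounded_bilinear B" and sym: "\<And>v w. B v w = B w v"
  shows "finite I \<Longrightarrow> (\<And>i. i \<in> I \<Longrightarrow> f i C1_differentiable_on S) \<Longrightarrow>
    (\<And>t c. t \<in> S \<Longrightarrow> \<exists>i\<in>I. c i \<noteq> 0 \<Longrightarrow> B (\<Sum>i\<in>I. c i *\<^sub>R f i t) (\<Sum>i\<in>I. c i *\<^sub>R f i t) > 0) \<Longrightarrow>
    \<exists>e. (\<forall>i\<in>I. e i C1_differentiable_on S) \<and>
      (\<forall>t\<in>S. (\<forall>i\<in>I. \<forall>j\<in>I. B (e i t) (e j t) = (if i = j then 1 else 0)) \<and>
         span ((\<lambda>i. e i t) ` I) = span ((\<lambda>i. f i t) ` I))"
proof (induction I rule: finite_induct)
  case empty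
  then show ?case by simp
next
  case (insert k I)
  interpret B: bounded_bilinear B by (rule B)
  have sub: "B (\<Sum>i\<in>I. c i *\<^sub>R f i t) (\<Sum>i\<in>I. c i *\<^sub>R f i t) > 0" if "t \<in> S" "\<exists>i\<in>I. c i \<noteq> 0" for t c
  proof -
    have "(\<Sum>i\<in>insert k I. (c(k := 0)) i *\<^sub>R f i t) = (\<Sum>i\<in>I. (c(k := 0)) i *\<^sub>R f i t)"
      using insert.hyps by simp
    also have "\<dots> = (\<Sum>i\<in>I. c i *\<^sub>R f i t)"
      using insert.hyps(2) by (intro sum.cong) auto
    moreover have "\<exists>i\<in>insert k I. (c(k := 0)) i \<noteq> 0" using that(2) insert.hyps(2) by auto
    ultimately show ?thesis using insert.prems(2)[OF that(1), of "c(k := 0)"] by simp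
  qed
  obtain e where e: "\<And>i. i \<in> I \<Longrightarrow> e i C1_differentiable_on S"
    and orth: "\<And>t i j. t \<in> S \<Longrightarrow> i \<in> I \<Longrightarrow> j \<in> I \<Longrightarrow> B (e i t) (e j t) = (if i = j then 1 else 0)"
    and span: "\<And>t. t \<in> S \<Longrightarrow> span ((\<lambda>i. e i t) ` I) = span ((\<lambda>i. f i t) ` I)"
    using insert.IH[OF insert.prems(1) sub] by blast
  define s where "s t = (\<Sum>i\<in>I. B (f k t) (e i t) *\<^sub>R e i t)" for t
  define w where "w t = f k t - s t" for t
  define n where "n t = inverse (sqrt (B (w t) (w t)))" for t
  have s_span: "s t \<in> span ((\<lambda>i. f i t) ` I)" if "t \<in> S" for t
    unfolding span[OF that, symmetric] s_def by (intro span_sum span_scale span_base) auto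
  \<comment> \<open>The vector \<open>w t\<close> is a combination of the given vectors in which \<open>f k t\<close> has coefficient 1.\<close>
  have pos: "B (w t) (w t) > 0" if t: "t \<in> S" for t
  proof -
    obtain c where c: "s t = (\<Sum>i\<in>I. c i *\<^sub>R f i t)"
      using span_image_sum[OF insert.hyps(1) s_span[OF t]] by blast
    let ?c = "\<lambda>i. if i = k then 1 else - c i"
    have "(\<Sum>i\<in>insert k I. ?c i *\<^sub>R f i t) = f k t + (\<Sum>i\<in>I. ?c i *\<^sub>R f i t)"
      using insert.hyps by simp
    also have "(\<Sum>i\<in>I. ?c i *\<^sub>R f i t) = - s t"
      unfolding c sum_negf[symmetric] using insert.hyps(2) by (intro sum.cong) auto
    finally have "(\<Sum>i\<in>insert k I. ?c i *\<^sub>R f i t) = w t" by (simp add: w_def)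
    then show ?thesis using insert.prems(2)[OF t, of ?c] by force
  qed
  have w_orth: "B (w t) (e j t) = 0" if "t \<in> S" "j \<in> I" for t j
  proof -
    have "B (s t) (e j t) = (\<Sum>i\<in>I. B (f k t) (e i t) * B (e i t) (e j t))"
      by (simp add: s_def B.sum_left B.scaleR_left)
    also have "\<dots> = (\<Sum>i\<in>I. if i = j then B (f k t) (e i t) else 0)"
      using orth[OF that(1) _ that(2)] by (intro sum.cong) auto
    also have "\<dots> = B (f k t) (e j t)"
      using insert.hyps(1) that(2) by simp
    finally show ?thesis by (simp add: w_def B.diff_left)
  qed
  have nn: "n t * n t * B (w t) (w t) = 1" if "t \<in> S" for t
    using pos[OF that] by (simp add: n_def field_simps)
  have n_nz: "n t \<noteq> 0" if "t \<in> S" for t using pos[OF that] by (simp add: n_def)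
  define e' where "e' i = (if i = k then (\<lambda>t. n t *\<^sub>R w t) else e i)" for i
  have e'I: "e' i = e i" if "i \<in> I" for i using that insert.hyps(2) by (auto simp: e'_def)
  have e'k: "e' k = (\<lambda>t. n t *\<^sub>R w t)" by (simp add: e'_def)
  have wC1: "w C1_differentiable_on S"
    unfolding w_def s_def
    by (intro C1_differentiable_on_diff C1_differentiable_on_sum C1_differentiable_on_scaleR
        C1_differentiable_on_bilinear[OF B] e insert.prems(1)) auto
  have nC1: "n C1_differentiable_on S"
    unfolding n_def by (intro C1_differentiable_on_inverse_sqrt C1_differentiable_on_bilinear[OF B] wC1 pos)
  show ?case
  proof (intro exI[of _ e'] conjI ballI)
    fix i assume "i \<in> insert k I"
    then show "e' i C1_differentiable_on S"
      using e e'I e'k C1_differentiable_on_scaleR[OF nC1 wC1] by (cases "i = k") auto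
  next
    fix t i j assume t: "t \<in> S" and "i \<in> insert k I" "j \<in> insert k I"
    then consider "i = k" "j = k" | "i = k" "j \<in> I" | "i \<in> I" "j = k" | "i \<in> I" "j \<in> I" by blast
    then show "B (e' i t) (e' j t) = (if i = j then 1 else 0)"
    proof cases
      case 1
      then show ?thesis using nn[OF t] by (simp add: e'k B.scaleR_left B.scaleR_right mult_ac)
    next
      case 2
      then show ?thesis using w_orth[OF t] insert.hyps(2) by (auto simp: e'k e'I B.scaleR_left)
    next
      case 3
      then show ?thesis using w_orth[OF t] insert.hyps(2) by (auto simp: e'k e'I B.scaleR_left sym[of "e i t"])
    next
      case 4
      then show ?thesis using orth[OF t] by (simp add: e'I)
    qed
  next
    fix t assume t: "t \<in> S"
    let ?F = "(\<lambda>i. f i t) ` I"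
    have im: "(\<lambda>i. e' i t) ` insert k I = insert (n t *\<^sub>R w t) ((\<lambda>i. e i t) ` I)"
      using e'I e'k by auto
    have sF: "s t \<in> span (insert x ?F)" for x
      using s_span[OF t] span_mono[of ?F "insert x ?F"] by blast
    have "span (insert (n t *\<^sub>R w t) ((\<lambda>i. e i t) ` I)) = span (insert (n t *\<^sub>R w t) ?F)"
      unfolding span_insert span[OF t] ..
    also have "\<dots> = span (insert (f k t) ?F)"
    proof (rule span_eq[THEN iffD2], intro conjI insert_subsetI)
      show "n t *\<^sub>R w t \<in> span (insert (f k t) ?F)"
        unfolding w_def by (intro span_scale span_diff sF span_base) auto
      have "f k t = inverse (n t) *\<^sub>R (n t *\<^sub>R w t) + s t"
        using n_nz[OF t] by (simp add: w_def)
      also have "\<dots> \<in> span (insert (n t *\<^sub>R w t) ?F)"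
        by (intro span_add sF) (intro span_scale span_base insertI1)
      finally show "f k t \<in> span (insert (n t *\<^sub>R w t) ?F)" .
    qed (auto intro: span_base)
    finally show "span ((\<lambda>i. e' i t) ` insert k I) = span ((\<lambda>i. f i t) ` insert k I)"
      unfolding im unfolding image_insert .
  qed
qed

section \<open>The translator equation in an orthonormal frame\<close>

lemma axis_expansion: "v = (\<Sum>i\<in>UNIV. v $ i *\<^sub>R axis i (1::real))"
  by (simp add: vec_eq_iff axis_def if_distrib cong: if_cong)

lemma linear_axis_expansion:
  assumes "linear f"
  shows "f v = (\<Sum>i\<in>UNIV. v $ i *\<^sub>R f (axis i (1::real)))"
proof -
  have "f v = f (\<Sum>i\<in>UNIV. v $ i *\<^sub>R axis i 1)" by (rule arg_cong[OF axis_expansion])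
  then show ?thesis by (simp add: linear_sum[OF assms] linear_cmul[OF assms])
qed

lemma dirderiv2_expand:
  fixes u :: "real^'m \<Rightarrow> 'b::euclidean_space"
  assumes "smooth u"
  shows "dirderiv v (dirderiv w u) x =
    (\<Sum>i\<in>UNIV. \<Sum>j\<in>UNIV. (v $ i * w $ j) *\<^sub>R dirderiv (axis i 1) (dirderiv (axis j 1) u) x)"
proof -
  have "dirderiv v (dirderiv w u) x = (\<Sum>i\<in>UNIV. v $ i *\<^sub>R dirderiv (axis i 1) (dirderiv w u) x)"
    by (rule linear_axis_expansion[OF linear_dirderiv[OF smooth_dirderiv[OF assms]]])
  also have "\<dots> = (\<Sum>i\<in>UNIV. v $ i *\<^sub>R dirderiv w (dirderiv (axis i 1) u) x)"
    by (intro sum.cong refl arg_cong[where f="scaleR _"] fun_cong[OF dirderiv_commute[OF assms]])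
  also have "\<dots> = (\<Sum>i\<in>UNIV. v $ i *\<^sub>R (\<Sum>j\<in>UNIV. w $ j *\<^sub>R dirderiv (axis j 1) (dirderiv (axis i 1) u) x))"
    by (simp only: linear_axis_expansion[OF linear_dirderiv[OF smooth_dirderiv[OF assms]], of w])
  also have "\<dots> = (\<Sum>i\<in>UNIV. \<Sum>j\<in>UNIV. (v $ i * w $ j) *\<^sub>R dirderiv (axis i 1) (dirderiv (axis j 1) u) x)"
    unfolding scaleR_sum_right scaleR_scaleR
    by (intro sum.cong refl arg_cong[where f="scaleR _"] fun_cong[OF dirderiv_commute[OF assms]])
  finally show ?thesis .
qed

definition graph_metric :: "(real^'m \<Rightarrow> real^'n) \<Rightarrow> real^'m \<Rightarrow> real^'m \<Rightarrow> real^'m \<Rightarrow> real" where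
  "graph_metric u x v w = v \<bullet> w - dirderiv v u x \<bullet> dirderiv w u x"

lemma graph_metric_expand:
  assumes smooth_u: "smooth u"
  shows "graph_metric u x v w = (\<Sum>i\<in>UNIV. \<Sum>j\<in>UNIV. v $ i * w $ j * graph_metric u x (axis i 1) (axis j 1))"
proof -
  have lin: "dirderiv z u x = (\<Sum>i\<in>UNIV. z $ i *\<^sub>R dirderiv (axis i 1) u x)" for z
    by (rule linear_axis_expansion[OF linear_dirderiv[OF smooth_u]])
  have "graph_metric u x v w = (\<Sum>i\<in>UNIV. v $ i *\<^sub>R axis i (1::real)) \<bullet> (\<Sum>j\<in>UNIV. w $ j *\<^sub>R axis j (1::real))
     - (\<Sum>i\<in>UNIV. v $ i *\<^sub>R dirderiv (axis i 1) u x) \<bullet> (\<Sum>j\<in>UNIV. w $ j *\<^sub>R dirderiv (axis j 1) u x)"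
    unfolding graph_metric_def
    by (intro arg_cong2[where f=minus] arg_cong2[where f=inner] axis_expansion lin)
  also have "\<dots> = (\<Sum>i\<in>UNIV. \<Sum>j\<in>UNIV. v $ i * w $ j * graph_metric u x (axis i 1) (axis j 1))"
    unfolding inner_sum_left unfolding inner_sum_right
    by (simp add: graph_metric_def right_diff_distrib sum_subtractf mult_ac)
  finally show ?thesis .
qed

text \<open>
  The soliton equation in the chart. \<open>G\<close> is the inverse of the induced metric, and \<open>(a, b)\<close> is the translation vector.
\<close>

locale graph_translator =
  fixes u :: "real^'m \<Rightarrow> real^'n" and G :: "real^'m \<Rightarrow> real^'m^'m" and a :: "real^'m" and b :: "real^'n"
  assumes smooth_u: "smooth u"
    and inverse_metric: "\<And>x. (\<chi> i j. graph_metric u x (axis i 1) (axis j 1)) ** G x = mat 1"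
    and translator_equation: "\<And>x. (\<Sum>i\<in>UNIV. \<Sum>j\<in>UNIV.
        G x $ i $ j *\<^sub>R dirderiv (axis i 1) (dirderiv (axis j 1) u) x) = b - dirderiv a u x"
begin

abbreviation D1 where "D1 v x \<equiv> dirderiv v u x"
abbreviation D2 where "D2 v w x \<equiv> dirderiv v (dirderiv w u) x"
abbreviation D3 where "D3 v w z x \<equiv> dirderiv v (dirderiv w (dirderiv z u)) x"
abbreviation D4 where "D4 v w z r x \<equiv> dirderiv v (dirderiv w (dirderiv z (dirderiv r u))) x"

text \<open>
  The operator \<open>\<Sum> G\<^sub>i\<^sub>j \<partial>\<^sub>i \<partial>\<^sub>j\<close> does not depend on the basis. In a basis that is orthonormal at \<open>x0\<close> the coefficient matrix is the identity at \<open>x0\<close>, which makes its derivatives there simple.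
\<close>

lemma frame_equation:
  fixes E :: "'m \<Rightarrow> real^'m"
  assumes E: "\<And>p q. graph_metric u x0 (E p) (E q) = (if p = q then 1 else 0)"
  obtains \<Gamma> :: "real^'m \<Rightarrow> real^'m^'m" where
    "\<And>x. (\<chi> p q. graph_metric u x (E p) (E q)) ** \<Gamma> x = mat 1"
    "\<And>x. (\<Sum>p\<in>UNIV. \<Sum>q\<in>UNIV. \<Gamma> x $ p $ q *\<^sub>R D2 (E p) (E q) x) = b - D1 a x"
proof -
  define g where "g x = (\<chi> i j. graph_metric u x (axis i 1) (axis j 1))" for x
  define M :: "real^'m^'m" where "M = (\<chi> i p. E p $ i)"
  \<comment> \<open>By orthonormality of the columns of \<open>M\<close> this is the inverse of \<open>M\<close>.\<close>
  define N where "N = transpose M ** g x0"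
  have frame: "transpose M ** g x ** M = (\<chi> p q. graph_metric u x (E p) (E q))" for x
  proof -
    have "(transpose M ** g x ** M) $ p $ q = graph_metric u x (E p) (E q)" for p q
    proof -
      have "(transpose M ** g x ** M) $ p $ q =
          (\<Sum>j\<in>UNIV. (\<Sum>i\<in>UNIV. E p $ i * graph_metric u x (axis i 1) (axis j 1)) * E q $ j)"
        by (simp add: matrix_matrix_mult_def transpose_def M_def g_def)
      also have "\<dots> = (\<Sum>j\<in>UNIV. \<Sum>i\<in>UNIV. E p $ i * E q $ j * graph_metric u x (axis i 1) (axis j 1))"
        unfolding sum_distrib_right by (intro sum.cong refl) simp
      also have "\<dots> = graph_metric u x (E p) (E q)"
        by (subst sum.swap) (rule graph_metric_expand[OF smooth_u, symmetric])
      finally show ?thesis .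
    qed
    then show ?thesis by (simp add: vec_eq_iff)
  qed
  have NM: "N ** M = mat 1"
    unfolding N_def frame by (simp add: E mat_def)
  then have MN: "M ** N = mat 1" by (simp add: matrix_left_right_inverse)
  define \<Gamma> where "\<Gamma> x = N ** G x ** transpose N" for x
  have "transpose M ** g x ** M ** \<Gamma> x = mat 1" for x
  proof -
    have "transpose M ** g x ** M ** \<Gamma> x = transpose M ** g x ** (M ** N) ** G x ** transpose N"
      by (simp add: \<Gamma>_def matrix_mul_assoc)
    also have "\<dots> = transpose M ** (g x ** G x) ** transpose N"
      by (simp add: MN matrix_mul_assoc)
    also have "\<dots> = transpose (N ** M)"
      using inverse_metric[of x] by (simp add: g_def matrix_transpose_mul)
    finally show ?thesis by (simp add: NM transpose_mat)
  qed
  then have 1: "(\<chi> p q. graph_metric u x (E p) (E q)) ** \<Gamma> x = mat 1" for x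
    by (simp add: frame)
  have G: "G x = M ** \<Gamma> x ** transpose M" for x
  proof -
    have "M ** \<Gamma> x ** transpose M = (M ** N) ** G x ** (transpose N ** transpose M)"
      by (simp add: \<Gamma>_def matrix_mul_assoc)
    then show ?thesis by (simp add: MN matrix_transpose_mul[symmetric] transpose_mat)
  qed
  have Gij: "G x $ i $ j = (\<Sum>p\<in>UNIV. \<Sum>q\<in>UNIV. \<Gamma> x $ p $ q * (E p $ i * E q $ j))" for x i j
  proof -
    have "G x $ i $ j = (\<Sum>q\<in>UNIV. (\<Sum>p\<in>UNIV. E p $ i * \<Gamma> x $ p $ q) * E q $ j)"
      by (simp add: G matrix_matrix_mult_def transpose_def M_def)
    also have "\<dots> = (\<Sum>q\<in>UNIV. \<Sum>p\<in>UNIV. \<Gamma> x $ p $ q * (E p $ i * E q $ j))"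
      unfolding sum_distrib_right by (intro sum.cong refl) simp
    also have "\<dots> = (\<Sum>p\<in>UNIV. \<Sum>q\<in>UNIV. \<Gamma> x $ p $ q * (E p $ i * E q $ j))"
      by (rule sum.swap)
    finally show ?thesis .
  qed
  have "(\<Sum>p\<in>UNIV. \<Sum>q\<in>UNIV. \<Gamma> x $ p $ q *\<^sub>R D2 (E p) (E q) x) = b - D1 a x" for x
  proof -
    let ?e = "\<lambda>i::'m. axis i (1::real)"
    have "(\<Sum>p\<in>UNIV. \<Sum>q\<in>UNIV. \<Gamma> x $ p $ q *\<^sub>R D2 (E p) (E q) x)
       = (\<Sum>p\<in>UNIV. \<Sum>q\<in>UNIV. \<Sum>i\<in>UNIV. \<Sum>j\<in>UNIV. (\<Gamma> x $ p $ q * (E p $ i * E q $ j)) *\<^sub>R D2 (?e i) (?e j) x)"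
      by (subst dirderiv2_expand[OF smooth_u]) (simp add: scaleR_sum_right)
    also have "\<dots> = (\<Sum>p\<in>UNIV. \<Sum>i\<in>UNIV. \<Sum>q\<in>UNIV. \<Sum>j\<in>UNIV. (\<Gamma> x $ p $ q * (E p $ i * E q $ j)) *\<^sub>R D2 (?e i) (?e j) x)"
      by (rule sum.cong[OF refl]) (rule sum.swap)
    also have "\<dots> = (\<Sum>i\<in>UNIV. \<Sum>p\<in>UNIV. \<Sum>q\<in>UNIV. \<Sum>j\<in>UNIV. (\<Gamma> x $ p $ q * (E p $ i * E q $ j)) *\<^sub>R D2 (?e i) (?e j) x)"
      by (rule sum.swap)
    also have "\<dots> = (\<Sum>i\<in>UNIV. \<Sum>p\<in>UNIV. \<Sum>j\<in>UNIV. \<Sum>q\<in>UNIV. (\<Gamma> x $ p $ q * (E p $ i * E q $ j)) *\<^sub>R D2 (?e i) (?e j) x)"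
      by (rule sum.cong[OF refl], rule sum.cong[OF refl]) (rule sum.swap)
    also have "\<dots> = (\<Sum>i\<in>UNIV. \<Sum>j\<in>UNIV. \<Sum>p\<in>UNIV. \<Sum>q\<in>UNIV. (\<Gamma> x $ p $ q * (E p $ i * E q $ j)) *\<^sub>R D2 (?e i) (?e j) x)"
      by (rule sum.cong[OF refl]) (rule sum.swap)
    also have "\<dots> = (\<Sum>i\<in>UNIV. \<Sum>j\<in>UNIV. G x $ i $ j *\<^sub>R D2 (?e i) (?e j) x)"
      by (simp add: Gij scaleR_sum_left)
    finally show ?thesis using translator_equation[of x] by simp
  qed
  with 1 that show ?thesis by blast
qed

text \<open>
  The equation, tested with a fixed vector \<open>c\<close>, differentiated once and twice along the line \<open>x0 + s w\<close>. If the metric in the frame has the jet \<open>(1, B, C)\<close>, then its inverse has the jet \<open>(1, - B, 2 B B - C)\<close>; the sums of \<open>\<sigma>\<close>, \<open>\<omega>\<close> and \<open>\<kappa>\<close> are the entries of \<open>- B\<close> and \<open>- C\<close>.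
\<close>

lemma equation_jets:
  fixes E :: "'m \<Rightarrow> real^'m" and w :: "real^'m" and c :: "real^'n"
  assumes E: "\<And>p q. graph_metric u x0 (E p) (E q) = (if p = q then 1 else 0)"
  defines "\<sigma> \<equiv> \<lambda>p q. D2 w (E p) x0 \<bullet> D1 (E q) x0"
    and "\<omega> \<equiv> \<lambda>p q. D2 w (E p) x0 \<bullet> D2 w (E q) x0"
    and "\<kappa> \<equiv> \<lambda>p q. D3 w w (E p) x0 \<bullet> D1 (E q) x0"
  shows "(\<Sum>p\<in>UNIV. c \<bullet> D3 w (E p) (E p) x0)
      + (\<Sum>p\<in>UNIV. \<Sum>q\<in>UNIV. (\<sigma> p q + \<sigma> q p) * (c \<bullet> D2 (E p) (E q) x0)) = - (c \<bullet> D2 w a x0)" (is ?first)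
    and "(\<Sum>p\<in>UNIV. c \<bullet> D4 w w (E p) (E p) x0)
      + 2 * (\<Sum>p\<in>UNIV. \<Sum>q\<in>UNIV. (\<sigma> p q + \<sigma> q p) * (c \<bullet> D3 w (E p) (E q) x0))
      + (\<Sum>p\<in>UNIV. \<Sum>q\<in>UNIV. (\<kappa> p q + \<kappa> q p + 2 * \<omega> p q
            + 2 * (\<Sum>r\<in>UNIV. (\<sigma> p r + \<sigma> r p) * (\<sigma> r q + \<sigma> q r))) * (c \<bullet> D2 (E p) (E q) x0))
      = - (c \<bullet> D3 w w a x0)" (is ?second)
proof -
  obtain \<Gamma> where inv: "\<And>x. (\<chi> p q. graph_metric u x (E p) (E q)) ** \<Gamma> x = mat 1"
    and eq: "\<And>x. (\<Sum>p\<in>UNIV. \<Sum>q\<in>UNIV. \<Gamma> x $ p $ q *\<^sub>R D2 (E p) (E q) x) = b - D1 a x"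
    using frame_equation[OF E] by blast
  define B :: "real^'m^'m" where "B = (\<chi> p q. - (\<sigma> p q + \<sigma> q p))"
  define C :: "real^'m^'m" where "C = (\<chi> p q. - (\<kappa> p q + \<kappa> q p + 2 * \<omega> p q))"
  have "jet2 (\<lambda>s. (\<chi> p q. graph_metric u (x0 + s *\<^sub>R w) (E p) (E q)) :: real^'m^'m) (mat 1) B C"
  proof (intro jet2_vec)
    fix p q
    have "jet2 (\<lambda>s. E p \<bullet> E q - D1 (E p) (x0 + s *\<^sub>R w) \<bullet> D1 (E q) (x0 + s *\<^sub>R w))
      (E p \<bullet> E q - D1 (E p) x0 \<bullet> D1 (E q) x0)
      (0 - (D1 (E p) x0 \<bullet> D2 w (E q) x0 + D2 w (E p) x0 \<bullet> D1 (E q) x0))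
      (0 - (D1 (E p) x0 \<bullet> D3 w w (E q) x0 + 2 *\<^sub>R (D2 w (E p) x0 \<bullet> D2 w (E q) x0) + D3 w w (E p) x0 \<bullet> D1 (E q) x0))"
      by (intro jet2_diff jet2_const jet2_inner jet2_line smooth_dirderiv smooth_u)
    moreover have "(mat 1 :: real^'m^'m) $ p $ q = E p \<bullet> E q - D1 (E p) x0 \<bullet> D1 (E q) x0"
      using E[of p q] by (simp add: mat_def graph_metric_def)
    ultimately show "jet2 (\<lambda>s. ((\<chi> p q. graph_metric u (x0 + s *\<^sub>R w) (E p) (E q)) :: real^'m^'m) $ p $ q)
        ((mat 1 :: real^'m^'m) $ p $ q) (B $ p $ q) (C $ p $ q)"
      by (elim jet2_cong) (auto simp: graph_metric_def B_def C_def \<sigma>_def \<kappa>_def \<omega>_def inner_commute)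
  qed
  from jet2_matrix_inverse[OF inv this]
  have "jet2 (\<lambda>s. \<Gamma> (x0 + s *\<^sub>R w)) (mat 1) (- B) (2 *\<^sub>R (B ** B) - C)" .
  then have \<Gamma>j: "jet2 (\<lambda>s. \<Gamma> (x0 + s *\<^sub>R w) $ p $ q) ((mat 1 :: real^'m^'m) $ p $ q) ((- B) $ p $ q)
      ((2 *\<^sub>R (B ** B) - C) $ p $ q)" for p q
    by (intro jet2_bounded_linear[OF bounded_linear_vec_nth]) auto
  have "jet2 (\<lambda>s. \<Sum>p\<in>UNIV. \<Sum>q\<in>UNIV. \<Gamma> (x0 + s *\<^sub>R w) $ p $ q * (c \<bullet> D2 (E p) (E q) (x0 + s *\<^sub>R w)))
     (\<Sum>p\<in>UNIV. \<Sum>q\<in>UNIV. (mat 1 :: real^'m^'m) $ p $ q * (c \<bullet> D2 (E p) (E q) x0))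
     (\<Sum>p\<in>UNIV. \<Sum>q\<in>UNIV. (mat 1 :: real^'m^'m) $ p $ q * (c \<bullet> D3 w (E p) (E q) x0)
         + (- B) $ p $ q * (c \<bullet> D2 (E p) (E q) x0))
     (\<Sum>p\<in>UNIV. \<Sum>q\<in>UNIV. (mat 1 :: real^'m^'m) $ p $ q * (c \<bullet> D4 w w (E p) (E q) x0)
         + 2 *\<^sub>R ((- B) $ p $ q * (c \<bullet> D3 w (E p) (E q) x0))
         + (2 *\<^sub>R (B ** B) - C) $ p $ q * (c \<bullet> D2 (E p) (E q) x0))"
    by (intro jet2_sum jet2_mult \<Gamma>j jet2_bounded_linear[OF bounded_linear_inner_right]
         jet2_line smooth_dirderiv smooth_u)
  moreover have "jet2 (\<lambda>s. c \<bullet> b - c \<bullet> D1 a (x0 + s *\<^sub>R w)) (c \<bullet> b - c \<bullet> D1 a x0)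
      (0 - c \<bullet> D2 w a x0) (0 - c \<bullet> D3 w w a x0)"
    by (intro jet2_diff jet2_const jet2_bounded_linear[OF bounded_linear_inner_right]
         jet2_line smooth_dirderiv smooth_u)
  moreover have "(\<Sum>p\<in>UNIV. \<Sum>q\<in>UNIV. \<Gamma> x $ p $ q * (c \<bullet> D2 (E p) (E q) x)) = c \<bullet> b - c \<bullet> D1 a x" for x
    using arg_cong[OF eq[of x], of "inner c"] by (simp add: inner_sum_right inner_diff_right)
  ultimately have J: "(\<Sum>p\<in>UNIV. \<Sum>q\<in>UNIV. (mat 1 :: real^'m^'m) $ p $ q * (c \<bullet> D3 w (E p) (E q) x0)
         + (- B) $ p $ q * (c \<bullet> D2 (E p) (E q) x0)) = - (c \<bullet> D2 w a x0) \<and>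
     (\<Sum>p\<in>UNIV. \<Sum>q\<in>UNIV. (mat 1 :: real^'m^'m) $ p $ q * (c \<bullet> D4 w w (E p) (E q) x0)
         + 2 *\<^sub>R ((- B) $ p $ q * (c \<bullet> D3 w (E p) (E q) x0))
         + (2 *\<^sub>R (B ** B) - C) $ p $ q * (c \<bullet> D2 (E p) (E q) x0)) = - (c \<bullet> D3 w w a x0)"
    by (auto dest: jet2_unique)
  have mat: "(\<Sum>q\<in>UNIV. (mat 1 :: real^'m^'m) $ p $ q * f q) = f p" for p :: 'm and f
    by (simp add: mat_def if_distrib[of "\<lambda>x. x * _"] cong: if_cong)
  have sq: "(2 *\<^sub>R (B ** B) - C) $ p $ q = \<kappa> p q + \<kappa> q p + 2 * \<omega> p q
            + 2 * (\<Sum>r\<in>UNIV. (\<sigma> p r + \<sigma> r p) * (\<sigma> r q + \<sigma> q r))" for p q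
  proof -
    have "(B ** B) $ p $ q = (\<Sum>r\<in>UNIV. (\<sigma> p r + \<sigma> r p) * (\<sigma> r q + \<sigma> q r))"
      unfolding matrix_matrix_mult_def B_def vec_lambda_beta by (intro sum.cong refl) (simp add: algebra_simps)
    then show ?thesis by (simp add: C_def)
  qed
  have neg: "(- B) $ p $ q = \<sigma> p q + \<sigma> q p" for p q by (simp add: B_def)
  show ?first
    using J by (simp only: sum.distrib mat neg)
  show ?second
    using J by (simp only: sum.distrib mat neg sq real_scaleR_def sum_distrib_left[symmetric])
qed

end

section \<open>Second variation along lines\<close>

lemma jet2_affine: "jet2 (\<lambda>t. c + t *\<^sub>R d) c d 0"
  using jet2_add[OF jet2_const[of c] jet2_scaleR[OF jet2_ident jet2_const[of d]]] by simp

context graph_translator begin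

text \<open>
  The vector \<open>(transpose_D1 x y, y)\<close> is the normal vector of the graph at \<open>x\<close> with vertical part \<open>y\<close>, and \<open>normal_sq x y\<close> is minus its pseudo-inner square.
\<close>

definition transpose_D1 :: "real^'m \<Rightarrow> real^'n \<Rightarrow> real^'m" where
  "transpose_D1 x y = (\<chi> i. y \<bullet> D1 (axis i 1) x)"

definition normal_sq :: "real^'m \<Rightarrow> real^'n \<Rightarrow> real" where
  "normal_sq x y = y \<bullet> y - transpose_D1 x y \<bullet> transpose_D1 x y"

lemma inner_functional:
  assumes "linear f"
  shows "(\<chi> i. y \<bullet> f (axis i 1)) \<bullet> w = (y::real^'n) \<bullet> f (w::real^'m)"
proof -
  have "f w = (\<Sum>i\<in>UNIV. w $ i *\<^sub>R f (axis i 1))"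
    by (rule linear_axis_expansion[OF assms])
  then show ?thesis by (simp add: inner_vec_def[of _ w] inner_sum_right mult.commute)
qed

lemma transpose_D1_inner: "transpose_D1 x y \<bullet> w = y \<bullet> D1 w x"
  unfolding transpose_D1_def by (rule inner_functional[OF linear_dirderiv[OF smooth_u]])

lemma D1_line: "D1 (v + t *\<^sub>R w) x = D1 v x + t *\<^sub>R D1 w x"
  by (simp add: dirderiv_add dirderiv_scaleR smooth_u)

lemma D2_commute: "D2 v w x = D2 w v x"
  by (rule fun_cong[OF dirderiv_commute[OF smooth_u]])

lemma D2_linear: "linear (\<lambda>w. D2 e w x)"
  by (rule ssubst[where P = linear, OF ext[OF D2_commute] linear_dirderiv[OF smooth_dirderiv[OF smooth_u]]])

lemma D3_commute: "D3 v w r x = D3 r v w x"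
proof -
  have "D3 v w r x = D3 v r w x" by (simp only: dirderiv_commute[OF smooth_u, of w r])
  also have "\<dots> = D3 r v w x" by (rule fun_cong[OF dirderiv_commute[OF smooth_dirderiv[OF smooth_u]]])
  finally show ?thesis .
qed

lemma D3_linear: "linear (\<lambda>w. D3 v r w x)"
  by (rule ssubst[where P = linear, OF ext[OF D3_commute]
        linear_dirderiv[OF smooth_dirderiv[OF smooth_dirderiv[OF smooth_u]]]])

lemma D2_add1: "D2 (v + w) r x = D2 v r x + D2 w r x"
  by (simp add: dirderiv_add smooth_dirderiv smooth_u)

lemma D2_scale1: "D2 (t *\<^sub>R v) r x = t *\<^sub>R D2 v r x"
  by (simp add: dirderiv_scaleR smooth_dirderiv smooth_u)

lemma D2_add2: "D2 r (v + w) x = D2 r v x + D2 r w x"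
  using D2_add1 D2_commute by metis

lemma D2_scale2: "D2 r (t *\<^sub>R v) x = t *\<^sub>R D2 r v x"
  using D2_scale1 D2_commute by metis

lemma D2_line: "D2 (v + t *\<^sub>R w) (v + t *\<^sub>R w) x = D2 v v x + (2 * t) *\<^sub>R D2 v w x + (t * t) *\<^sub>R D2 w w x"
proof -
  let ?z = "v + t *\<^sub>R w"
  have 1: "D2 r ?z x = D2 r v x + t *\<^sub>R D2 r w x" for r
    by (simp only: D2_add2 D2_scale2)
  have 2: "D2 ?z r x = D2 v r x + t *\<^sub>R D2 w r x" for r
    by (simp only: D2_add1 D2_scale1)
  have "D2 ?z ?z x = D2 v v x + t *\<^sub>R D2 w v x + t *\<^sub>R (D2 v w x + t *\<^sub>R D2 w w x)"
    using 1[of ?z] 2[of v] 2[of w] by argo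
  then show ?thesis
    using D2_commute[of w v x] scaleR_left_distrib[of t t "D2 v w x"]
    by (simp add: scaleR_add_right)
qed

text \<open>
  The hypotheses say that \<open>(x0, v, y)\<close> maximises the curvature in the direction of unit vectors, weighted
  with the cutoff \<open>1 - k \<bar>x\<bar>\<^sup>2\<close>, and that \<open>v\<close> and the normal vector of \<open>y\<close> have unit length. The length of the normal vector,
  a square root, has been replaced by its majorant \<open>(normal_sq x y + 1) / 2\<close>, which agrees with it to first order at
  length \<open>1\<close> and is smooth. The conclusions are the first and second derivative tests along the line
  \<open>(x0 + t e, v + t V, y + t Y)\<close>; \<open>A1, A2\<close> and \<open>C1, C2\<close> and \<open>N1, N2\<close> are the first and second derivatives of
  the squared length of the tangent vector, the squared length of the normal vector, and the second fundamental form.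
\<close>

lemma variation_along_line:
  fixes x0 e v V :: "real^'m" and y Y :: "real^'n" and M k R :: real
  assumes ineq: "\<And>x v y. norm x < R \<Longrightarrow>
      (y \<bullet> D2 v v x) * (1 - k * (x \<bullet> x)) \<le> M * graph_metric u x v v * (normal_sq x y + 1) / 2"
    and x0: "norm x0 < R"
    and A0: "graph_metric u x0 v v = 1" and C0: "normal_sq x0 y = 1"
    and N0: "(y \<bullet> D2 v v x0) * (1 - k * (x0 \<bullet> x0)) = M"
  defines "A1 \<equiv> 2 * (v \<bullet> V - D1 v x0 \<bullet> (D2 e v x0 + D1 V x0))"
    and "A2 \<equiv> 2 * (V \<bullet> V - (D2 e v x0 + D1 V x0) \<bullet> (D2 e v x0 + D1 V x0)
           - D1 v x0 \<bullet> (D3 e e v x0 + 2 *\<^sub>R D2 e V x0))"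
    and "C1 \<equiv> 2 * (y \<bullet> Y - transpose_D1 x0 y \<bullet> ((\<chi> i. y \<bullet> D2 e (axis i 1) x0) + transpose_D1 x0 Y))"
    and "C2 \<equiv> 2 * (Y \<bullet> Y - ((\<chi> i. y \<bullet> D2 e (axis i 1) x0) + transpose_D1 x0 Y) \<bullet> ((\<chi> i. y \<bullet> D2 e (axis i 1) x0) + transpose_D1 x0 Y)
           - (y \<bullet> D3 e e (transpose_D1 x0 y) x0 + 2 * (Y \<bullet> D2 e (transpose_D1 x0 y) x0)))"
    and "N1 \<equiv> y \<bullet> (D3 e v v x0 + 2 *\<^sub>R D2 v V x0) + Y \<bullet> D2 v v x0"
    and "N2 \<equiv> y \<bullet> (D4 e e v v x0 + 4 *\<^sub>R D3 e v V x0 + 2 *\<^sub>R D2 V V x0)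
           + 2 * (Y \<bullet> (D3 e v v x0 + 2 *\<^sub>R D2 v V x0))"
  shows "N1 * (1 - k * (x0 \<bullet> x0)) + (y \<bullet> D2 v v x0) * (- (2 * k * (x0 \<bullet> e))) = M * (A1 + C1 / 2)"
    and "N2 * (1 - k * (x0 \<bullet> x0)) + 2 * N1 * (- (2 * k * (x0 \<bullet> e))) + (y \<bullet> D2 v v x0) * (- (2 * k * (e \<bullet> e)))
       \<le> M * (A2 + A1 * C1 + C2 / 2)"
proof -
  let ?x = "\<lambda>t. x0 + t *\<^sub>R e"
  note sm = smooth_u smooth_dirderiv
  have tl: "jet2 (\<lambda>t. t *\<^sub>R f (?x t)) 0 (f x0) (2 *\<^sub>R dirderiv e f x0)"
    if "smooth f" for f :: "real^'m \<Rightarrow> real^'n"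
    using jet2_scaleR[OF jet2_ident jet2_line[OF that, of x0 e]] by simp
  have Aj: "jet2 (\<lambda>t. graph_metric u (?x t) (v + t *\<^sub>R V) (v + t *\<^sub>R V)) 1 A1 A2"
  proof -
    have Q: "jet2 (\<lambda>t. D1 v (?x t) + t *\<^sub>R D1 V (?x t)) (D1 v x0 + 0) (D2 e v x0 + D1 V x0)
        (D3 e e v x0 + 2 *\<^sub>R D2 e V x0)"
      by (intro jet2_add jet2_line tl sm)
    show ?thesis
      by (rule jet2_cong[OF jet2_diff[OF jet2_inner[OF jet2_affine[of v V] jet2_affine[of v V]] jet2_inner[OF Q Q]]])
        (use A0 in \<open>simp_all add: graph_metric_def D1_line A1_def A2_def inner_commute algebra_simps\<close>)
  qed
  have Cj: "jet2 (\<lambda>t. normal_sq (?x t) (y + t *\<^sub>R Y)) 1 C1 C2"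
  proof -
    have P: "jet2 (\<lambda>t. \<chi> i. (y + t *\<^sub>R Y) \<bullet> D1 (axis i 1) (?x t)) (\<chi> i. y \<bullet> D1 (axis i 1) x0)
       (\<chi> i. y \<bullet> D2 e (axis i 1) x0 + Y \<bullet> D1 (axis i 1) x0)
       (\<chi> i. y \<bullet> D3 e e (axis i 1) x0 + 2 *\<^sub>R (Y \<bullet> D2 e (axis i 1) x0) + 0 \<bullet> D1 (axis i 1) x0)"
      by (rule jet2_vec, unfold vec_lambda_beta) (intro jet2_inner jet2_affine jet2_line sm)
    have P1: "(\<chi> i. y \<bullet> D2 e (axis i 1) x0 + Y \<bullet> D1 (axis i 1) x0)
        = (\<chi> i. y \<bullet> D2 e (axis i 1) x0) + transpose_D1 x0 Y"
      by (simp add: vec_eq_iff transpose_D1_def)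
    have P2: "transpose_D1 x0 y \<bullet> (\<chi> i. y \<bullet> D3 e e (axis i 1) x0 + 2 *\<^sub>R (Y \<bullet> D2 e (axis i 1) x0) + 0 \<bullet> D1 (axis i 1) x0)
      = y \<bullet> D3 e e (transpose_D1 x0 y) x0 + 2 * (Y \<bullet> D2 e (transpose_D1 x0 y) x0)"
    proof -
      have "(\<chi> i. y \<bullet> D3 e e (axis i 1) x0 + 2 *\<^sub>R (Y \<bullet> D2 e (axis i 1) x0) + 0 \<bullet> D1 (axis i 1) x0)
        = (\<chi> i. y \<bullet> D3 e e (axis i 1) x0) + 2 *\<^sub>R (\<chi> i. Y \<bullet> D2 e (axis i 1) x0)"
        by (simp add: vec_eq_iff)
      then show ?thesis
        by (simp add: inner_add_right inner_functional[OF D3_linear] inner_functional[OF D2_linear] inner_commute[of "transpose_D1 x0 y"])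
    qed
    show ?thesis
      by (rule jet2_cong[OF jet2_diff[OF jet2_inner[OF jet2_affine[of y Y] jet2_affine[of y Y]] jet2_inner[OF P P]]])
        (use C0 P2 in \<open>simp_all add: normal_sq_def transpose_D1_def[symmetric] P1 C1_def C2_def inner_commute\<close>)
  qed
  have Nj: "jet2 (\<lambda>t. (y + t *\<^sub>R Y) \<bullet> D2 (v + t *\<^sub>R V) (v + t *\<^sub>R V) (?x t)) (y \<bullet> D2 v v x0) N1 N2"
  proof -
    have tt: "jet2 (\<lambda>t. t * t) 0 0 (2::real)"
      using jet2_mult[OF jet2_ident jet2_ident] by simp
    have tj: "jet2 (\<lambda>t. 2 * t) 0 2 (0::real)"
      using jet2_mult[OF jet2_const[of 2] jet2_ident] by simp
    have Q: "jet2 (\<lambda>t. D2 v v (?x t) + (2 * t) *\<^sub>R D2 v V (?x t) + (t * t) *\<^sub>R D2 V V (?x t))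
       (D2 v v x0 + 0 *\<^sub>R D2 v V x0 + 0 *\<^sub>R D2 V V x0)
       (D3 e v v x0 + (0 *\<^sub>R D3 e v V x0 + 2 *\<^sub>R D2 v V x0) + (0 *\<^sub>R D3 e V V x0 + 0 *\<^sub>R D2 V V x0))
       (D4 e e v v x0 + (0 *\<^sub>R D4 e e v V x0 + 2 *\<^sub>R (2 *\<^sub>R D3 e v V x0) + 0 *\<^sub>R D2 v V x0)
        + (0 *\<^sub>R D4 e e V V x0 + 2 *\<^sub>R (0 *\<^sub>R D3 e V V x0) + 2 *\<^sub>R D2 V V x0))"
      by (intro jet2_add jet2_scaleR tt tj jet2_line sm)
    show ?thesis
      by (rule jet2_cong[OF jet2_inner[OF jet2_affine[of y Y] Q]])
        (simp_all add: D2_line N1_def N2_def)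
  qed
  have \<eta>j: "jet2 (\<lambda>t. 1 - k * (?x t \<bullet> ?x t)) (1 - k * (x0 \<bullet> x0)) (- (2 * k * (x0 \<bullet> e))) (- (2 * k * (e \<bullet> e)))"
    by (rule jet2_cong[OF jet2_diff[OF jet2_const[of 1] jet2_mult[OF jet2_const[of k] jet2_inner[OF jet2_affine[of x0 e] jet2_affine[of x0 e]]]]])
      (simp_all add: inner_commute algebra_simps)
  define \<psi> where "\<psi> t = (M / 2) * (graph_metric u (?x t) (v + t *\<^sub>R V) (v + t *\<^sub>R V) * (normal_sq (?x t) (y + t *\<^sub>R Y) + 1))
     - ((y + t *\<^sub>R Y) \<bullet> D2 (v + t *\<^sub>R V) (v + t *\<^sub>R V) (?x t)) * (1 - k * (?x t \<bullet> ?x t))" for t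
  have \<psi>j: "jet2 \<psi> 0
     (M * (A1 + C1 / 2) - (N1 * (1 - k * (x0 \<bullet> x0)) + (y \<bullet> D2 v v x0) * (- (2 * k * (x0 \<bullet> e)))))
     (M * (A2 + A1 * C1 + C2 / 2) - (N2 * (1 - k * (x0 \<bullet> x0)) + 2 * N1 * (- (2 * k * (x0 \<bullet> e))) + (y \<bullet> D2 v v x0) * (- (2 * k * (e \<bullet> e)))))"
    unfolding \<psi>_def
    by (rule jet2_cong[OF jet2_diff[OF jet2_mult[OF jet2_const[of "M/2"] jet2_mult[OF Aj jet2_add[OF Cj jet2_const[of 1]]]]
           jet2_mult[OF Nj \<eta>j]] refl])
      (use N0 in \<open>simp_all add: algebra_simps add_divide_distrib\<close>)
  define d where "d = (R - norm x0) / (norm e + 1)"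
  have ne: "norm e + 1 > 0" by (simp add: add_nonneg_pos)
  have d: "d > 0" using x0 ne by (simp add: d_def)
  have "\<psi> t \<ge> 0" if "\<bar>t\<bar> < d" for t
  proof -
    have "norm (?x t) \<le> norm x0 + \<bar>t\<bar> * norm e"
      by (metis norm_scaleR norm_triangle_ineq)
    also have "\<bar>t\<bar> * norm e \<le> \<bar>t\<bar> * (norm e + 1)" by (simp add: mult_left_mono)
    also have "\<bar>t\<bar> * (norm e + 1) < d * (norm e + 1)" using that ne by simp
    also have "d * (norm e + 1) = R - norm x0" using ne by (simp add: d_def)
    finally have "norm (?x t) < R" by simp
    from ineq[OF this, of "y + t *\<^sub>R Y" "v + t *\<^sub>R V"] show ?thesis by (simp add: \<psi>_def mult.assoc)
  qed
  from jet2_local_min[OF \<psi>j d this]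
  show "N1 * (1 - k * (x0 \<bullet> x0)) + (y \<bullet> D2 v v x0) * (- (2 * k * (x0 \<bullet> e))) = M * (A1 + C1 / 2)"
    and "N2 * (1 - k * (x0 \<bullet> x0)) + 2 * N1 * (- (2 * k * (x0 \<bullet> e))) + (y \<bullet> D2 v v x0) * (- (2 * k * (e \<bullet> e)))
       \<le> M * (A2 + A1 * C1 + C2 / 2)"
    by linarith+
qed

end

section \<open>The estimate at a maximum of the weighted curvature\<close>

text \<open>
  Index bookkeeping for the sum over the frame of the second derivatives of \<open>y \<bullet> D\<^sup>2u(v, v)\<close>. The hypothesis
  is the equation differentiated twice; it removes \<open>d\<close> (fourth derivatives) and cancels \<open>\<theta>\<close> and \<open>\<kappa>\<close> (third
  derivatives), leaving a quadratic form in second derivatives.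
\<close>

lemma third_order_terms_cancel:
  fixes \<tau> \<beta> \<theta> \<kappa> \<omega> :: "'i::finite \<Rightarrow> 'i \<Rightarrow> real"
  assumes \<beta>: "\<And>p q. \<beta> p q = \<beta> q p" and \<theta>: "\<And>p q. \<theta> p q = \<theta> q p"
    and eq: "(\<Sum>p\<in>UNIV. d p) + 2 * (\<Sum>p\<in>UNIV. \<Sum>q\<in>UNIV. (\<tau> p q + \<tau> q p) * \<theta> p q)
      + (\<Sum>p\<in>UNIV. \<Sum>q\<in>UNIV. (\<kappa> p q + \<kappa> q p + 2 * \<omega> p q
            + 2 * (\<Sum>r\<in>UNIV. (\<tau> p r + \<tau> r p) * (\<tau> r q + \<tau> q r))) * \<beta> p q) = c"
  shows "(\<Sum>p\<in>UNIV. d p + 4 * (\<Sum>q\<in>UNIV. \<tau> p q * \<theta> p q)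
        + 2 * (\<Sum>q\<in>UNIV. \<Sum>r\<in>UNIV. \<tau> p q * \<tau> p r * \<beta> q r)
        + 2 * (\<Sum>q\<in>UNIV. \<beta> p q * \<kappa> p q)
        + 4 * (\<Sum>q\<in>UNIV. \<Sum>r\<in>UNIV. \<beta> p q * \<tau> p r * \<tau> r q))
      = c - 2 * (\<Sum>p\<in>UNIV. \<Sum>q\<in>UNIV. (\<omega> p q + (\<Sum>r\<in>UNIV. \<tau> p r * \<tau> q r)) * \<beta> p q)"
proof -
  have sym: "(\<Sum>p\<in>UNIV. \<Sum>q\<in>UNIV. f q p * s p q) = (\<Sum>p\<in>UNIV. \<Sum>q\<in>UNIV. f p q * s p q)"
    if "\<And>p q. s p q = s q p" for f s :: "'i \<Rightarrow> 'i \<Rightarrow> real"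
  proof -
    have "(\<Sum>p\<in>UNIV. \<Sum>q\<in>UNIV. f q p * s p q) = (\<Sum>q\<in>UNIV. \<Sum>p\<in>UNIV. f q p * s p q)"
      by (rule sum.swap)
    also have "\<dots> = (\<Sum>q\<in>UNIV. \<Sum>p\<in>UNIV. f q p * s q p)"
      by (intro sum.cong refl arg_cong2[where f = times] that)
    finally show ?thesis .
  qed
  define T1 where "T1 = (\<Sum>p\<in>UNIV. \<Sum>q\<in>UNIV. (\<Sum>r\<in>UNIV. \<tau> p r * \<tau> r q) * \<beta> p q)"
  define T2 where "T2 = (\<Sum>p\<in>UNIV. \<Sum>q\<in>UNIV. (\<Sum>r\<in>UNIV. \<tau> p r * \<tau> q r) * \<beta> p q)"
  define T3 where "T3 = (\<Sum>p\<in>UNIV. \<Sum>q\<in>UNIV. (\<Sum>r\<in>UNIV. \<tau> r p * \<tau> r q) * \<beta> p q)"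
  have T4: "(\<Sum>p\<in>UNIV. \<Sum>q\<in>UNIV. (\<Sum>r\<in>UNIV. \<tau> r p * \<tau> q r) * \<beta> p q) = T1"
    unfolding T1_def using sym[of \<beta> "\<lambda>p q. \<Sum>r\<in>UNIV. \<tau> p r * \<tau> r q", OF \<beta>] by (simp add: mult.commute)
  have "(\<Sum>p\<in>UNIV. \<Sum>q\<in>UNIV. (\<kappa> p q + \<kappa> q p + 2 * \<omega> p q
            + 2 * (\<Sum>r\<in>UNIV. (\<tau> p r + \<tau> r p) * (\<tau> r q + \<tau> q r))) * \<beta> p q)
     = (\<Sum>p\<in>UNIV. \<Sum>q\<in>UNIV. \<kappa> p q * \<beta> p q) + (\<Sum>p\<in>UNIV. \<Sum>q\<in>UNIV. \<kappa> q p * \<beta> p q)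
      + 2 * (\<Sum>p\<in>UNIV. \<Sum>q\<in>UNIV. \<omega> p q * \<beta> p q) + 2 * (T1 + T2 + T3
      + (\<Sum>p\<in>UNIV. \<Sum>q\<in>UNIV. (\<Sum>r\<in>UNIV. \<tau> r p * \<tau> q r) * \<beta> p q))"
  proof -
    have S: "(\<Sum>r\<in>UNIV. (\<tau> p r + \<tau> r p) * (\<tau> r q + \<tau> q r)) =
       (\<Sum>r\<in>UNIV. \<tau> p r * \<tau> r q) + (\<Sum>r\<in>UNIV. \<tau> p r * \<tau> q r) + (\<Sum>r\<in>UNIV. \<tau> r p * \<tau> r q)
       + (\<Sum>r\<in>UNIV. \<tau> r p * \<tau> q r)" for p q
      unfolding sum.distrib[symmetric] by (intro sum.cong refl) (simp add: algebra_simps)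
    have "(\<kappa> p q + \<kappa> q p + 2 * \<omega> p q + 2 * (x1 + x2 + x3 + x4)) * \<beta> p q =
      \<kappa> p q * \<beta> p q + \<kappa> q p * \<beta> p q + 2 * (\<omega> p q * \<beta> p q)
        + 2 * (x1 * \<beta> p q + x2 * \<beta> p q + x3 * \<beta> p q + x4 * \<beta> p q)" for p q x1 x2 x3 x4
      by (simp add: algebra_simps)
    then show ?thesis
      unfolding T1_def T2_def T3_def S by (simp only: sum.distrib sum_distrib_left[symmetric])
  qed
  then have K: "(\<Sum>p\<in>UNIV. \<Sum>q\<in>UNIV. (\<kappa> p q + \<kappa> q p + 2 * \<omega> p q
            + 2 * (\<Sum>r\<in>UNIV. (\<tau> p r + \<tau> r p) * (\<tau> r q + \<tau> q r))) * \<beta> p q)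
     = 2 * (\<Sum>p\<in>UNIV. \<Sum>q\<in>UNIV. \<kappa> p q * \<beta> p q)
      + 2 * (\<Sum>p\<in>UNIV. \<Sum>q\<in>UNIV. \<omega> p q * \<beta> p q) + 2 * (2 * T1 + T2 + T3)"
  proof -
    have "l = 2 * x + 2 * w + 2 * (2 * t1 + t2 + t3)"
      if "l = x + x' + 2 * w + 2 * (t1 + t2 + t3 + t4)" "t4 = t1" "x' = x" for l x x' w t1 t2 t3 t4 :: real
      using that by simp
    from this[OF _ T4 sym[of \<beta> \<kappa>, OF \<beta>]] \<open>_ = _ + _ + _ + 2 * (T1 + _ + _ + _)\<close> show ?thesis by blast
  qed
  have "(\<Sum>p\<in>UNIV. \<Sum>q\<in>UNIV. (\<tau> p q + \<tau> q p) * \<theta> p q) = (\<Sum>p\<in>UNIV. \<Sum>q\<in>UNIV. \<tau> p q * \<theta> p q)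
      + (\<Sum>p\<in>UNIV. \<Sum>q\<in>UNIV. \<tau> q p * \<theta> p q)"
    by (simp add: distrib_right sum.distrib)
  then have L: "(\<Sum>p\<in>UNIV. \<Sum>q\<in>UNIV. (\<tau> p q + \<tau> q p) * \<theta> p q) = 2 * (\<Sum>p\<in>UNIV. \<Sum>q\<in>UNIV. \<tau> p q * \<theta> p q)"
    unfolding sym[of \<theta> \<tau>, OF \<theta>] by (simp only: mult_2)
  have T3': "(\<Sum>p\<in>UNIV. \<Sum>q\<in>UNIV. \<Sum>r\<in>UNIV. \<tau> p q * \<tau> p r * \<beta> q r) = T3"
  proof -
    have "(\<Sum>p\<in>UNIV. \<Sum>q\<in>UNIV. \<Sum>r\<in>UNIV. \<tau> p q * \<tau> p r * \<beta> q r)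
        = (\<Sum>q\<in>UNIV. \<Sum>p\<in>UNIV. \<Sum>r\<in>UNIV. \<tau> p q * \<tau> p r * \<beta> q r)" by (rule sum.swap)
    also have "\<dots> = (\<Sum>q\<in>UNIV. \<Sum>r\<in>UNIV. \<Sum>p\<in>UNIV. \<tau> p q * \<tau> p r * \<beta> q r)"
      by (rule sum.cong[OF refl]) (rule sum.swap)
    finally show ?thesis by (simp add: T3_def sum_distrib_right)
  qed
  have T1': "(\<Sum>p\<in>UNIV. \<Sum>q\<in>UNIV. \<Sum>r\<in>UNIV. \<beta> p q * \<tau> p r * \<tau> r q) = T1"
    unfolding T1_def sum_distrib_right by (intro sum.cong refl) simp
  have A: "(\<Sum>p\<in>UNIV. d p + 4 * (\<Sum>q\<in>UNIV. \<tau> p q * \<theta> p q)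
        + 2 * (\<Sum>q\<in>UNIV. \<Sum>r\<in>UNIV. \<tau> p q * \<tau> p r * \<beta> q r)
        + 2 * (\<Sum>q\<in>UNIV. \<beta> p q * \<kappa> p q)
        + 4 * (\<Sum>q\<in>UNIV. \<Sum>r\<in>UNIV. \<beta> p q * \<tau> p r * \<tau> r q))
    = (\<Sum>p\<in>UNIV. d p) + 4 * (\<Sum>p\<in>UNIV. \<Sum>q\<in>UNIV. \<tau> p q * \<theta> p q) + 2 * T3
      + 2 * (\<Sum>p\<in>UNIV. \<Sum>q\<in>UNIV. \<kappa> p q * \<beta> p q) + 4 * T1"
    unfolding T3'[symmetric] T1'[symmetric]
    by (simp only: sum.distrib sum_distrib_left[symmetric] mult.commute[of "\<beta> _ _" "\<kappa> _ _"])
  have B: "(\<Sum>p\<in>UNIV. \<Sum>q\<in>UNIV. (\<omega> p q + (\<Sum>r\<in>UNIV. \<tau> p r * \<tau> q r)) * \<beta> p q)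
     = (\<Sum>p\<in>UNIV. \<Sum>q\<in>UNIV. \<omega> p q * \<beta> p q) + T2"
    by (simp add: T2_def distrib_right sum.distrib)
  have "l = c - 2 * B"
    if "l = D + 4 * t + 2 * T3 + 2 * x + 4 * T1" "B = w + T2"
      "D + 2 * (2 * t) + (2 * x + 2 * w + 2 * (2 * T1 + T2 + T3)) = c" for l B D t x w
    using that by simp
  from this[OF A B eq[unfolded K L]] show ?thesis .
qed

text \<open>
  The trace of a product of a form bounded by \<open>m\<close> with a positive semidefinite form, the latter being given as a sum of squares of linear forms.
\<close>

lemma sum_quadratic_form_le:
  fixes \<beta> :: "'i::finite \<Rightarrow> 'i \<Rightarrow> real"
  assumes "\<And>c. (\<Sum>p\<in>UNIV. \<Sum>q\<in>UNIV. c p * c q * \<beta> p q) \<le> m * (\<Sum>p\<in>UNIV. (c p)\<^sup>2)"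
  shows "(\<Sum>p\<in>UNIV. \<Sum>q\<in>UNIV. (\<Sum>r\<in>K. f r p * f r q) * \<beta> p q) \<le> m * (\<Sum>p\<in>UNIV. \<Sum>r\<in>K. (f r p)\<^sup>2)"
proof -
  have "(\<Sum>p\<in>UNIV. \<Sum>q\<in>UNIV. (\<Sum>r\<in>K. f r p * f r q) * \<beta> p q)
     = (\<Sum>p\<in>UNIV. \<Sum>r\<in>K. \<Sum>q\<in>UNIV. f r p * f r q * \<beta> p q)"
  proof (rule sum.cong[OF refl])
    fix p
    have "(\<Sum>q\<in>UNIV. (\<Sum>r\<in>K. f r p * f r q) * \<beta> p q) = (\<Sum>q\<in>UNIV. \<Sum>r\<in>K. f r p * f r q * \<beta> p q)"
      by (simp add: sum_distrib_right)
    also have "\<dots> = (\<Sum>r\<in>K. \<Sum>q\<in>UNIV. f r p * f r q * \<beta> p q)" by (rule sum.swap)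
    finally show "(\<Sum>q\<in>UNIV. (\<Sum>r\<in>K. f r p * f r q) * \<beta> p q) = (\<Sum>r\<in>K. \<Sum>q\<in>UNIV. f r p * f r q * \<beta> p q)" .
  qed
  also have "\<dots> = (\<Sum>r\<in>K. \<Sum>p\<in>UNIV. \<Sum>q\<in>UNIV. f r p * f r q * \<beta> p q)" by (rule sum.swap)
  also have "\<dots> \<le> (\<Sum>r\<in>K. m * (\<Sum>p\<in>UNIV. (f r p)\<^sup>2))" by (rule sum_mono) (rule assms)
  also have "\<dots> = m * (\<Sum>p\<in>UNIV. \<Sum>r\<in>K. (f r p)\<^sup>2)"
    unfolding sum_distrib_left[symmetric] by (subst sum.swap) (rule refl)
  finally show ?thesis .
qed

lemma sum_symmetrize:
  fixes s X :: "'i::finite \<Rightarrow> 'i \<Rightarrow> real"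
  assumes "\<And>p q. X p q = X q p"
  shows "(\<Sum>p\<in>UNIV. \<Sum>q\<in>UNIV. (s p q + s q p) * X p q) = 2 * (\<Sum>p\<in>UNIV. \<Sum>q\<in>UNIV. s p q * X p q)"
proof -
  have "(\<Sum>p\<in>UNIV. \<Sum>q\<in>UNIV. s q p * X p q) = (\<Sum>q\<in>UNIV. \<Sum>p\<in>UNIV. s q p * X p q)"
    by (rule sum.swap)
  also have "\<dots> = (\<Sum>q\<in>UNIV. \<Sum>p\<in>UNIV. s q p * X q p)"
    by (intro sum.cong refl arg_cong2[where f = times] assms)
  finally show ?thesis by (simp add: distrib_right sum.distrib)
qed

context graph_translator begin

abbreviation g where "g \<equiv> graph_metric u"

lemma metric_commute: "g x v w = g x w v"
  by (simp add: graph_metric_def inner_commute)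

lemma metric_linear: "linear (\<lambda>w. g x v w)"
  using smooth_u by (intro linearI) (simp_all add: graph_metric_def dirderiv_add dirderiv_scaleR inner_add_right algebra_simps)

lemma frame_expansion:
  fixes E :: "'m \<Rightarrow> real^'m"
  assumes E: "\<And>p q. g x0 (E p) (E q) = (if p = q then 1 else 0)"
  shows "w = (\<Sum>q\<in>UNIV. g x0 (E q) w *\<^sub>R E q)"
proof -
  define M :: "real^'m^'m" where "M = (\<chi> i p. E p $ i)"
  define N :: "real^'m^'m" where "N = (\<chi> q i. g x0 (E q) (axis i 1))"
  have lin: "(\<Sum>i\<in>UNIV. g x0 v (axis i 1) * z $ i) = g x0 v z" for v z
    using linear_axis_expansion[OF metric_linear, of x0 v z] by (simp add: mult.commute)
  have "N ** M = mat 1"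
    by (simp add: N_def M_def matrix_matrix_mult_def mat_def vec_eq_iff lin E)
  then have "M ** N = mat 1" by (simp add: matrix_left_right_inverse)
  then have "M *v (N *v w) = w" by (simp add: matrix_vector_mul_assoc)
  moreover have "N *v w = (\<chi> q. g x0 (E q) w)"
    by (simp add: N_def matrix_vector_mult_def vec_eq_iff lin)
  moreover have "M *v (\<chi> q. g x0 (E q) w) = (\<Sum>q\<in>UNIV. g x0 (E q) w *\<^sub>R E q)"
    by (simp add: M_def matrix_vector_mult_def vec_eq_iff mult.commute)
  ultimately show ?thesis by simp
qed

lemma frame_linear:
  fixes E :: "'m \<Rightarrow> real^'m" and f :: "real^'m \<Rightarrow> 'b::real_vector"
  assumes E: "\<And>p q. g x0 (E p) (E q) = (if p = q then 1 else 0)" and f: "linear f"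
  shows "(\<Sum>q\<in>UNIV. g x0 (E q) w *\<^sub>R f (E q)) = f w"
proof -
  have "f w = f (\<Sum>q\<in>UNIV. g x0 (E q) w *\<^sub>R E q)"
    by (rule arg_cong[where f = f]) (rule frame_expansion[OF E])
  then show ?thesis by (simp add: linear_sum[OF f] linear_cmul[OF f])
qed

text \<open>
  The vector with coordinates \<open>f (E q)\<close> represents the functional \<open>f\<close> with respect to the induced metric.
\<close>

lemma frame_dual:
  fixes E :: "'m \<Rightarrow> real^'m" and f :: "real^'m \<Rightarrow> real"
  assumes E: "\<And>p q. g x0 (E p) (E q) = (if p = q then 1 else 0)" and f: "linear f"
  shows "g x0 (\<Sum>q\<in>UNIV. f (E q) *\<^sub>R E q) w = f w"
proof -
  have "g x0 (\<Sum>q\<in>UNIV. f (E q) *\<^sub>R E q) w = g x0 w (\<Sum>q\<in>UNIV. f (E q) *\<^sub>R E q)" by (rule metric_commute)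
  also have "\<dots> = (\<Sum>q\<in>UNIV. f (E q) * g x0 w (E q))"
    by (simp add: linear_sum[OF metric_linear] linear_cmul[OF metric_linear])
  also have "\<dots> = f w"
    using frame_linear[OF E f, of w] by (simp add: mult.commute metric_commute[of x0 w "E _"])
  finally show ?thesis .
qed

lemma frame_parseval:
  fixes E :: "'m \<Rightarrow> real^'m"
  assumes E: "\<And>p q. g x0 (E p) (E q) = (if p = q then 1 else 0)"
  shows "g x0 w w = (\<Sum>q\<in>UNIV. (g x0 (E q) w)\<^sup>2)"
proof -
  have "g x0 w w = (\<Sum>q\<in>UNIV. g x0 (E q) w *\<^sub>R g x0 w (E q))"
    by (rule frame_linear[OF E metric_linear, symmetric])
  also have "\<dots> = (\<Sum>q\<in>UNIV. (g x0 (E q) w)\<^sup>2)"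
    by (intro sum.cong refl) (simp add: power2_eq_square metric_commute[of x0 w "E _"])
  finally show ?thesis .
qed

text \<open>
  Differentiating the normal vector \<open>(transpose_D1 x y, y)\<close> in the direction \<open>e\<close>, while \<open>y\<close> moves with velocity
  \<open>D1 \<xi> x0\<close>, gives the tangent vector \<open>(\<xi>, D1 \<xi> x0)\<close>: the normal vector is moved in a parallel way.
\<close>

lemma transpose_D1_frame_sum:
  fixes E :: "'m \<Rightarrow> real^'m" and e :: "real^'m" and y :: "real^'n"
  assumes E: "\<And>p q. g x0 (E p) (E q) = (if p = q then 1 else 0)"
  defines "\<xi> \<equiv> \<Sum>q\<in>UNIV. (y \<bullet> D2 e (E q) x0) *\<^sub>R E q"
  shows "(\<chi> i. y \<bullet> D2 e (axis i 1) x0) + transpose_D1 x0 (D1 \<xi> x0) = \<xi>"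
proof -
  have f: "linear (\<lambda>w. y \<bullet> D2 e w x0)"
    by (rule linear_compose[OF D2_linear bounded_linear.linear[OF bounded_linear_inner_right], unfolded o_def])
  have "((\<chi> i. y \<bullet> D2 e (axis i 1) x0) + transpose_D1 x0 (D1 \<xi> x0)) \<bullet> w = \<xi> \<bullet> w" for w
    using frame_dual[OF E f, of w]
    by (simp add: inner_add_left inner_functional[OF D2_linear] transpose_D1_inner graph_metric_def \<xi>_def[symmetric])
  then show ?thesis using vector_eq_rdot by blast
qed

text \<open>
  Simons' inequality at a maximum point. Write \<open>\<mu>\<close> for the curvature at the point and \<open>h\<close> for the cutoff, so that
  \<open>M = \<mu> h\<close>. The summed second derivative tests bound \<open>T\<close>, the rough Laplacian of the curvature, above by
  derivatives of the cutoff, while the equation bounds it below by \<open>\<mu>\<^sup>3\<close> minus the derivative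
  in the drift direction \<open>a\<close>, which the first derivative test expresses through the cutoff as well.
\<close>

lemma max_point_estimate:
  fixes x0 v :: "real^'m" and y :: "real^'n" and M k R :: real and E :: "'m \<Rightarrow> real^'m"
  assumes ineq: "\<And>x v y. norm x < R \<Longrightarrow>
      (y \<bullet> D2 v v x) * (1 - k * (x \<bullet> x)) \<le> M * graph_metric u x v v * (normal_sq x y + 1) / 2"
    and x0: "norm x0 < R"
    and A0: "graph_metric u x0 v v = 1" and C0: "normal_sq x0 y = 1"
    and N0: "(y \<bullet> D2 v v x0) * (1 - k * (x0 \<bullet> x0)) = M"
    and M: "M > 0" and \<eta>: "1 - k * (x0 \<bullet> x0) > 0"
    and E: "\<And>p q. graph_metric u x0 (E p) (E q) = (if p = q then 1 else 0)"
  shows "M\<^sup>2 \<le> (\<Sum>p\<in>UNIV. 8 * k\<^sup>2 * (x0 \<bullet> E p)\<^sup>2 + 2 * k * (1 - k * (x0 \<bullet> x0)) * (E p \<bullet> E p))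
      + 2 * k * (1 - k * (x0 \<bullet> x0)) * (x0 \<bullet> a)"
proof -
  define h where "h = 1 - k * (x0 \<bullet> x0)"
  define \<mu> where "\<mu> = y \<bullet> D2 v v x0"
  have h: "h > 0" using \<eta> by (simp add: h_def)
  have M_eq: "M = \<mu> * h" using N0 by (simp add: \<mu>_def h_def)
  have \<mu>: "\<mu> > 0" using M h M_eq by (simp add: zero_less_mult_iff)
  note test = variation_along_line[OF ineq x0 A0 C0 N0]
  define z where "z = transpose_D1 x0 y"
  have zi: "z \<bullet> w = y \<bullet> D1 w x0" for w by (simp add: z_def transpose_D1_inner)
  have linD: "linear (\<lambda>w. c \<bullet> D2 e w x0)" for c e
    by (rule linear_compose[OF D2_linear bounded_linear.linear[OF bounded_linear_inner_right], unfolded o_def])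
  have linS: "linear (\<lambda>w. D1 w x0 \<bullet> c)" for c
    by (rule linear_compose[OF linear_dirderiv[OF smooth_u] bounded_linear.linear[OF bounded_linear_inner_left], unfolded o_def])
  \<comment> \<open>The velocity that keeps the tangent vector \<open>(v, D1 v x)\<close> parallel: with it, the derivative of this vector is normal to the graph.\<close>
  define V where "V e = (\<Sum>q\<in>UNIV. (D1 (E q) x0 \<bullet> D2 e v x0) *\<^sub>R E q)" for e
  \<comment> \<open>The velocity \<open>Y e\<close> keeps the normal vector parallel: its derivative is the tangent vector \<open>(\<xi> e, Y e)\<close>.\<close>
  define \<xi> where "\<xi> e = (\<Sum>q\<in>UNIV. (y \<bullet> D2 e (E q) x0) *\<^sub>R E q)" for e
  define Y where "Y e = D1 (\<xi> e) x0" for e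
  have gV: "g x0 (V e) w = D1 w x0 \<bullet> D2 e v x0" for e w
    unfolding V_def by (rule frame_dual[OF E linS])
  have g\<xi>: "g x0 (\<xi> e) w = y \<bullet> D2 e w x0" for e w
    unfolding \<xi>_def by (rule frame_dual[OF E linD])
  have adjY: "(\<chi> i. y \<bullet> D2 e (axis i 1) x0) + transpose_D1 x0 (Y e) = \<xi> e" for e
    unfolding Y_def \<xi>_def by (rule transpose_D1_frame_sum[OF E])
  have A1: "2 * (v \<bullet> V e - D1 v x0 \<bullet> (D2 e v x0 + D1 (V e) x0)) = 0" for e
    using gV[of e v] by (simp add: graph_metric_def inner_add_right inner_commute)
  have C1: "2 * (y \<bullet> Y e - z \<bullet> ((\<chi> i. y \<bullet> D2 e (axis i 1) x0) + transpose_D1 x0 (Y e))) = 0" for e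
    unfolding adjY by (simp add: Y_def zi)
  define A2 where "A2 e = - 2 * g x0 (V e) (V e) - 2 * (D2 e v x0 \<bullet> D2 e v x0)
      - 2 * (D1 v x0 \<bullet> D3 e e v x0) - 4 * (D1 v x0 \<bullet> D2 e (V e) x0)" for e
  have A2: "2 * (V e \<bullet> V e - (D2 e v x0 + D1 (V e) x0) \<bullet> (D2 e v x0 + D1 (V e) x0)
           - D1 v x0 \<bullet> (D3 e e v x0 + 2 *\<^sub>R D2 e (V e) x0)) = A2 e" for e
    using gV[of e "V e"]
    by (simp add: A2_def graph_metric_def inner_add_right inner_add_left inner_commute)
  define C2 where "C2 e = - 2 * g x0 (\<xi> e) (\<xi> e) - 2 * (y \<bullet> D3 e e z x0) - 4 * (Y e \<bullet> D2 e z x0)" for e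
  have C2: "2 * (Y e \<bullet> Y e - ((\<chi> i. y \<bullet> D2 e (axis i 1) x0) + transpose_D1 x0 (Y e)) \<bullet> ((\<chi> i. y \<bullet> D2 e (axis i 1) x0) + transpose_D1 x0 (Y e))
           - (y \<bullet> D3 e e z x0 + 2 * (Y e \<bullet> D2 e z x0))) = C2 e" for e
    unfolding adjY by (simp add: C2_def graph_metric_def Y_def)
  define N1 where "N1 e = y \<bullet> D3 e v v x0 + 2 * (y \<bullet> D2 v (V e) x0) + Y e \<bullet> D2 v v x0" for e
  define N2 where "N2 e = y \<bullet> D4 e e v v x0 + 4 * (y \<bullet> D3 e v (V e) x0) + 2 * (y \<bullet> D2 (V e) (V e) x0)
           + 2 * (Y e \<bullet> D3 e v v x0) + 4 * (Y e \<bullet> D2 v (V e) x0)" for e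
  have first: "N1 e * h = 2 * \<mu> * k * (x0 \<bullet> e)" for e
    using test(1)[of e "V e" "Y e"] unfolding z_def[symmetric] A1 C1
    by (simp add: N1_def h_def \<mu>_def inner_add_right)
  have second: "N2 e * h - 4 * N1 e * k * (x0 \<bullet> e) - 2 * \<mu> * k * (e \<bullet> e) \<le> M * (A2 e + C2 e / 2)" for e
    using test(2)[of e "V e" "Y e"] unfolding z_def[symmetric] A1 C1 A2 C2
    by (simp add: N2_def N1_def h_def \<mu>_def inner_add_right algebra_simps)
  \<comment> \<open>Since \<open>v\<close> and \<open>y\<close> are critical at fixed \<open>x0\<close>, \<open>v\<close> is an eigenvector of the second fundamental form in the direction of the normal, and the normal is parallel to the curvature vector of \<open>v\<close>.\<close>
  have critical_v: "y \<bullet> D2 v w x0 = \<mu> * g x0 v w" for w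
  proof -
    have D0: "D2 0 w' x0 = 0" "D3 0 w' w'' x0 = 0" for w' w''
      by (simp_all add: linear_0[OF linear_dirderiv] smooth_dirderiv smooth_u)
    have "2 * (y \<bullet> D2 v w x0) * h = 2 * \<mu> * h * g x0 v w"
      using test(1)[of 0 w 0]
      by (simp add: D0 h_def[symmetric] M_eq graph_metric_def inner_add_right transpose_D1_def zero_vec_def[symmetric] algebra_simps)
    then show ?thesis using h by simp
  qed
  have critical_y: "w \<bullet> D2 v v x0 = \<mu> * (y \<bullet> w - z \<bullet> transpose_D1 x0 w)" for w
  proof -
    have D0: "D2 0 w' x0 = 0" "D3 0 w' w'' x0 = 0" for w' w''
      by (simp_all add: linear_0[OF linear_dirderiv] smooth_dirderiv smooth_u)
    have D1: "D1 0 x0 = 0" by (simp add: linear_0[OF linear_dirderiv] smooth_u)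
    have D2: "D2 w' 0 x0 = 0" for w' using D0 D2_commute by metis
    have "(w \<bullet> D2 v v x0) * h = \<mu> * h * (y \<bullet> w - z \<bullet> transpose_D1 x0 w)"
      using test(1)[of 0 0 w]
      by (simp add: D0 D1 D2 h_def[symmetric] z_def[symmetric] M_eq zero_vec_def[symmetric] algebra_simps)
    then show ?thesis using h by simp
  qed
  have form_le: "y \<bullet> D2 w w x0 \<le> \<mu> * g x0 w w" for w
  proof -
    have "(y \<bullet> D2 w w x0) * h \<le> \<mu> * h * g x0 w w"
      using ineq[OF x0, of y w] C0 by (simp add: h_def M_eq)
    then have "(y \<bullet> D2 w w x0) * h \<le> (\<mu> * g x0 w w) * h" by (simp add: mult_ac)
    then show ?thesis using h by simp
  qed
  \<comment> \<open>Components in the frame of the second fundamental form in the chosen normal direction (\<open>\<beta>\<close>), of the velocities \<open>V\<close> (\<open>\<tau>\<close>), and of third derivatives.\<close>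
  define \<beta> where "\<beta> p q = y \<bullet> D2 (E p) (E q) x0" for p q
  define \<tau> where "\<tau> p q = D2 v (E p) x0 \<bullet> D1 (E q) x0" for p q
  define \<kappa> where "\<kappa> p q = D3 v v (E p) x0 \<bullet> D1 (E q) x0" for p q
  define \<omega> where "\<omega> p q = D2 v (E p) x0 \<bullet> D2 v (E q) x0" for p q
  define \<theta> where "\<theta> p q = y \<bullet> D3 v (E p) (E q) x0" for p q
  have VE: "V (E p) = (\<Sum>q\<in>UNIV. \<tau> p q *\<^sub>R E q)" for p
    by (simp add: V_def \<tau>_def inner_commute D2_commute[of "E p" v])
  have D3p: "D3 (E p) v w x0 = D3 v (E p) w x0" for p w
    by (rule fun_cong[OF dirderiv_commute[OF smooth_dirderiv[OF smooth_u]]])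
  have YE: "Y (E p) \<bullet> c = (\<Sum>q\<in>UNIV. \<beta> p q * (D1 (E q) x0 \<bullet> c))" for p c
    by (simp add: Y_def \<xi>_def \<beta>_def dirderiv_sum dirderiv_scaleR smooth_u inner_sum_left)
  have lin3: "linear (\<lambda>w. c \<bullet> D3 v' e w x0)" for c v' e
    by (rule linear_compose[OF D3_linear bounded_linear.linear[OF bounded_linear_inner_right], unfolded o_def])
  have D2V: "c \<bullet> D2 e (V (E p)) x0 = (\<Sum>q\<in>UNIV. \<tau> p q * (c \<bullet> D2 e (E q) x0))" for c e p
    unfolding VE by (simp add: linear_sum[OF linD] linear_cmul[OF linD])
  have n1: "D4 (E p) (E p) v v x0 = D4 v v (E p) (E p) x0" for p
  proof -
    note c = dirderiv_commute
    have 1: "dirderiv (E p) (dirderiv v (dirderiv v u)) = dirderiv v (dirderiv v (dirderiv (E p) u))"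
      using c[OF smooth_dirderiv[OF smooth_u], of "E p" v v] c[OF smooth_u, of "E p" v] by simp
    have 2: "dirderiv (E p) (dirderiv v (dirderiv v w)) = dirderiv v (dirderiv v (dirderiv (E p) w))"
      if "smooth w" for w :: "real^'m \<Rightarrow> real^'n"
      using c[OF smooth_dirderiv[OF that], of "E p" v v] c[OF that, of "E p" v] by simp
    show ?thesis unfolding 1 by (rule fun_cong[OF 2[OF smooth_dirderiv[OF smooth_u]]])
  qed
  have n2: "Y (E p) \<bullet> D3 (E p) v v x0 = (\<Sum>q\<in>UNIV. \<beta> p q * \<kappa> p q)" for p
    unfolding YE D3_commute[of v v "E p", symmetric] \<kappa>_def by (simp add: inner_commute)
  have n3: "y \<bullet> D3 (E p) v (V (E p)) x0 = (\<Sum>q\<in>UNIV. \<tau> p q * \<theta> p q)" for p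
    unfolding VE D3p by (simp add: linear_sum[OF lin3] linear_cmul[OF lin3] \<theta>_def)
  have n4: "Y (E p) \<bullet> D2 v (V (E p)) x0 = (\<Sum>q\<in>UNIV. \<Sum>r\<in>UNIV. \<beta> p q * \<tau> p r * \<tau> r q)" for p
  proof -
    have "Y (E p) \<bullet> D2 v (V (E p)) x0 = (\<Sum>q\<in>UNIV. \<beta> p q * (D1 (E q) x0 \<bullet> D2 v (V (E p)) x0))" by (rule YE)
    also have "\<dots> = (\<Sum>q\<in>UNIV. \<beta> p q * (\<Sum>r\<in>UNIV. \<tau> p r * \<tau> r q))"
      unfolding D2V \<tau>_def by (simp only: inner_commute)
    finally show ?thesis by (simp add: sum_distrib_left mult.assoc)
  qed
  have n5: "y \<bullet> D2 (V (E p)) (V (E p)) x0 = (\<Sum>q\<in>UNIV. \<Sum>r\<in>UNIV. \<tau> p q * \<tau> p r * \<beta> q r)" for p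
  proof -
    have "y \<bullet> D2 (V (E p)) (V (E p)) x0 = (\<Sum>q\<in>UNIV. \<tau> p q * (y \<bullet> D2 (V (E p)) (E q) x0))" by (rule D2V)
    also have "\<dots> = (\<Sum>q\<in>UNIV. \<tau> p q * (\<Sum>r\<in>UNIV. \<tau> p r * \<beta> q r))"
      unfolding D2_commute[of "V (E p)" "E _"] D2V \<beta>_def by (rule refl)
    finally show ?thesis by (simp add: sum_distrib_left mult.assoc)
  qed
  have \<beta>_sym: "\<beta> p q = \<beta> q p" and \<theta>_sym: "\<theta> p q = \<theta> q p" for p q
    unfolding \<beta>_def \<theta>_def dirderiv_commute[OF smooth_u, of "E p" "E q"] by (rule refl)+
  \<comment> \<open>The Gram matrix of the normal vectors \<open>B(v, E p)\<close>, with the sign that makes it positive.\<close>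
  define Q where "Q p q = \<omega> p q + (\<Sum>r\<in>UNIV. \<tau> p r * \<tau> q r)" for p q
  have sumN: "(\<Sum>p\<in>UNIV. N2 (E p)) = - (y \<bullet> D3 v v a x0) - 2 * (\<Sum>p\<in>UNIV. \<Sum>q\<in>UNIV. Q p q * \<beta> p q)"
    unfolding N2_def n1 n2 n3 n4 n5 Q_def
    by (rule third_order_terms_cancel[OF \<beta>_sym \<theta>_sym])
      (rule equation_jets(2)[OF E, where w = v and c = y, folded \<tau>_def \<kappa>_def \<omega>_def \<theta>_def \<beta>_def])
  have gVV: "g x0 (V (E p)) (V (E p)) = (\<Sum>r\<in>UNIV. \<tau> p r * \<tau> p r)" for p
  proof -
    have "g x0 (E q) (V (E p)) = \<tau> p q" for q
      unfolding metric_commute[of x0 "E q"] gV \<tau>_def D2_commute[of "E p" v] by (rule inner_commute)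
    then show ?thesis unfolding frame_parseval[OF E, of "V (E p)"] by (simp add: power2_eq_square)
  qed
  have sumA: "(\<Sum>p\<in>UNIV. A2 (E p)) = - 2 * (\<Sum>p\<in>UNIV. Q p p) + 2 * (D1 v x0 \<bullet> D2 v a x0)"
  proof -
    let ?X = "\<lambda>p q. D1 v x0 \<bullet> D2 (E p) (E q) x0"
    have eq: "(\<Sum>p\<in>UNIV. D1 v x0 \<bullet> D3 v (E p) (E p) x0) + 2 * (\<Sum>p\<in>UNIV. \<Sum>q\<in>UNIV. \<tau> p q * ?X p q)
        = - (D1 v x0 \<bullet> D2 v a x0)"
      using equation_jets(1)[OF E, where w = v and c = "D1 v x0", folded \<tau>_def]
      by (subst (asm) sum_symmetrize) (simp_all add: D2_commute[of "E _" "E _"])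
    have "A2 (E p) = - 2 * Q p p - 2 * (D1 v x0 \<bullet> D3 v (E p) (E p) x0) - 4 * (\<Sum>q\<in>UNIV. \<tau> p q * ?X p q)" for p
      unfolding A2_def gVV D2V D3_commute[of "E p" "E p" v] Q_def \<omega>_def D2_commute[of v "E p"]
      by simp
    then have "(\<Sum>p\<in>UNIV. A2 (E p)) = - 2 * (\<Sum>p\<in>UNIV. Q p p) - 2 * (\<Sum>p\<in>UNIV. D1 v x0 \<bullet> D3 v (E p) (E p) x0)
       - 4 * (\<Sum>p\<in>UNIV. \<Sum>q\<in>UNIV. \<tau> p q * ?X p q)"
      by (simp only: sum.distrib sum_subtractf sum_distrib_left[symmetric])
    then show ?thesis using eq by linarith
  qed
  have g\<xi>\<xi>: "g x0 (\<xi> (E p)) (\<xi> (E p)) = (\<Sum>q\<in>UNIV. (\<beta> p q)\<^sup>2)" for p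
  proof -
    have "g x0 (E q) (\<xi> (E p)) = \<beta> p q" for q
      unfolding metric_commute[of x0 "E q"] g\<xi> \<beta>_def by (rule refl)
    then show ?thesis unfolding frame_parseval[OF E, of "\<xi> (E p)"] by simp
  qed
  have sumC: "(\<Sum>p\<in>UNIV. C2 (E p)) = - 2 * (\<Sum>p\<in>UNIV. \<Sum>q\<in>UNIV. (\<beta> p q)\<^sup>2) + 2 * (y \<bullet> D2 z a x0)"
  proof -
    let ?s = "\<lambda>p q. D2 z (E p) x0 \<bullet> D1 (E q) x0"
    have eq: "(\<Sum>p\<in>UNIV. y \<bullet> D3 z (E p) (E p) x0) + 2 * (\<Sum>p\<in>UNIV. \<Sum>q\<in>UNIV. ?s p q * \<beta> p q)
        = - (y \<bullet> D2 z a x0)"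
      using equation_jets(1)[OF E, where w = z and c = y, folded \<beta>_def]
      by (subst (asm) sum_symmetrize) (rule \<beta>_sym)
    have "C2 (E p) = - 2 * (\<Sum>q\<in>UNIV. (\<beta> p q)\<^sup>2) - 2 * (y \<bullet> D3 z (E p) (E p) x0) - 4 * (\<Sum>q\<in>UNIV. ?s p q * \<beta> p q)" for p
      unfolding C2_def g\<xi>\<xi> YE D3_commute[of "E p" "E p" z] D2_commute[of z "E p"]
      by (simp add: inner_commute mult.commute)
    then have "(\<Sum>p\<in>UNIV. C2 (E p)) = - 2 * (\<Sum>p\<in>UNIV. \<Sum>q\<in>UNIV. (\<beta> p q)\<^sup>2)
       - 2 * (\<Sum>p\<in>UNIV. y \<bullet> D3 z (E p) (E p) x0) - 4 * (\<Sum>p\<in>UNIV. \<Sum>q\<in>UNIV. ?s p q * \<beta> p q)"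
      by (simp only: sum.distrib sum_subtractf sum_distrib_left[symmetric])
    then show ?thesis using eq by linarith
  qed
  \<comment> \<open>In the drift direction the right hand sides of the differentiated equation add up to exactly a first derivative.\<close>
  have N1a: "N1 a = y \<bullet> D3 v v a x0 + 2 * \<mu> * (D1 v x0 \<bullet> D2 v a x0) + \<mu> * (y \<bullet> D2 z a x0)"
  proof -
    have "y \<bullet> D2 v (V a) x0 = \<mu> * (D1 v x0 \<bullet> D2 v a x0)"
      unfolding critical_v metric_commute[of x0 v "V a"] gV D2_commute[of a v] by (rule refl)
    moreover have "Y a \<bullet> D2 v v x0 = \<mu> * (y \<bullet> D2 z a x0)"
    proof -
      have "y \<bullet> Y a - z \<bullet> transpose_D1 x0 (Y a) = g x0 (\<xi> a) z"
      proof -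
        have "y \<bullet> Y a = \<xi> a \<bullet> z" unfolding Y_def zi[symmetric] by (rule inner_commute)
        moreover have "z \<bullet> transpose_D1 x0 (Y a) = D1 (\<xi> a) x0 \<bullet> D1 z x0"
          unfolding Y_def inner_commute[of z] by (rule transpose_D1_inner)
        ultimately show ?thesis by (simp add: graph_metric_def)
      qed
      then show ?thesis unfolding critical_y by (simp add: g\<xi> D2_commute[of a z])
    qed
    ultimately show ?thesis unfolding N1_def D3_commute[of v v a, symmetric] by simp
  qed
  \<comment> \<open>The form \<open>\<beta>\<close> is bounded by \<open>\<mu>\<close> because the maximum is taken over all \<open>v\<close>.\<close>
  have Q_le: "(\<Sum>p\<in>UNIV. \<Sum>q\<in>UNIV. Q p q * \<beta> p q) \<le> \<mu> * (\<Sum>p\<in>UNIV. Q p p)"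
  proof -
    have form: "(\<Sum>p\<in>UNIV. \<Sum>q\<in>UNIV. c p * c q * \<beta> p q) \<le> \<mu> * (\<Sum>p\<in>UNIV. (c p)\<^sup>2)" for c
    proof -
      let ?w = "\<Sum>p\<in>UNIV. c p *\<^sub>R E p"
      have 1: "b \<bullet> D2 e ?w x0 = (\<Sum>q\<in>UNIV. c q * (b \<bullet> D2 e (E q) x0))" for b e
        by (simp add: linear_sum[OF linD] linear_cmul[OF linD])
      have "y \<bullet> D2 ?w ?w x0 = (\<Sum>q\<in>UNIV. c q * (y \<bullet> D2 (E q) ?w x0))"
        unfolding 1[of y ?w] D2_commute[of ?w "E _"] by (rule refl)
      also have "\<dots> = (\<Sum>p\<in>UNIV. \<Sum>q\<in>UNIV. c p * c q * \<beta> p q)"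
        unfolding 1 by (simp add: sum_distrib_left \<beta>_def mult.assoc)
      finally have 2: "y \<bullet> D2 ?w ?w x0 = (\<Sum>p\<in>UNIV. \<Sum>q\<in>UNIV. c p * c q * \<beta> p q)" .
      have "g x0 (E q) ?w = c q" for q
        by (simp add: linear_sum[OF metric_linear] linear_cmul[OF metric_linear] E if_distrib cong: if_cong)
      then have "g x0 ?w ?w = (\<Sum>p\<in>UNIV. (c p)\<^sup>2)" by (simp add: frame_parseval[OF E])
      with form_le[of ?w] 2 show ?thesis by simp
    qed
    have "(\<Sum>p\<in>UNIV. \<Sum>q\<in>UNIV. (\<Sum>r\<in>UNIV. \<tau> p r * \<tau> q r) * \<beta> p q) \<le> \<mu> * (\<Sum>p\<in>UNIV. \<Sum>r\<in>UNIV. (\<tau> p r)\<^sup>2)"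
      by (rule sum_quadratic_form_le[OF form, of "\<lambda>r p. \<tau> p r"])
    moreover have "(\<Sum>p\<in>UNIV. \<Sum>q\<in>UNIV. \<omega> p q * \<beta> p q) \<le> \<mu> * (\<Sum>p\<in>UNIV. \<omega> p p)"
      using sum_quadratic_form_le[OF form, of "\<lambda>r p. D2 v (E p) x0 $ r" UNIV]
      by (simp add: \<omega>_def inner_vec_def power2_eq_square)
    ultimately show ?thesis
      by (simp add: Q_def distrib_right distrib_left sum.distrib power2_eq_square)
  qed
  \<comment> \<open>The unit eigenvector \<open>v\<close> alone contributes \<open>\<mu>\<^sup>2\<close>; this is where the cubic growth comes from.\<close>
  have \<beta>_ge: "\<mu>\<^sup>2 \<le> (\<Sum>p\<in>UNIV. \<Sum>q\<in>UNIV. (\<beta> p q)\<^sup>2)"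
  proof -
    let ?c = "\<lambda>q. g x0 (E q) v"
    have c1: "(\<Sum>q\<in>UNIV. (?c q)\<^sup>2) = 1" using frame_parseval[OF E, of v] A0 by simp
    have "(\<mu> * ?c p)\<^sup>2 \<le> (\<Sum>q\<in>UNIV. (\<beta> p q)\<^sup>2)" for p
    proof -
      have "\<mu> * ?c p = y \<bullet> D2 (E p) v x0"
        using critical_v[of "E p"] by (simp add: metric_commute[of x0 v] D2_commute[of v])
      also have "\<dots> = (\<Sum>q\<in>UNIV. ?c q * \<beta> p q)"
        using frame_linear[OF E linD, of v y "E p"] by (simp add: \<beta>_def)
      finally have "(\<mu> * ?c p)\<^sup>2 \<le> (\<Sum>q\<in>UNIV. (?c q)\<^sup>2) * (\<Sum>q\<in>UNIV. (\<beta> p q)\<^sup>2)"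
        using Cauchy_Schwarz_ineq_sum[of ?c "\<beta> p" UNIV] by simp
      then show ?thesis by (simp add: c1)
    qed
    then have "(\<Sum>p\<in>UNIV. (\<mu> * ?c p)\<^sup>2) \<le> (\<Sum>p\<in>UNIV. \<Sum>q\<in>UNIV. (\<beta> p q)\<^sup>2)" by (rule sum_mono)
    moreover have "(\<Sum>p\<in>UNIV. (\<mu> * ?c p)\<^sup>2) = \<mu>\<^sup>2"
      by (simp add: power_mult_distrib sum_distrib_left[symmetric] c1)
    ultimately show ?thesis by simp
  qed
  define S where "S = (\<Sum>p\<in>UNIV. 8 * k\<^sup>2 * (x0 \<bullet> E p)\<^sup>2 + 2 * k * h * (E p \<bullet> E p))"
  define T where "T = (\<Sum>p\<in>UNIV. N2 (E p) - \<mu> * (A2 (E p) + C2 (E p) / 2))"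
  have T_ge: "\<mu> * \<mu>\<^sup>2 - N1 a \<le> T"
  proof -
    have "T = (\<Sum>p\<in>UNIV. N2 (E p)) - \<mu> * ((\<Sum>p\<in>UNIV. A2 (E p)) + (\<Sum>p\<in>UNIV. C2 (E p)) / 2)"
      unfolding T_def by (simp only: sum_subtractf sum.distrib sum_distrib_left[symmetric] sum_divide_distrib[symmetric])
    also have "\<dots> = - N1 a + 2 * (\<mu> * (\<Sum>p\<in>UNIV. Q p p) - (\<Sum>p\<in>UNIV. \<Sum>q\<in>UNIV. Q p q * \<beta> p q))
        + \<mu> * (\<Sum>p\<in>UNIV. \<Sum>q\<in>UNIV. (\<beta> p q)\<^sup>2)"
      unfolding sumN sumA sumC N1a by (simp add: field_simps)
    finally have T: "T = \<dots>" .
    have "m - n \<le> t" if "t = - n + 2 * (q - r) + b" "r \<le> q" "m \<le> b" for m n t q r b :: real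
      using that by simp
    from this[OF T Q_le mult_left_mono[OF \<beta>_ge less_imp_le[OF \<mu>]]] show ?thesis .
  qed
  have T_le: "h\<^sup>2 * T \<le> \<mu> * S"
  proof -
    have "h\<^sup>2 * (N2 (E p) - \<mu> * (A2 (E p) + C2 (E p) / 2))
        \<le> \<mu> * (8 * k\<^sup>2 * (x0 \<bullet> E p)\<^sup>2 + 2 * k * h * (E p \<bullet> E p))" for p
    proof -
      have "N2 (E p) * h - \<mu> * h * (A2 (E p) + C2 (E p) / 2) \<le> 4 * N1 (E p) * k * (x0 \<bullet> E p) + 2 * \<mu> * k * (E p \<bullet> E p)"
        using second[of "E p"] unfolding M_eq by linarith
      then have "h * (N2 (E p) * h - \<mu> * h * (A2 (E p) + C2 (E p) / 2))
          \<le> h * (4 * N1 (E p) * k * (x0 \<bullet> E p) + 2 * \<mu> * k * (E p \<bullet> E p))"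
        using h by (intro mult_left_mono) auto
      also have "\<dots> = 4 * (N1 (E p) * h) * k * (x0 \<bullet> E p) + 2 * \<mu> * k * h * (E p \<bullet> E p)"
        by (simp add: algebra_simps)
      also have "\<dots> = \<mu> * (8 * k\<^sup>2 * (x0 \<bullet> E p)\<^sup>2 + 2 * k * h * (E p \<bullet> E p))"
        unfolding first by (simp add: algebra_simps power2_eq_square)
      finally show ?thesis by (simp add: algebra_simps power2_eq_square)
    qed
    then show ?thesis unfolding T_def S_def sum_distrib_left by (rule sum_mono)
  qed
  have "\<mu> * M\<^sup>2 = h\<^sup>2 * (\<mu> * \<mu>\<^sup>2 - N1 a) + h * (N1 a * h)"
    by (simp add: M_eq power2_eq_square algebra_simps)
  also have "\<dots> \<le> \<mu> * S + h * (2 * \<mu> * k * (x0 \<bullet> a))"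
    unfolding first using T_le mult_left_mono[OF T_ge, of "h\<^sup>2"] by simp
  also have "\<dots> = \<mu> * (S + 2 * k * h * (x0 \<bullet> a))" by (simp add: algebra_simps)
  finally have "M\<^sup>2 \<le> S + 2 * k * h * (x0 \<bullet> a)" using \<mu> by simp
  then show ?thesis by (simp add: S_def h_def)
qed

end

section \<open>A Liouville theorem for uniformly spacelike translators\<close>

locale uniform_graph_translator = graph_translator u G a b
  for u :: "real^'m \<Rightarrow> real^'n" and G a b +
  fixes K :: real
  assumes K_pos: "0 < K" and K: "\<And>x v. v \<bullet> v \<le> K * graph_metric u x v v"
begin

lemma metric_pos:
  assumes "v \<noteq> 0"
  shows "0 < g x v v"
proof -
  have "0 < v \<bullet> v" using assms by simp
  then have "0 < K * g x v v" using K[of v x] by linarith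
  then show ?thesis using K_pos by (simp add: zero_less_mult_iff)
qed

lemma metric_nonneg: "0 \<le> g x v v"
  using metric_pos[of v x] K[of v x] K_pos by (cases "v = 0") (auto simp: zero_le_mult_iff)

lemma metric_scale: "g x (c *\<^sub>R v) (c *\<^sub>R v) = c\<^sup>2 * g x v v"
  by (simp add: graph_metric_def dirderiv_scaleR smooth_u power2_eq_square algebra_simps)

lemma normal_sq_scale: "normal_sq x (c *\<^sub>R y) = c\<^sup>2 * normal_sq x y"
proof -
  have "transpose_D1 x (c *\<^sub>R y) = c *\<^sub>R transpose_D1 x y" by (simp add: transpose_D1_def vec_eq_iff)
  then show ?thesis by (simp add: normal_sq_def power2_eq_square algebra_simps)
qed

lemma D2_scale: "D2 (c *\<^sub>R v) (c *\<^sub>R v) x = c\<^sup>2 *\<^sub>R D2 v v x"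
  by (simp add: D2_scale1 D2_scale2 power2_eq_square)

text \<open>
  The transpose of a strict contraction is a strict contraction.
\<close>

lemma normal_sq_pos:
  assumes "y \<noteq> 0"
  shows "0 < normal_sq x y"
proof (cases "transpose_D1 x y = 0")
  case True
  then show ?thesis using assms by (simp add: normal_sq_def)
next
  case False
  let ?w = "transpose_D1 x y"
  have "norm (D1 ?w x) < norm ?w"
    using metric_pos[OF False, of x] by (simp add: graph_metric_def norm_lt)
  then have "norm y * norm (D1 ?w x) < norm y * norm ?w" using assms by simp
  moreover have "norm ?w * norm ?w \<le> norm y * norm (D1 ?w x)"
    using norm_cauchy_schwarz[of y "D1 ?w x"] by (simp add: transpose_D1_inner[symmetric] norm_eq_sqrt_inner)
  ultimately have "norm ?w < norm y"
    using norm_ge_zero[of ?w] by (smt (verit) False mult_right_less_imp_less mult_le_cancel_right_pos norm_le_zero_iff)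
  then show ?thesis by (simp add: normal_sq_def norm_lt)
qed

lemma exists_frame:
  obtains E :: "'m \<Rightarrow> real^'m" where "\<And>p q. g x (E p) (E q) = (if p = q then 1 else 0)"
proof -
  let ?f = "\<lambda>(i::'m) (t::real). axis i (1::real)"
  have lin: "linear (\<lambda>v. g x v w)" for w
    using metric_linear[of x w] by (simp add: metric_commute[of x w])
  have B: "bounded_bilinear (g x)"
    using metric_linear lin unfolding bilinear_conv_bounded_bilinear[symmetric] bilinear_def by blast
  have pos: "g x (\<Sum>i\<in>UNIV. c i *\<^sub>R ?f i t) (\<Sum>i\<in>UNIV. c i *\<^sub>R ?f i t) > 0" if "t \<in> {0}" "\<exists>i\<in>UNIV. c i \<noteq> 0" for t :: real and c
  proof (rule metric_pos)
    have "(\<Sum>i\<in>UNIV. c i *\<^sub>R ?f i t) = (\<chi> i. c i)"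
      by (simp add: vec_eq_iff axis_def if_distrib cong: if_cong)
    then show "(\<Sum>i\<in>UNIV. c i *\<^sub>R ?f i t) \<noteq> 0" using that by (auto simp: vec_eq_iff)
  qed
  have "\<exists>e :: 'm \<Rightarrow> real \<Rightarrow> real^'m. (\<forall>i\<in>UNIV. e i C1_differentiable_on {0}) \<and>
      (\<forall>t\<in>{0}. (\<forall>i\<in>UNIV. \<forall>j\<in>UNIV. g x (e i t) (e j t) = (if i = j then 1 else 0)) \<and>
         span (range (\<lambda>i. e i t)) = span (range (\<lambda>i. ?f i t)))"
    by (rule gram_schmidt_curves[where I = UNIV and f = ?f, OF B metric_commute finite])
      (rule C1_differentiable_on_const, rule pos)
  then obtain e :: "'m \<Rightarrow> real \<Rightarrow> real^'m" where "\<forall>i\<in>UNIV. \<forall>j\<in>UNIV. g x (e i 0) (e j 0) = (if i = j then 1 else 0)"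
    by auto
  then show ?thesis using that[of "\<lambda>i. e i 0"] by simp
qed

lemma continuous_D1: "continuous_on UNIV (\<lambda>(x, v). D1 v x)"
proof -
  have eq: "(\<lambda>(x, v). D1 v x) = (\<lambda>p. \<Sum>i\<in>UNIV. snd p $ i *\<^sub>R D1 (axis i 1) (fst p))"
    by (rule ext) (simp add: case_prod_beta linear_axis_expansion[OF linear_dirderiv[OF smooth_u], symmetric])
  show ?thesis unfolding eq
    by (intro continuous_intros continuous_on_compose2[OF smooth_continuous[OF smooth_dirderiv[OF smooth_u]]]) auto
qed

lemma continuous_D2: "continuous_on UNIV (\<lambda>(x, v). D2 v v x)"
proof -
  have eq: "(\<lambda>(x, v). D2 v v x) = (\<lambda>p. \<Sum>i\<in>UNIV. \<Sum>j\<in>UNIV.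
      (snd p $ i * snd p $ j) *\<^sub>R D2 (axis i 1) (axis j 1) (fst p))"
    by (rule ext, clarify, simp, rule dirderiv2_expand[OF smooth_u])
  show ?thesis unfolding eq
    by (intro continuous_intros continuous_on_compose2[OF smooth_continuous[OF smooth_dirderiv[OF smooth_dirderiv[OF smooth_u]]]]) auto
qed

lemma continuous_transpose_D1: "continuous_on UNIV (\<lambda>(x, y). transpose_D1 x y)"
proof -
  have eq: "(\<lambda>(x, y). transpose_D1 x y) = (\<lambda>p. \<chi> i. snd p \<bullet> D1 (axis i 1) (fst p))"
    by (auto simp: transpose_D1_def)
  show ?thesis unfolding eq
    by (intro continuous_on_vec_lambda continuous_intros
        continuous_on_compose2[OF smooth_continuous[OF smooth_dirderiv[OF smooth_u]]]) auto
qed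

text \<open>
  The maximum over the compact set of \<open>(x, v, y)\<close> with \<open>\<bar>x\<bar> \<le> R\<close> and unit \<open>v\<close> and \<open>y\<close> exists; by homogeneity the
  resulting inequality holds for all \<open>v\<close> and \<open>y\<close>. Rescaled so that the geometric lengths are \<open>1\<close>, the maximiser
  satisfies the hypotheses of \<open>max_point_estimate\<close>. It lies in the open ball because the cutoff vanishes on the sphere.
\<close>

lemma curvature_bound_on_ball:
  assumes R: "R > 0"
  shows "\<exists>M\<ge>0. M\<^sup>2 \<le> CARD('m) * (10 * K / R\<^sup>2) + 2 * norm a / R \<and>
    (\<forall>x v y. norm x < R \<longrightarrow> (y \<bullet> D2 v v x) * (1 - (x \<bullet> x) / R\<^sup>2) \<le> M * g x v v * sqrt (normal_sq x y))"
proof -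
  define \<eta> where "\<eta> x = 1 - (x \<bullet> x) / R\<^sup>2" for x :: "real^'m"
  define \<Phi> where "\<Phi> p = (case p of (x, v, y) \<Rightarrow> (y \<bullet> D2 v v x) * \<eta> x / (g x v v * sqrt (normal_sq x y)))" for p
  define S where "S = cball (0::real^'m) R \<times> sphere (0::real^'m) 1 \<times> sphere (0::real^'n) 1"
  have pos: "g x v v * sqrt (normal_sq x y) > 0" if "norm v = 1" "norm y = 1" for x v y
  proof -
    have "v \<noteq> 0" "y \<noteq> 0" using that by auto
    then show ?thesis by (simp add: metric_pos normal_sq_pos)
  qed
  have "compact S" unfolding S_def by (intro compact_Times compact_cball compact_sphere)
  moreover have "S \<noteq> {}"
  proof -
    have "(0, axis undefined 1, axis undefined 1) \<in> S" using R by (simp add: S_def norm_axis_1)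
    then show ?thesis by blast
  qed
  moreover have "continuous_on S \<Phi>"
  proof -
    note c1 = continuous_on_compose2[OF continuous_D1, of S "\<lambda>p. (fst p, fst (snd p))", simplified]
    note c2 = continuous_on_compose2[OF continuous_D2, of S "\<lambda>p. (fst p, fst (snd p))", simplified]
    note c3 = continuous_on_compose2[OF continuous_transpose_D1, of S "\<lambda>p. (fst p, snd (snd p))", simplified]
    have eq: "\<Phi> = (\<lambda>p. (snd (snd p) \<bullet> D2 (fst (snd p)) (fst (snd p)) (fst p)) * (1 - (fst p \<bullet> fst p) / R\<^sup>2)
       / ((fst (snd p) \<bullet> fst (snd p) - D1 (fst (snd p)) (fst p) \<bullet> D1 (fst (snd p)) (fst p))
          * sqrt (snd (snd p) \<bullet> snd (snd p) - transpose_D1 (fst p) (snd (snd p)) \<bullet> transpose_D1 (fst p) (snd (snd p)))))"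
      by (auto simp: \<Phi>_def \<eta>_def graph_metric_def normal_sq_def)
    have nz: "\<forall>p\<in>S. (fst (snd p) \<bullet> fst (snd p) - D1 (fst (snd p)) (fst p) \<bullet> D1 (fst (snd p)) (fst p))
          * sqrt (snd (snd p) \<bullet> snd (snd p) - transpose_D1 (fst p) (snd (snd p)) \<bullet> transpose_D1 (fst p) (snd (snd p))) \<noteq> 0"
    proof
      fix p assume "p \<in> S"
      then have "norm (fst (snd p)) = 1" "norm (snd (snd p)) = 1" by (auto simp: S_def)
      from pos[OF this, of "fst p"] show "(fst (snd p) \<bullet> fst (snd p) - D1 (fst (snd p)) (fst p) \<bullet> D1 (fst (snd p)) (fst p))
          * sqrt (snd (snd p) \<bullet> snd (snd p) - transpose_D1 (fst p) (snd (snd p)) \<bullet> transpose_D1 (fst p) (snd (snd p))) \<noteq> 0"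
        unfolding graph_metric_def normal_sq_def by (rule less_imp_neq[symmetric])
    qed
    show ?thesis unfolding eq
      using R by (intro continuous_on_divide nz continuous_intros c1 c2 c3) auto
  qed
  ultimately obtain p0 where p0: "p0 \<in> S" "\<And>p. p \<in> S \<Longrightarrow> \<Phi> p \<le> \<Phi> p0"
    using continuous_attains_sup by metis
  obtain x0 v0 y0 where p0_eq: "p0 = (x0, v0, y0)" by (cases p0) auto
  have x0: "norm x0 \<le> R" and v0: "norm v0 = 1" and y0: "norm y0 = 1"
    using p0(1) by (auto simp: S_def p0_eq)
  define m where "m = \<Phi> p0"
  define M where "M = max m 0"
  have unit: "(y \<bullet> D2 v v x) * \<eta> x \<le> M * (g x v v * sqrt (normal_sq x y))"
    if "norm x \<le> R" "norm v = 1" "norm y = 1" for x v y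
  proof -
    have "\<Phi> (x, v, y) \<le> M" using p0(2)[of "(x, v, y)"] that by (simp add: S_def M_def m_def)
    then show ?thesis using pos[OF that(2,3), of x] by (simp add: \<Phi>_def pos_divide_le_eq)
  qed
  have all: "(y \<bullet> D2 v v x) * \<eta> x \<le> M * g x v v * sqrt (normal_sq x y)" if x: "norm x \<le> R" for x v y
  proof (cases "v = 0 \<or> y = 0")
    case True
    have "D2 0 0 x = 0" using D2_scale[of 0 0 x] by simp
    with True have 1: "(y \<bullet> D2 v v x) * \<eta> x = 0" by auto
    have 2: "M * g x v v * sqrt (normal_sq x y) = 0"
      using True metric_scale[of x 0 v] normal_sq_scale[of x 0 y] by auto
    show ?thesis unfolding 1 2 by (rule order_refl)
  next
    case False
    define v' where "v' = (1 / norm v) *\<^sub>R v"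
    define y' where "y' = (1 / norm y) *\<^sub>R y"
    have v: "v = norm v *\<^sub>R v'" and y: "y = norm y *\<^sub>R y'" using False by (simp_all add: v'_def y'_def)
    have n: "norm v' = 1" "norm y' = 1" using False by (simp_all add: v'_def y'_def)
    have "(y \<bullet> D2 v v x) * \<eta> x = ((norm v)\<^sup>2 * norm y) * ((y' \<bullet> D2 v' v' x) * \<eta> x)"
      by (subst v, subst v, subst y) (simp add: D2_scale)
    also have "\<dots> \<le> ((norm v)\<^sup>2 * norm y) * (M * (g x v' v' * sqrt (normal_sq x y')))"
      by (intro mult_left_mono unit x n) auto
    also have "\<dots> = M * g x v v * sqrt (normal_sq x y)"
    proof -
      have "g x v v = (norm v)\<^sup>2 * g x v' v'" by (subst v, subst v) (simp add: metric_scale)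
      moreover have "sqrt (normal_sq x y) = norm y * sqrt (normal_sq x y')"
        by (subst y) (simp add: normal_sq_scale real_sqrt_mult)
      ultimately show ?thesis by simp
    qed
    finally show ?thesis .
  qed
  have "M\<^sup>2 \<le> CARD('m) * (10 * K / R\<^sup>2) + 2 * norm a / R"
  proof (cases "m > 0")
    case False
    then show ?thesis using R K_pos by (simp add: M_def)
  next
    case True
    then have Mm: "M = m" by (simp add: M_def)
    define A where "A = g x0 v0 v0"
    define C where "C = normal_sq x0 y0"
    have A: "A > 0" and C: "C > 0"
    proof -
      have "v0 \<noteq> 0" "y0 \<noteq> 0" using v0 y0 by auto
      then show "A > 0" "C > 0" by (simp_all add: A_def C_def metric_pos normal_sq_pos)
    qed
    define v where "v = (1 / sqrt A) *\<^sub>R v0"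
    define y where "y = (1 / sqrt C) *\<^sub>R y0"
    have A1: "g x0 v v = 1" using A by (simp add: v_def metric_scale A_def[symmetric] power_divide)
    have C1: "normal_sq x0 y = 1" using C by (simp add: y_def normal_sq_scale C_def[symmetric] power_divide)
    define k where "k = 1 / R\<^sup>2"
    have \<eta>k: "\<eta> x = 1 - k * (x \<bullet> x)" for x by (simp add: \<eta>_def k_def)
    have N0: "(y \<bullet> D2 v v x0) * (1 - k * (x0 \<bullet> x0)) = M"
    proof -
      have "m = (y0 \<bullet> D2 v0 v0 x0) * \<eta> x0 / (A * sqrt C)"
        by (simp add: m_def p0_eq \<Phi>_def A_def C_def)
      moreover have "y \<bullet> D2 v v x0 = (y0 \<bullet> D2 v0 v0 x0) / (A * sqrt C)"
        using A by (simp add: v_def y_def D2_scale power_divide)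
      ultimately show ?thesis by (simp add: Mm \<eta>k[symmetric])
    qed
    have \<eta>0: "\<eta> x0 \<noteq> 0" using N0 True by (auto simp: Mm \<eta>k)
    have xR: "norm x0 < R"
    proof (rule ccontr)
      assume "\<not> norm x0 < R"
      then have "norm x0 = R" using x0 by simp
      then have "\<eta> x0 = 0" using R by (simp add: \<eta>_def dot_square_norm)
      with \<eta>0 show False by simp
    qed
    have \<eta>pos: "1 - k * (x0 \<bullet> x0) > 0" and \<eta>le: "1 - k * (x0 \<bullet> x0) \<le> 1"
    proof -
      have "(norm x0)\<^sup>2 < R\<^sup>2" using xR by (intro power_strict_mono) auto
      then show "1 - k * (x0 \<bullet> x0) > 0" using R by (simp add: k_def dot_square_norm)
      show "1 - k * (x0 \<bullet> x0) \<le> 1" by (simp add: k_def)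
    qed
    have ineq: "(y \<bullet> D2 v v x) * (1 - k * (x \<bullet> x)) \<le> M * g x v v * (normal_sq x y + 1) / 2"
      if "norm x < R" for x v y
    proof -
      have C: "0 \<le> normal_sq x y"
        using normal_sq_pos[of y x] normal_sq_scale[of x 0 y] by (cases "y = 0") (auto simp: less_imp_le)
      have "0 \<le> (sqrt (normal_sq x y) - 1)\<^sup>2" by simp
      then have s: "sqrt (normal_sq x y) \<le> (normal_sq x y + 1) / 2"
        using C by (simp add: power2_diff)
      have "(y \<bullet> D2 v v x) * (1 - k * (x \<bullet> x)) \<le> M * g x v v * sqrt (normal_sq x y)"
        using all[of x y v] that by (simp add: \<eta>k)
      also have "\<dots> \<le> M * g x v v * ((normal_sq x y + 1) / 2)"
        by (intro mult_left_mono s mult_nonneg_nonneg metric_nonneg) (simp add: M_def)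
      finally show ?thesis by simp
    qed
    obtain E :: "'m \<Rightarrow> real^'m" where E: "\<And>p q. g x0 (E p) (E q) = (if p = q then 1 else 0)"
      using exists_frame by blast
    have Ep: "E p \<bullet> E p \<le> K" for p using K[of "E p" x0] by (simp add: E)
    have k: "k > 0" using R by (simp add: k_def)
    have k2: "k\<^sup>2 * R\<^sup>2 = k" using R by (simp add: k_def power2_eq_square)
    have "M > 0" using True by (simp add: Mm)
    from max_point_estimate[OF ineq xR A1 C1 N0 this \<eta>pos E]
    have "M\<^sup>2 \<le> (\<Sum>p\<in>UNIV. 8 * k\<^sup>2 * (x0 \<bullet> E p)\<^sup>2 + 2 * k * (1 - k * (x0 \<bullet> x0)) * (E p \<bullet> E p))
      + 2 * k * (1 - k * (x0 \<bullet> x0)) * (x0 \<bullet> a)" .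
    also have "\<dots> \<le> (\<Sum>p\<in>(UNIV::'m set). 10 * k * K) + 2 * k * R * norm a"
    proof (intro add_mono sum_mono)
      fix p
      have "(x0 \<bullet> E p)\<^sup>2 \<le> (x0 \<bullet> x0) * (E p \<bullet> E p)" by (rule Cauchy_Schwarz_ineq)
      also have "\<dots> \<le> R\<^sup>2 * K"
        using x0 Ep[of p] R by (intro mult_mono) (auto simp: dot_square_norm intro!: power_mono)
      finally have "8 * k\<^sup>2 * (x0 \<bullet> E p)\<^sup>2 \<le> 8 * k\<^sup>2 * (R\<^sup>2 * K)" by (intro mult_left_mono) auto
      also have "\<dots> = 8 * (k\<^sup>2 * R\<^sup>2) * K" by simp
      finally have 1: "8 * k\<^sup>2 * (x0 \<bullet> E p)\<^sup>2 \<le> 8 * k * K" by (simp only: k2)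
      have "2 * k * (1 - k * (x0 \<bullet> x0)) * (E p \<bullet> E p) \<le> 2 * k * 1 * K"
        using k \<eta>pos \<eta>le Ep[of p] by (intro mult_mono) auto
      with 1 show "8 * k\<^sup>2 * (x0 \<bullet> E p)\<^sup>2 + 2 * k * (1 - k * (x0 \<bullet> x0)) * (E p \<bullet> E p) \<le> 10 * k * K"
        by simp
    next
      have "2 * k * (1 - k * (x0 \<bullet> x0)) * (x0 \<bullet> a) \<le> 2 * k * (1 - k * (x0 \<bullet> x0)) * (norm x0 * norm a)"
        using k \<eta>pos by (intro mult_left_mono norm_cauchy_schwarz) auto
      also have "\<dots> \<le> 2 * k * 1 * (R * norm a)"
        using k \<eta>pos \<eta>le x0 R by (intro mult_mono) auto
      finally show "2 * k * (1 - k * (x0 \<bullet> x0)) * (x0 \<bullet> a) \<le> 2 * k * R * norm a" by simp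
    qed
    also have "\<dots> = CARD('m) * (10 * K / R\<^sup>2) + 2 * norm a / R"
      using R by (simp add: k_def power2_eq_square)
    finally show ?thesis .
  qed
  moreover have "M \<ge> 0" by (simp add: M_def)
  ultimately show ?thesis using all unfolding \<eta>_def by (intro exI[of _ M]) auto
qed

text \<open>
  With \<open>R\<close> tending to infinity the bound on the ball becomes \<open>y \<bullet> D\<^sup>2u(v, v) \<le> 0\<close> for every \<open>y\<close>, hence also for \<open>- y\<close>.
\<close>

lemma second_derivative_zero: "D2 v w x = 0"
proof -
  have nonpos: "y \<bullet> D2 v v x \<le> 0" for v y
  proof -
    let ?c = "g x v v * sqrt (normal_sq x y)"
    let ?B = "\<lambda>R::real. CARD('m) * (10 * K / R\<^sup>2) + 2 * norm a / R"
    have "0 \<le> normal_sq x y"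
      using normal_sq_pos[of y x] normal_sq_scale[of x 0 y] by (cases "y = 0") (auto simp: less_imp_le)
    then have c: "0 \<le> ?c" using metric_nonneg by simp
    have le: "(y \<bullet> D2 v v x) * (1 - (x \<bullet> x) / R\<^sup>2) \<le> sqrt (?B R) * ?c" if "R > norm x" for R
    proof -
      have R: "R > 0" using that norm_ge_zero[of x] by linarith
      obtain M where M: "0 \<le> M" "M\<^sup>2 \<le> ?B R"
        and all: "\<forall>x v y. norm x < R \<longrightarrow>
          (y \<bullet> D2 v v x) * (1 - (x \<bullet> x) / R\<^sup>2) \<le> M * g x v v * sqrt (normal_sq x y)"
        using curvature_bound_on_ball[OF R] by (elim exE conjE)
      have "M \<le> sqrt (?B R)" using M(1,2) by (simp add: real_le_rsqrt)
      then have "M * ?c \<le> sqrt (?B R) * ?c" using c by (rule mult_right_mono)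
      with all[rule_format, OF that, of y v] show ?thesis by (simp add: mult.assoc)
    qed
    have inv: "((\<lambda>R::real. 1 / R) \<longlongrightarrow> 0) at_top"
      by (intro tendsto_divide_0[OF tendsto_const] filterlim_at_top_imp_at_infinity filterlim_ident)
    have inv2: "((\<lambda>R::real. 1 / R\<^sup>2) \<longlongrightarrow> 0) at_top"
      using tendsto_mult[OF inv inv] by (simp add: power2_eq_square)
    have "((\<lambda>R. CARD('m) * (10 * K) * (1 / R\<^sup>2) + 2 * norm a * (1 / R)) \<longlongrightarrow> CARD('m) * (10 * K) * 0 + 2 * norm a * 0) at_top"
      by (intro tendsto_intros inv inv2)
    then have "((\<lambda>R. sqrt (?B R) * ?c) \<longlongrightarrow> sqrt 0 * ?c) at_top"
      by (intro tendsto_mult tendsto_const tendsto_real_sqrt) simp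
    moreover have "((\<lambda>R. (y \<bullet> D2 v v x) * (1 - (x \<bullet> x) * (1 / R\<^sup>2))) \<longlongrightarrow> (y \<bullet> D2 v v x) * (1 - (x \<bullet> x) * 0)) at_top"
      by (intro tendsto_intros inv2)
    moreover have "eventually (\<lambda>R. (y \<bullet> D2 v v x) * (1 - (x \<bullet> x) * (1 / R\<^sup>2)) \<le> sqrt (?B R) * ?c) at_top"
      using eventually_gt_at_top[of "norm x"] by eventually_elim (use le in simp)
    ultimately have "(y \<bullet> D2 v v x) * (1 - (x \<bullet> x) * 0) \<le> sqrt 0 * ?c"
      by (intro tendsto_le[OF trivial_limit_at_top_linorder])
    then show ?thesis by simp
  qed
  have diag: "D2 v v x = 0" for v
  proof -
    have "D2 v v x \<bullet> D2 v v x = 0" by (rule antisym[OF nonpos inner_ge_zero])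
    then show ?thesis by simp
  qed
  have "D2 (v + 1 *\<^sub>R w) (v + 1 *\<^sub>R w) x = D2 v v x + (2 * 1) *\<^sub>R D2 v w x + (1 * 1) *\<^sub>R D2 w w x"
    by (rule D2_line)
  then show ?thesis by (simp add: diag)
qed

lemma graph_function_affine: "u x = u 0 + D1 x 0"
proof -
  have const: "D1 v x = D1 v 0" for v x
  proof -
    have "(dirderiv v u has_derivative (\<lambda>w. 0)) (at x)" for x
      using smooth_has_derivative[OF smooth_dirderiv[OF smooth_u], of v x] by (simp add: second_derivative_zero)
    then obtain c where "\<And>x. D1 v x = c"
      using has_derivative_zero_constant[OF convex_UNIV, of "dirderiv v u"] by auto
    then show ?thesis by simp
  qed
  have "((\<lambda>x. u x - D1 x 0) has_derivative (\<lambda>v. D1 v x - D1 v 0)) (at x)" for x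
    by (intro has_derivative_diff smooth_has_derivative smooth_u linear_imp_has_derivative linear_dirderiv)
  note deriv = this
  have deriv0: "((\<lambda>x. u x - D1 x 0) has_derivative (\<lambda>v. 0)) (at x)" for x
  proof -
    have "(\<lambda>v. D1 v x - D1 v 0) = (\<lambda>v. 0)" using const by auto
    with deriv[of x] show ?thesis by simp
  qed
  from deriv0 obtain c where c: "\<And>x. u x - D1 x 0 = c"
    using has_derivative_zero_constant[OF convex_UNIV, of "\<lambda>x. u x - D1 x 0"] by auto
  have "D1 0 0 = 0" by (simp add: linear_0[OF linear_dirderiv] smooth_u)
  then show ?thesis using c[of x] c[of 0] by (simp add: algebra_simps)
qed

end

section \<open>Bounded Gauss image implies uniformly spacelike\<close>

lemma bounded_bilinear_pseudo_inner: "bounded_bilinear pseudo_inner"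
  unfolding bilinear_conv_bounded_bilinear[symmetric] bilinear_def
  by (intro conjI allI linearI)
    (simp_all add: pseudo_inner_def inner_add_left inner_add_right algebra_simps)

interpretation pseudo_inner: bounded_bilinear pseudo_inner
  by (rule bounded_bilinear_pseudo_inner)

lemma pseudo_inner_commute: "pseudo_inner v w = pseudo_inner w v"
  by (simp add: pseudo_inner_def inner_commute)

text \<open>
  For a pseudo-orthonormal frame of the tangent plane at \<open>x\<close> this is the trace of the inverse of the induced metric, so it depends only on the plane. It controls how close the plane is to the light cone.
\<close>

definition horizontal_energy :: "((real^'m) \<times> (real^'n)) ^ 'm \<Rightarrow> real" where
  "horizontal_energy e = (\<Sum>i\<in>UNIV. fst (e $ i) \<bullet> fst (e $ i))"

lemma frame_span_sum:
  assumes "X \<in> frame_span e"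
  obtains c where "X = (\<Sum>i\<in>UNIV. c i *\<^sub>R e $ i)"
  using assms span_image_sum[of UNIV X "($) e"] unfolding frame_span_def by auto

lemma pseudo_inner_sum:
  assumes "pseudo_orthonormal e"
  shows "pseudo_inner (\<Sum>i\<in>UNIV. c i *\<^sub>R e $ i) (\<Sum>i\<in>UNIV. c i *\<^sub>R e $ i) = (\<Sum>i\<in>UNIV. (c i)\<^sup>2)"
proof -
  have "pseudo_inner (\<Sum>i\<in>UNIV. c i *\<^sub>R e $ i) (\<Sum>j\<in>UNIV. c j *\<^sub>R e $ j)
     = (\<Sum>i\<in>UNIV. c i * (\<Sum>j\<in>UNIV. c j * (if j = i then 1 else 0)))"
    using assms unfolding pseudo_orthonormal_def
    by (simp add: pseudo_inner.sum_left pseudo_inner.sum_right pseudo_inner.scaleR_left pseudo_inner.scaleR_right)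
  also have "\<dots> = (\<Sum>i\<in>UNIV. c i * (\<Sum>j\<in>UNIV. if j = i then c j else 0))"
    by (intro sum.cong refl arg_cong2[where f = times]) auto
  finally show ?thesis by (simp add: power2_eq_square)
qed

lemma horizontal_energy_pos:
  assumes "pseudo_orthonormal e"
  shows "horizontal_energy e > 0"
proof -
  have "fst (e $ i) \<bullet> fst (e $ i) = 1 + snd (e $ i) \<bullet> snd (e $ i)" for i
    using assms unfolding pseudo_orthonormal_def pseudo_inner_def by (metis diff_add_cancel)
  then have "fst (e $ i) \<bullet> fst (e $ i) > 0" for i
    by (simp add: add_pos_nonneg)
  then show ?thesis unfolding horizontal_energy_def by (intro sum_pos) auto
qed

lemma norm_sum_scaleR_le:
  fixes V :: "'i \<Rightarrow> 'a::real_inner"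
  shows "(\<Sum>i\<in>I. c i *\<^sub>R V i) \<bullet> (\<Sum>i\<in>I. c i *\<^sub>R V i) \<le> (\<Sum>i\<in>I. V i \<bullet> V i) * (\<Sum>i\<in>I. (c i)\<^sup>2)"
proof -
  have "norm (\<Sum>i\<in>I. c i *\<^sub>R V i) \<le> (\<Sum>i\<in>I. \<bar>c i\<bar> * norm (V i))"
    by (rule order_trans[OF norm_sum]) simp
  then have "(norm (\<Sum>i\<in>I. c i *\<^sub>R V i))\<^sup>2 \<le> (\<Sum>i\<in>I. \<bar>c i\<bar> * norm (V i))\<^sup>2"
    by (intro power_mono) auto
  also have "\<dots> \<le> (\<Sum>i\<in>I. \<bar>c i\<bar>\<^sup>2) * (\<Sum>i\<in>I. (norm (V i))\<^sup>2)"
    by (rule Cauchy_Schwarz_ineq_sum)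
  finally show ?thesis by (simp add: dot_square_norm mult.commute)
qed

lemma frame_span_horizontal_le:
  assumes e: "pseudo_orthonormal e" and X: "X \<in> frame_span e"
  shows "fst X \<bullet> fst X \<le> horizontal_energy e * pseudo_inner X X"
proof -
  obtain c where c: "X = (\<Sum>i\<in>UNIV. c i *\<^sub>R e $ i)" using frame_span_sum[OF X] .
  have "fst X = (\<Sum>i\<in>UNIV. c i *\<^sub>R fst (e $ i))" by (simp add: c fst_sum)
  then show ?thesis
    using norm_sum_scaleR_le[of c "\<lambda>i. fst (e $ i)" UNIV] pseudo_inner_sum[OF e, of c]
    by (simp add: c horizontal_energy_def)
qed

lemma spacelike_frame_span:
  assumes e: "pseudo_orthonormal e"
  shows "spacelike_subspace (frame_span e)"
  unfolding spacelike_subspace_def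
proof (intro conjI ballI impI)
  show "subspace (frame_span e)" by (simp add: frame_span_def)
  fix X assume "X \<in> frame_span e" "X \<noteq> 0"
  then obtain c where c: "X = (\<Sum>i\<in>UNIV. c i *\<^sub>R e $ i)" using frame_span_sum by blast
  with \<open>X \<noteq> 0\<close> obtain i where "c i \<noteq> 0" by force
  then have "(\<Sum>i\<in>UNIV. (c i)\<^sup>2) > 0" by (intro sum_pos2[of _ i]) auto
  then show "pseudo_inner X X > 0" by (simp add: c pseudo_inner_sum[OF e])
qed

lemma normal_part_frame:
  assumes e: "pseudo_orthonormal e"
  shows "normal_part (frame_span e) w = w - (\<Sum>j\<in>UNIV. pseudo_inner w (e $ j) *\<^sub>R e $ j)"
proof (rule normal_part_eqI[OF spacelike_frame_span[OF e]])
  let ?t = "\<Sum>j\<in>UNIV. pseudo_inner w (e $ j) *\<^sub>R e $ j"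
  have orth: "pseudo_inner (w - ?t) (e $ i) = 0" for i
  proof -
    have "pseudo_inner ?t (e $ i) = (\<Sum>j\<in>UNIV. pseudo_inner w (e $ j) * (if j = i then 1 else 0))"
      using e unfolding pseudo_orthonormal_def by (simp add: pseudo_inner.sum_left pseudo_inner.scaleR_left)
    also have "\<dots> = pseudo_inner w (e $ i)" by (simp add: if_distrib cong: if_cong)
    finally show ?thesis by (simp add: pseudo_inner.diff_left)
  qed
  show "w - ?t \<in> pseudo_orthogonal (frame_span e)"
    unfolding pseudo_orthogonal_def
  proof clarify
    fix a b assume "(a, b) \<in> frame_span e"
    then obtain c where c: "(a, b) = (\<Sum>i\<in>UNIV. c i *\<^sub>R e $ i)" using frame_span_sum by blast
    show "pseudo_inner (w - ?t) (a, b) = 0"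
      unfolding c by (simp add: pseudo_inner.sum_right pseudo_inner.scaleR_right orth)
  qed
  show "w - (w - ?t) \<in> frame_span e"
    unfolding frame_span_def by (simp, intro span_sum span_scale span_base) auto
qed

text \<open>
  A vector of the plane with vanishing horizontal part has pseudo-inner square at most \<open>0\<close>, hence is zero; so the projection of the plane to the horizontal factor is injective, and surjective by dimension.
\<close>

lemma horizontal_parts_span:
  assumes e: "pseudo_orthonormal (e :: ((real^'m) \<times> (real^'n)) ^ 'm)"
  obtains X where "X \<in> frame_span e" "fst X = p"
proof -
  define A :: "real^'m^'m" where "A = (\<chi> k i. fst (e $ i) $ k)"
  have A: "A *v c = fst (\<Sum>i\<in>UNIV. c $ i *\<^sub>R e $ i)" for c
    by (simp add: A_def matrix_vector_mult_def vec_eq_iff fst_sum mult.commute)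
  have "c = 0" if "A *v c = 0" for c
  proof -
    let ?X = "\<Sum>i\<in>UNIV. c $ i *\<^sub>R e $ i"
    have "pseudo_inner ?X ?X \<le> 0" using that by (simp add: pseudo_inner_def A)
    then have "(\<Sum>i\<in>UNIV. (c $ i)\<^sup>2) \<le> 0" by (simp add: pseudo_inner_sum[OF e])
    then have "c \<bullet> c \<le> 0" by (simp add: inner_vec_def power2_eq_square)
    then show ?thesis by (metis inner_gt_zero_iff linorder_not_le)
  qed
  then obtain B where "B ** A = mat 1" using matrix_left_invertible_ker[of A] by blast
  then have "A ** B = mat 1" by (simp add: matrix_left_right_inverse)
  then have "A *v (B *v p) = p" by (simp add: matrix_vector_mul_assoc)
  then have "fst (\<Sum>i\<in>UNIV. (B *v p) $ i *\<^sub>R e $ i) = p" by (simp add: A)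
  moreover have "(\<Sum>i\<in>UNIV. (B *v p) $ i *\<^sub>R e $ i) \<in> frame_span e"
    unfolding frame_span_def by (intro span_sum span_scale span_base) auto
  ultimately show ?thesis using that by blast
qed

text \<open>
  Let \<open>X\<close> be the vector of the plane with the same horizontal part as \<open>\<nu>\<close>. Orthogonality to \<open>X\<close> forces the vertical part of \<open>\<nu>\<close> to be at least as long as its horizontal part divided by the slope of \<open>X\<close>, and the slope of \<open>X\<close> is bounded away from \<open>1\<close> by the horizontal energy.
\<close>

lemma normal_horizontal_le:
  assumes e: "pseudo_orthonormal (e :: ((real^'m) \<times> (real^'n)) ^ 'm)"
    and \<nu>: "\<nu> \<in> pseudo_orthogonal (frame_span e)"
  shows "fst \<nu> \<bullet> fst \<nu> \<le> horizontal_energy e * - pseudo_inner \<nu> \<nu>"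
proof (cases "fst \<nu> = 0")
  case True
  then show ?thesis using horizontal_energy_pos[OF e] by (simp add: pseudo_inner_def)
next
  case False
  let ?Q = "horizontal_energy e"
  have Q: "?Q > 0" by (rule horizontal_energy_pos[OF e])
  obtain X where X: "X \<in> frame_span e" "fst X = fst \<nu>" using horizontal_parts_span[OF e] .
  define p where "p = fst \<nu> \<bullet> fst \<nu>"
  define q where "q = snd X \<bullet> snd X"
  define y where "y = snd \<nu> \<bullet> snd \<nu>"
  have p: "p > 0" using False by (simp add: p_def)
  have "pseudo_inner \<nu> X = 0" using \<nu> X(1) by (auto simp: pseudo_orthogonal_def)
  then have "p = snd \<nu> \<bullet> snd X" by (simp add: pseudo_inner_def X(2) p_def)
  then have pp: "p * p \<le> y * q"
    using Cauchy_Schwarz_ineq[of "snd \<nu>" "snd X"] by (simp add: y_def q_def power2_eq_square)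
  have "p \<le> ?Q * (p - q)"
    using frame_span_horizontal_le[OF e X(1)] by (simp add: X(2) p_def q_def pseudo_inner_def)
  then have Qq: "?Q * q \<le> ?Q * p - p" by (simp add: algebra_simps)
  have y: "y \<ge> 0" by (simp add: y_def)
  have "p * (?Q * p) \<le> y * (?Q * q)" using mult_left_mono[OF pp, of ?Q] Q by (simp add: mult_ac)
  also have "\<dots> \<le> y * (?Q * p - p)" using Qq y by (rule mult_left_mono)
  also have "\<dots> = p * (y * ?Q - y)" by (simp add: algebra_simps)
  finally have 1: "?Q * p \<le> y * ?Q - y" using p by simp
  have "p \<le> y"
  proof (rule ccontr)
    assume "\<not> p \<le> y"
    then have "?Q * p > ?Q * y" using Q by simp
    with 1 y show False by (simp add: mult.commute)
  qed
  then have "p \<le> ?Q * (y - p)" using 1 by (simp add: algebra_simps)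
  then show ?thesis by (simp add: p_def y_def pseudo_inner_def)
qed

lemma pseudo_orthonormal_derivative_antisymmetric:
  fixes e :: "real \<Rightarrow> ((real^'m) \<times> (real^'n)) ^ 'm"
  assumes e: "\<And>t. t \<in> {0..1} \<Longrightarrow> pseudo_orthonormal (e t)" and t: "t \<in> {0<..<1}"
    and D: "(e has_vector_derivative D) (at t)"
  shows "pseudo_inner (D $ i) (e t $ j) = - pseudo_inner (D $ j) (e t $ i)"
proof -
  have Di: "((\<lambda>s. e s $ i) has_vector_derivative D $ i) (at t)" for i
    by (rule bounded_linear.has_vector_derivative[OF bounded_linear_vec_nth D])
  have "((\<lambda>s. pseudo_inner (e s $ i) (e s $ j)) has_vector_derivative
      pseudo_inner (e t $ i) (D $ j) + pseudo_inner (D $ i) (e t $ j)) (at t)"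
    by (rule pseudo_inner.has_vector_derivative[OF Di Di])
  moreover have "((\<lambda>s. pseudo_inner (e s $ i) (e s $ j)) has_vector_derivative 0) (at t)"
  proof (rule has_vector_derivative_transform_within_open[OF has_vector_derivative_const])
    show "open {0<..<1::real}" "t \<in> {0<..<1}" using t by auto
    show "(if i = j then 1 else 0) = pseudo_inner (e s $ i) (e s $ j)" if "s \<in> {0<..<1}" for s
      using e[of s] that by (simp add: pseudo_orthonormal_def)
  qed
  ultimately have "pseudo_inner (e t $ i) (D $ j) + pseudo_inner (D $ i) (e t $ j) = 0"
    by (rule vector_derivative_unique_at)
  then show ?thesis by (simp add: pseudo_inner_commute[of "e t $ i"])
qed

text \<open>
  The tangential part of the derivative of the frame is an infinitesimal rotation, which does not change the energy. The normal part changes it at a rate of at most twice the energy times the speed, so the logarithm of the energy grows by at most twice the length.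
\<close>

lemma horizontal_energy_growth:
  fixes e :: "real \<Rightarrow> ((real^'m) \<times> (real^'n)) ^ 'm"
  assumes C1: "e C1_differentiable_on {0..1}" and orth: "\<And>t. t \<in> {0..1} \<Longrightarrow> pseudo_orthonormal (e t)"
  shows "horizontal_energy (e 1) \<le> horizontal_energy (e 0) * exp (2 * grassmann_length e)"
proof -
  define D where "D t = vector_derivative e (at t)" for t
  have D: "(e has_vector_derivative D t) (at t)" if "t \<in> {0..1}" for t
    using C1 that unfolding C1_differentiable_on_eq D_def by (simp add: vector_derivative_works)
  have Dc: "continuous_on {0..1} D"
    using C1 unfolding C1_differentiable_on_eq D_def[abs_def] by simp
  have ec: "continuous_on {0..1} e"
    using has_vector_derivative_continuous[OF D] by (intro continuous_at_imp_continuous_on ballI)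
  have Di: "((\<lambda>s. e s $ i) has_vector_derivative D t $ i) (at t)" if "t \<in> {0..1}" for i t
    by (rule bounded_linear.has_vector_derivative[OF bounded_linear_vec_nth D[OF that]])
  define \<nu> where "\<nu> t i = D t $ i - (\<Sum>j\<in>UNIV. pseudo_inner (D t $ i) (e t $ j) *\<^sub>R e t $ j)" for t i
  define \<sigma> where "\<sigma> t = sqrt (\<Sum>i\<in>UNIV. - pseudo_inner (\<nu> t i) (\<nu> t i))" for t
  have np: "normal_part (frame_span (e t)) (D t $ i) = \<nu> t i" if "t \<in> {0..1}" for t i
    unfolding \<nu>_def by (rule normal_part_frame[OF orth[OF that]])
  have speed: "grassmann_speed e t = \<sigma> t" if "t \<in> {0..1}" for t
    unfolding grassmann_speed_def \<sigma>_def D_def[symmetric] by (simp add: np[OF that] Let_def)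
  have \<nu>c: "continuous_on {0..1} (\<lambda>t. \<nu> t i)" for i
    unfolding \<nu>_def
    by (intro continuous_on_diff continuous_on_sum continuous_on_scaleR pseudo_inner.continuous_on
        continuous_on_component Dc ec)
  have \<sigma>c: "continuous_on {0..1} \<sigma>"
    unfolding \<sigma>_def by (intro continuous_on_real_sqrt continuous_on_sum continuous_on_minus pseudo_inner.continuous_on \<nu>c)
  define Q where "Q t = horizontal_energy (e t)" for t
  have Qpos: "Q t > 0" if "t \<in> {0..1}" for t
    unfolding Q_def by (rule horizontal_energy_pos[OF orth[OF that]])
  define Q' where "Q' t = 2 * (\<Sum>i\<in>UNIV. fst (e t $ i) \<bullet> fst (D t $ i))" for t
  have Qd: "(Q has_real_derivative Q' t) (at t)" if t: "t \<in> {0..1}" for t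
  proof -
    have F: "((\<lambda>s. fst (e s $ i)) has_vector_derivative fst (D t $ i)) (at t)" for i
      by (rule bounded_linear.has_vector_derivative[OF bounded_linear_fst Di[OF t]])
    have "(Q has_vector_derivative (\<Sum>i\<in>UNIV. fst (e t $ i) \<bullet> fst (D t $ i) + fst (D t $ i) \<bullet> fst (e t $ i))) (at t)"
      unfolding Q_def horizontal_energy_def
      by (intro has_vector_derivative_sum bounded_bilinear.has_vector_derivative[OF bounded_bilinear_inner] F)
    moreover have "(\<Sum>i\<in>UNIV. fst (e t $ i) \<bullet> fst (D t $ i) + fst (D t $ i) \<bullet> fst (e t $ i)) = Q' t"
      by (simp add: Q'_def sum_distrib_left inner_commute)
    ultimately show ?thesis by (simp add: has_real_derivative_iff_has_vector_derivative)
  qed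
  have Q'_le: "Q' t \<le> 2 * Q t * \<sigma> t" if t: "t \<in> {0<..<1}" for t
  proof -
    have t': "t \<in> {0..1}" using t by auto
    let ?a = "\<lambda>i j. pseudo_inner (D t $ i) (e t $ j)"
    have anti: "?a i j = - ?a j i" for i j
      by (rule pseudo_orthonormal_derivative_antisymmetric[OF orth t D[OF t']])
    let ?s = "\<Sum>i\<in>UNIV. \<Sum>j\<in>UNIV. ?a i j * (fst (e t $ i) \<bullet> fst (e t $ j))"
    have "?s = (\<Sum>j\<in>UNIV. \<Sum>i\<in>UNIV. ?a i j * (fst (e t $ i) \<bullet> fst (e t $ j)))" by (rule sum.swap)
    also have "\<dots> = (\<Sum>j\<in>UNIV. \<Sum>i\<in>UNIV. - (?a j i * (fst (e t $ j) \<bullet> fst (e t $ i))))"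
      by (intro sum.cong refl) (subst anti, simp add: inner_commute)
    also have "\<dots> = - ?s" by (simp add: sum_negf)
    finally have s0: "?s = 0" by simp
    have "fst (D t $ i) = fst (\<nu> t i) + (\<Sum>j\<in>UNIV. ?a i j *\<^sub>R fst (e t $ j))" for i
      by (simp add: \<nu>_def fst_sum)
    then have "(\<Sum>i\<in>UNIV. fst (e t $ i) \<bullet> fst (D t $ i)) = (\<Sum>i\<in>UNIV. fst (e t $ i) \<bullet> fst (\<nu> t i)) + ?s"
      by (simp add: inner_add_right inner_sum_right sum.distrib)
    then have "Q' t = 2 * (\<Sum>i\<in>UNIV. fst (e t $ i) \<bullet> fst (\<nu> t i))"
      by (simp add: Q'_def s0)
    also have "(\<Sum>i\<in>UNIV. fst (e t $ i) \<bullet> fst (\<nu> t i)) \<le> (\<Sum>i\<in>UNIV. norm (fst (e t $ i)) * norm (fst (\<nu> t i)))"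
      by (intro sum_mono norm_cauchy_schwarz)
    also have "\<dots> \<le> sqrt ((\<Sum>i\<in>UNIV. (norm (fst (e t $ i)))\<^sup>2) * (\<Sum>i\<in>UNIV. (norm (fst (\<nu> t i)))\<^sup>2))"
      by (intro real_le_rsqrt Cauchy_Schwarz_ineq_sum)
    also have "\<dots> \<le> sqrt (Q t * (Q t * (\<Sum>i\<in>UNIV. - pseudo_inner (\<nu> t i) (\<nu> t i))))"
    proof (intro real_sqrt_le_mono mult_mono)
      show "(\<Sum>i\<in>UNIV. (norm (fst (e t $ i)))\<^sup>2) \<le> Q t"
        by (simp add: Q_def horizontal_energy_def dot_square_norm)
      have "\<nu> t i \<in> pseudo_orthogonal (frame_span (e t))" for i
      proof -
        have "pseudo_inner (\<nu> t i) (e t $ k) = 0" for k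
        proof -
          have "pseudo_inner (\<Sum>j\<in>UNIV. ?a i j *\<^sub>R e t $ j) (e t $ k) = (\<Sum>j\<in>UNIV. ?a i j * (if j = k then 1 else 0))"
            using orth[OF t'] unfolding pseudo_orthonormal_def by (simp add: pseudo_inner.sum_left pseudo_inner.scaleR_left)
          then show ?thesis by (simp add: \<nu>_def pseudo_inner.diff_left if_distrib cong: if_cong)
        qed
        then show ?thesis unfolding pseudo_orthogonal_def
          by (auto elim!: frame_span_sum simp: pseudo_inner.sum_right pseudo_inner.scaleR_right)
      qed
      then show "(\<Sum>i\<in>UNIV. (norm (fst (\<nu> t i)))\<^sup>2) \<le> Q t * (\<Sum>i\<in>UNIV. - pseudo_inner (\<nu> t i) (\<nu> t i))"
        unfolding sum_distrib_left Q_def dot_square_norm[symmetric]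
        by (intro sum_mono normal_horizontal_le orth t')
    qed (use Qpos[OF t'] in \<open>auto intro: sum_nonneg\<close>)
    also have "\<dots> = Q t * \<sigma> t"
    proof -
      have "Q t * (Q t * (\<Sum>i\<in>UNIV. - pseudo_inner (\<nu> t i) (\<nu> t i))) = (Q t)\<^sup>2 * (\<Sum>i\<in>UNIV. - pseudo_inner (\<nu> t i) (\<nu> t i))"
        by (simp add: power2_eq_square)
      then show ?thesis using Qpos[OF t'] by (simp only: real_sqrt_mult real_sqrt_abs \<sigma>_def)
    qed
    finally show ?thesis by simp
  qed
  \<comment> \<open>The bound for \<open>Q'\<close> is available in the open interval only, as antisymmetry comes from differentiating constraints that hold on the closed one.\<close>
  have "((\<lambda>t. Q' t / Q t) has_integral (ln (Q 1) - ln (Q 0))) {0..1}"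
  proof (rule fundamental_theorem_of_calculus)
    show "((\<lambda>t. ln (Q t)) has_vector_derivative Q' t / Q t) (at t within {0..1})" if "t \<in> {0..1}" for t
      using DERIV_chain2[OF DERIV_ln_divide[OF Qpos[OF that]] Qd[OF that]]
      by (simp add: has_real_derivative_iff_has_vector_derivative has_vector_derivative_at_within)
  qed simp
  moreover have "((\<lambda>t. 2 * grassmann_speed e t) has_integral (2 * grassmann_length e)) {0..1}"
  proof -
    have "grassmann_speed e integrable_on {0..1}"
      by (rule integrable_eq[OF integrable_continuous_real[OF \<sigma>c]]) (simp add: speed)
    then show ?thesis unfolding grassmann_length_def by (intro has_integral_mult_right integrable_integral)
  qed
  ultimately have "ln (Q 1) - ln (Q 0) \<le> 2 * grassmann_length e"
    unfolding has_integral_Icc_iff_Ioo[of "\<lambda>t. Q' t / Q t"] has_integral_Icc_iff_Ioo[of "\<lambda>t. 2 * grassmann_speed e t"]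
  proof (rule has_integral_le)
    show "Q' t / Q t \<le> 2 * grassmann_speed e t" if "t \<in> {0<..<1}" for t
      using Q'_le[OF that] Qpos[of t] speed[of t] that by (simp add: pos_divide_le_eq mult_ac)
  qed
  then have "ln (Q 1) \<le> ln (Q 0) + 2 * grassmann_length e" by simp
  then have "exp (ln (Q 1)) \<le> exp (ln (Q 0) + 2 * grassmann_length e)" by simp
  then show ?thesis using Qpos[of 0] Qpos[of 1] by (simp add: exp_add Q_def)
qed

lemma tangent_lift_dirderiv: "smooth u \<Longrightarrow> tangent_lift u x v = (v, dirderiv v u x)"
  by (simp add: tangent_lift_eq smooth_differentiable dirderiv_def)

lemma tangent_space_span:
  assumes "smooth u"
  shows "tangent_space u x = span (range (\<lambda>i. (axis i 1, dirderiv (axis i 1) u x)))" (is "_ = span (range ?f)")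
proof
  show "tangent_space u x \<subseteq> span (range ?f)"
  proof
    fix X assume "X \<in> tangent_space u x"
    then obtain v where X: "X = (v, dirderiv v u x)"
      by (auto simp: tangent_space_def tangent_lift_dirderiv[OF assms])
    have "X = (\<Sum>i\<in>UNIV. v $ i *\<^sub>R ?f i)"
      using axis_expansion[of v] linear_axis_expansion[OF linear_dirderiv[OF assms], of v x]
      by (simp add: X prod_eq_iff fst_sum snd_sum)
    then show "X \<in> span (range ?f)" by (elim ssubst) (intro span_sum span_scale span_base rangeI)
  qed
  have "subspace (tangent_space u x)"
  proof (rule subspaceI)
    show "0 \<in> tangent_space u x"
      unfolding tangent_space_def
      by (rule range_eqI[of _ _ 0]) (simp add: tangent_lift_dirderiv assms linear_0[OF linear_dirderiv] zero_prod_def)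
  qed (auto simp: tangent_space_def tangent_lift_dirderiv assms dirderiv_add[symmetric] dirderiv_scaleR[symmetric])
  moreover have "range ?f \<subseteq> tangent_space u x"
    by (auto simp: tangent_space_def tangent_lift_dirderiv assms)
  ultimately show "span (range ?f) \<subseteq> tangent_space u x" by (rule span_minimal[rotated])
qed

lemma spacelike_graph_norm_less:
  assumes u: "smooth u" and "spacelike_graph u" and "v \<noteq> 0"
  shows "norm (dirderiv v u x) < norm v"
proof -
  have "v \<bullet> (induced_metric u x *v v) = graph_metric u x v v"
  proof -
    have "v \<bullet> (induced_metric u x *v v) = (\<Sum>i\<in>UNIV. \<Sum>j\<in>UNIV. v $ i * v $ j * graph_metric u x (axis i 1) (axis j 1))"
      by (simp add: inner_vec_def matrix_vector_mult_def sum_distrib_left induced_metric_def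
          pseudo_inner_def tangent_lift_dirderiv[OF u] graph_metric_def mult_ac)
    then show ?thesis using graph_metric_expand[OF u] by metis
  qed
  then have "graph_metric u x v v > 0"
    using assms unfolding spacelike_graph_def by metis
  then show ?thesis by (simp add: graph_metric_def norm_lt)
qed

text \<open>
  The linear interpolation between the differentials at \<open>x\<close> and \<open>y\<close> stays a strict contraction, so its graphs are spacelike; orthonormalising their standard bases gives the frames.
\<close>

lemma tangent_spaces_joined_by_frames:
  assumes u: "smooth (u :: real^'m \<Rightarrow> real^'n)" and s: "spacelike_graph u"
  obtains e where "e C1_differentiable_on {0..1}" "\<forall>t\<in>{0..1}. pseudo_orthonormal (e t)"
    "frame_span (e 0) = tangent_space u x" "frame_span (e 1) = tangent_space u y"
proof -
  define f :: "'m \<Rightarrow> real \<Rightarrow> (real^'m) \<times> (real^'n)"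
    where "f i t = (axis i 1, dirderiv (axis i 1) u x) + t *\<^sub>R (0, dirderiv (axis i 1) u y - dirderiv (axis i 1) u x)" for i t
  have f01: "f i 0 = (axis i 1, dirderiv (axis i 1) u x)" "f i 1 = (axis i 1, dirderiv (axis i 1) u y)" for i
    by (simp_all add: f_def)
  have C1: "f i C1_differentiable_on {0..1}" for i
    unfolding f_def by (intro C1_differentiable_on_add C1_differentiable_on_scaleR) auto
  have pos: "pseudo_inner (\<Sum>i\<in>UNIV. c i *\<^sub>R f i t) (\<Sum>i\<in>UNIV. c i *\<^sub>R f i t) > 0"
    if t: "t \<in> {0..1}" and c: "\<exists>i\<in>UNIV. c i \<noteq> 0" for t c
  proof -
    let ?v = "(\<chi> i. c i) :: real^'m"
    have v: "?v = (\<Sum>i\<in>UNIV. c i *\<^sub>R axis i 1)"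
      using axis_expansion[of ?v] by simp
    have d: "dirderiv ?v u z = (\<Sum>i\<in>UNIV. c i *\<^sub>R dirderiv (axis i 1) u z)" for z
      using linear_axis_expansion[OF linear_dirderiv[OF u], of ?v z] by simp
    have nz: "?v \<noteq> 0" using c by (auto simp: vec_eq_iff)
    let ?w = "(1 - t) *\<^sub>R dirderiv ?v u x + t *\<^sub>R dirderiv ?v u y"
    have "(\<Sum>i\<in>UNIV. c i *\<^sub>R f i t) = (?v, ?w)"
    proof -
      have "?w = (\<Sum>i\<in>UNIV. c i *\<^sub>R (dirderiv (axis i 1) u x + t *\<^sub>R (dirderiv (axis i 1) u y - dirderiv (axis i 1) u x)))"
        unfolding d scaleR_sum_right sum.distrib[symmetric] by (intro sum.cong refl) (simp add: algebra_simps)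
      then show ?thesis using v by (simp add: f_def prod_eq_iff fst_sum snd_sum)
    qed
    moreover have "norm ?w < norm ?v"
    proof -
      have "norm ?w \<le> (1 - t) * norm (dirderiv ?v u x) + t * norm (dirderiv ?v u y)"
        using t by (intro order_trans[OF norm_triangle_ineq]) auto
      also have "\<dots> < norm ?v"
        using t by (intro convex_bound_lt spacelike_graph_norm_less[OF u s nz]) auto
      finally show ?thesis .
    qed
    ultimately show ?thesis by (simp add: pseudo_inner_def norm_lt)
  qed
  have "\<exists>e :: 'm \<Rightarrow> real \<Rightarrow> (real^'m) \<times> (real^'n). (\<forall>i\<in>UNIV. e i C1_differentiable_on {0..1}) \<and>
      (\<forall>t\<in>{0..1}. (\<forall>i\<in>UNIV. \<forall>j\<in>UNIV. pseudo_inner (e i t) (e j t) = (if i = j then 1 else 0)) \<and>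
         span (range (\<lambda>i. e i t)) = span (range (\<lambda>i. f i t)))"
    by (rule gram_schmidt_curves[where I = UNIV and f = f, OF bounded_bilinear_pseudo_inner pseudo_inner_commute finite])
      (rule C1, rule pos)
  then obtain e :: "'m \<Rightarrow> real \<Rightarrow> (real^'m) \<times> (real^'n)" where e: "\<And>i. e i C1_differentiable_on {0..1}"
    and orth: "\<And>t i j. t \<in> {0..1} \<Longrightarrow> pseudo_inner (e i t) (e j t) = (if i = j then 1 else 0)"
    and span: "\<And>t. t \<in> {0..1} \<Longrightarrow> span (range (\<lambda>i. e i t)) = span (range (\<lambda>i. f i t))"
    by blast
  show ?thesis
  proof (rule that[of "\<lambda>t. \<chi> i. e i t"])
    show "(\<lambda>t. \<chi> i. e i t) C1_differentiable_on {0..1}"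
    proof -
      have "\<exists>D. (\<forall>t\<in>{0..1}. (e i has_vector_derivative D t) (at t)) \<and> continuous_on {0..1} D" for i
        using e[of i] unfolding C1_differentiable_on_def by blast
      then obtain D where "\<And>i t. t \<in> {0..1} \<Longrightarrow> (e i has_vector_derivative D i t) (at t)"
        "\<And>i. continuous_on {0..1} (D i)" by metis
      then show ?thesis unfolding C1_differentiable_on_def
        by (intro exI[of _ "\<lambda>t. \<chi> i. D i t"]) (auto intro!: has_vector_derivative_vec continuous_on_vec_lambda)
    qed
    show "\<forall>t\<in>{0..1}. pseudo_orthonormal (\<chi> i. e i t)"
      using orth by (simp add: pseudo_orthonormal_def)
    have fs: "frame_span (\<chi> i. e i t) = span (range (\<lambda>i. f i t))" if "t \<in> {0..1}" for t
    proof -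
      have "range (($) (\<chi> i. e i t)) = range (\<lambda>i. e i t)" by auto
      then show ?thesis using span[OF that] by (simp add: frame_span_def)
    qed
    show "frame_span (\<chi> i. e i 0) = tangent_space u x" "frame_span (\<chi> i. e i 1) = tangent_space u y"
      by (simp_all add: fs f01 tangent_space_span[OF u])
  qed
qed

text \<open>
  A frame path from the tangent plane at \<open>0\<close> whose length exceeds the distance by at most \<open>1\<close> transports the bound for the horizontal energy to the tangent plane at \<open>x\<close>.
\<close>

lemma bounded_gauss_image_uniformly_spacelike:
  assumes u: "smooth (u :: real^'m \<Rightarrow> real^'n)" and s: "spacelike_graph u"
    and bdd: "grassmann_bounded (gauss_image u)"
  obtains K where "0 < K" "\<And>x v. v \<bullet> v \<le> K * graph_metric u x v v"
proof -
  obtain r where r: "\<And>P Q. P \<in> gauss_image u \<Longrightarrow> Q \<in> gauss_image u \<Longrightarrow> grassmann_dist P Q \<le> r"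
    using bdd unfolding grassmann_bounded_def by blast
  obtain e0 where "e0 C1_differentiable_on {0..1}" "\<forall>t\<in>{0..1}. pseudo_orthonormal (e0 t)"
    and base: "frame_span (e0 0) = tangent_space u 0" "frame_span (e0 1) = tangent_space u 0"
    using tangent_spaces_joined_by_frames[OF u s, of 0 0] by blast
  then have e0: "pseudo_orthonormal (e0 0)" "frame_span (e0 0) = tangent_space u 0" by simp_all
  define Q0 where "Q0 = horizontal_energy (e0 0)"
  have Q0: "Q0 > 0" unfolding Q0_def by (rule horizontal_energy_pos[OF e0(1)])
  define K where "K = real CARD('m) * Q0 * exp (2 * (r + 1))"
  have K: "K > 0" using Q0 by (simp add: K_def)
  have "v \<bullet> v \<le> K * graph_metric u x v v" for x v
  proof -
    let ?L = "{grassmann_length e | e.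
            e C1_differentiable_on {0..1} \<and> (\<forall>t\<in>{0..1}. pseudo_orthonormal (e t)) \<and>
            frame_span (e 0) = tangent_space u 0 \<and> frame_span (e 1) = tangent_space u x}"
    have "?L \<noteq> {}"
    proof -
      obtain e where "e C1_differentiable_on {0..1}" "\<forall>t\<in>{0..1}. pseudo_orthonormal (e t)"
        "frame_span (e 0) = tangent_space u 0" "frame_span (e 1) = tangent_space u x"
        using tangent_spaces_joined_by_frames[OF u s, of 0 x] by blast
      then have "grassmann_length e \<in> ?L" by (intro CollectI exI[of _ e]) simp
      then show ?thesis by (metis empty_iff)
    qed
    moreover have "Inf ?L < r + 1"
      using r[of "tangent_space u 0" "tangent_space u x"] by (simp add: gauss_image_def grassmann_dist_def)
    ultimately have "\<exists>l\<in>?L. l < r + 1" by (rule cInf_lessD)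
    then obtain e where e: "e C1_differentiable_on {0..1}" "\<And>t. t \<in> {0..1} \<Longrightarrow> pseudo_orthonormal (e t)"
      "frame_span (e 0) = tangent_space u 0" "frame_span (e 1) = tangent_space u x" "grassmann_length e < r + 1"
      by blast
    have "horizontal_energy (e 0) \<le> (\<Sum>i\<in>(UNIV::'m set). Q0)"
      unfolding horizontal_energy_def
    proof (rule sum_mono)
      fix i
      have "e 0 $ i \<in> frame_span (e 0)" unfolding frame_span_def by (intro span_base rangeI)
      then have "e 0 $ i \<in> frame_span (e0 0)" by (simp only: e(3) e0(2))
      from frame_span_horizontal_le[OF e0(1) this] show "fst (e 0 $ i) \<bullet> fst (e 0 $ i) \<le> Q0"
        using e(2)[of 0] by (simp add: pseudo_orthonormal_def Q0_def)
    qed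
    then have E0: "horizontal_energy (e 0) \<le> real CARD('m) * Q0" by simp
    have "horizontal_energy (e 1) \<le> horizontal_energy (e 0) * exp (2 * grassmann_length e)"
      by (rule horizontal_energy_growth[OF e(1,2)])
    also have "\<dots> \<le> real CARD('m) * Q0 * exp (2 * (r + 1))"
      using e(5) Q0 by (intro mult_mono E0) auto
    finally have E1: "horizontal_energy (e 1) \<le> K" by (simp add: K_def)
    have X: "(v, dirderiv v u x) \<in> frame_span (e 1)"
      unfolding e(4) tangent_space_def by (auto simp: tangent_lift_dirderiv[OF u])
    have g: "0 \<le> graph_metric u x v v"
      using spacelike_graph_norm_less[OF u s, of v x]
      by (cases "v = 0") (auto simp: graph_metric_def norm_lt linear_0[OF linear_dirderiv[OF u]] less_imp_le)
    have "v \<bullet> v \<le> horizontal_energy (e 1) * graph_metric u x v v"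
      using frame_span_horizontal_le[OF e(2) X] by (simp add: pseudo_inner_def graph_metric_def)
    also have "\<dots> \<le> K * graph_metric u x v v" using E1 g by (rule mult_right_mono)
    finally show ?thesis .
  qed
  with K that show ?thesis by blast
qed

section \<open>Solitons as graphs solving the translator equation\<close>

lemma second_fundamental_form_eq:
  assumes u: "smooth (u :: real^'m \<Rightarrow> real^'n)"
  shows "second_fundamental_form u x v w = normal_part (tangent_space u x) (0, dirderiv v (dirderiv w u) x)"
proof -
  have "((\<lambda>y. (w, dirderiv w u y)) has_derivative (\<lambda>v. (0, dirderiv v (dirderiv w u) x))) (at x)"
    by (intro has_derivative_Pair has_derivative_const smooth_has_derivative smooth_dirderiv u)
  then have "frechet_derivative (\<lambda>y. (w, dirderiv w u y)) (at x) = (\<lambda>v. (0, dirderiv v (dirderiv w u) x))"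
    by (rule frechet_derivative_at[symmetric])
  then show ?thesis unfolding second_fundamental_form_def tangent_lift_dirderiv[OF u] by simp
qed

lemma induced_metric_inverse:
  assumes u: "smooth (u :: real^'m \<Rightarrow> real^'n)" and s: "spacelike_graph u"
  shows "(\<chi> i j. graph_metric u x (axis i 1) (axis j 1)) ** matrix_inv (induced_metric u x) = mat 1"
proof -
  have "v = 0" if "induced_metric u x *v v = 0" for v
    using s that unfolding spacelike_graph_def by (metis inner_zero_right less_irrefl)
  then obtain B where "B ** induced_metric u x = mat 1"
    using matrix_left_invertible_ker[of "induced_metric u x"] by blast
  then have "\<exists>B. induced_metric u x ** B = mat 1 \<and> B ** induced_metric u x = mat 1"
    using matrix_left_right_inverse by blast
  then have "induced_metric u x ** matrix_inv (induced_metric u x) = mat 1"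
    unfolding matrix_inv_def by (rule someI2_ex) blast
  moreover have "(\<chi> i j. graph_metric u x (axis i 1) (axis j 1)) = induced_metric u x"
    by (simp add: induced_metric_def graph_metric_def pseudo_inner_def tangent_lift_dirderiv[OF u])
  ultimately show ?thesis by simp
qed

text \<open>
  The normal projection is linear, so \<open>H = T\<^sup>\<bottom>\<close> means that \<open>(0, \<Sum> G\<^sub>i\<^sub>j \<partial>\<^sub>i \<partial>\<^sub>j u) - T\<close> is tangent, that is, of the form \<open>(v, dirderiv v u x)\<close>. The horizontal component determines \<open>v = - fst T\<close>.
\<close>

lemma translator_equation_of_soliton:
  assumes u: "smooth (u :: real^'m \<Rightarrow> real^'n)" and s: "spacelike_graph u"
    and H: "mean_curvature u x = normal_part (tangent_space u x) T"
  shows "(\<Sum>i\<in>UNIV. \<Sum>j\<in>UNIV. matrix_inv (induced_metric u x) $ i $ j *\<^sub>R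
      dirderiv (axis i 1) (dirderiv (axis j 1) u) x) = snd T - dirderiv (fst T) u x"
proof -
  obtain f where "f C1_differentiable_on {0..1}" "\<forall>t\<in>{0..1}. pseudo_orthonormal (f t)"
    and base: "frame_span (f 0) = tangent_space u x" "frame_span (f 1) = tangent_space u x"
    using tangent_spaces_joined_by_frames[OF u s, of x x] by blast
  then obtain e where e: "pseudo_orthonormal e" and P: "frame_span e = tangent_space u x" by force
  have sub: "subspace (tangent_space u x)" unfolding tangent_space_span[OF u] by (rule subspace_span)
  define G where "G i j = matrix_inv (induced_metric u x) $ i $ j" for i j
  define \<pi> where "\<pi> w = (\<Sum>j\<in>UNIV. pseudo_inner w (e $ j) *\<^sub>R e $ j)" for w
  have n: "normal_part (tangent_space u x) w = w - \<pi> w" for w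
    unfolding P[symmetric] \<pi>_def by (rule normal_part_frame[OF e])
  have \<pi>_mem: "\<pi> w \<in> tangent_space u x" for w
    unfolding P[symmetric] \<pi>_def frame_span_def by (intro span_sum span_scale span_base rangeI)
  have lin: "linear (\<lambda>w. w - \<pi> w)"
    by (rule linearI) (simp_all add: \<pi>_def pseudo_inner.add_left pseudo_inner.scaleR_left
        scaleR_add_left sum.distrib scaleR_sum_right algebra_simps)
  define X where "X = (\<Sum>i\<in>UNIV. \<Sum>j\<in>UNIV. G i j *\<^sub>R (0 :: real^'m, dirderiv (axis i 1) (dirderiv (axis j 1) u) x))"
  have "mean_curvature u x = X - \<pi> X"
    unfolding X_def linear_sum[OF lin] linear_cmul[OF lin] mean_curvature_def
      second_fundamental_form_eq[OF u] n G_def by (rule refl)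
  with H have "X - T = \<pi> X - \<pi> T" by (simp add: n algebra_simps)
  also have "\<dots> \<in> tangent_space u x"
    by (rule subspace_diff[OF sub \<pi>_mem \<pi>_mem])
  finally obtain v where v: "X - T = (v, dirderiv v u x)"
    by (auto simp: tangent_space_def tangent_lift_dirderiv[OF u])
  have X: "fst X = 0" "snd X = (\<Sum>i\<in>UNIV. \<Sum>j\<in>UNIV. G i j *\<^sub>R dirderiv (axis i 1) (dirderiv (axis j 1) u) x)"
    by (simp_all add: X_def fst_sum snd_sum)
  have "v = - fst T" using arg_cong[OF v, of fst] X(1) by simp
  moreover have "snd X - snd T = dirderiv v u x" using arg_cong[OF v, of snd] by simp
  ultimately have "snd X = snd T - dirderiv (fst T) u x"
    by (simp add: linear_neg[OF linear_dirderiv[OF u]] algebra_simps)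
  then show ?thesis by (simp add: X(2) G_def)
qed

lemma affine_graph:
  assumes L: "linear L" and u: "\<And>x. u x = c + L x"
  shows "affine (entire_graph (u :: real^'m \<Rightarrow> real^'n)) \<and> aff_dim (entire_graph u) = int CARD('m)"
proof -
  let ?l = "\<lambda>x. (x, L x)"
  have l: "linear ?l"
    by (rule linearI) (simp_all add: linear_add[OF L] linear_cmul[OF L])
  have S: "subspace (range ?l)" using linear_subspace_image[OF l subspace_UNIV] .
  have eq: "entire_graph u = (+) (0, c) ` range ?l"
    by (auto simp: entire_graph_def graph_map_def u image_iff)
  have "inj ?l" by (auto simp: inj_on_def)
  then have "dim (range ?l) = CARD('m)"
    using dim_image_eq[OF l, of UNIV] by (simp add: dim_UNIV)
  then show ?thesis
    unfolding eq using S by (simp add: affine_translation[symmetric] subspace_imp_affine aff_dim_translation_eq aff_dim_subspace)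
qed

theorem corollary1:
  fixes u :: "real ^ 'm \<Rightarrow> real ^ 'n"
  assumes "\<And>\<alpha>. smooth (\<lambda>x. u x $ \<alpha>)"
    and "spacelike_translator u"
    and "grassmann_bounded (gauss_image u)"
  shows "affine (entire_graph u) \<and> aff_dim (entire_graph u) = int CARD('m)"
proof -
  have u: "smooth u" by (rule smooth_componentwise[OF assms(1)])
  obtain T where s: "spacelike_graph u"
    and T: "\<And>x. mean_curvature u x = normal_part (tangent_space u x) T"
    using assms(2) unfolding spacelike_translator_def by blast
  obtain K where K: "0 < K" "\<And>x v. v \<bullet> v \<le> K * graph_metric u x v v"
    using bounded_gauss_image_uniformly_spacelike[OF u s assms(3)] by blast
  interpret uniform_graph_translator u "\<lambda>x. matrix_inv (induced_metric u x)" "fst T" "snd T" K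
    by unfold_locales
      (use u K induced_metric_inverse[OF u s] translator_equation_of_soliton[OF u s T] in auto)
  show ?thesis
    by (rule affine_graph[OF linear_dirderiv[OF u] graph_function_affine])
qed

end
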